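(* Let $d\ge1$ and let $M\in\mathcal G$. (i) If $\rho_{\mathrm{HS}}(M)<1$, then $\Sigma_M$ is strongly stable (and hence locally strongly stable). (ii) If $\Sigma_M$ is locally strongly stable, then $\rho_{\mathrm{HS}}(M)\le 1$.
   Context: Fix an integer $d\ge 1$ and a norm $|\cdot|$ on $\mathbb R^d$; $\|\cdot\|$ is the induced matrix norm on the space $\mathcal M_d(\mathbb R)$ of real $d\times d$ matrices, $\mathrm{Id}$ is the identity matrix, $\mathrm{id}$ the identity map, $\rho(\cdot)$ the spectral radius, $\|\cdot\|_\infty$ the supremum norm. $\mathrm{NBV}([-1,0],\mathcal M_d(\mathbb R))$ is the set of functions $M:[-1,0]\to\mathcal M_d(\mathbb R)$ of bounded variation with $M(-1)=0$ and $M$ right-continuous on $(-1,0)$. Such $M$ correspond one-to-one to matrix-valued Borel measures $\mu_M$ on $[-1,0]$ (each entry a finite signed measure) via $M(t)=\mu_M([-1,t])$ for $t\in(-1,0]$. Integrals $\int_{-1}^0\cdots dM(\theta)$ are integrals over $[-1,0]$ with respect to $\mu_M$. Any notion defined for $M$ is also used for $\mu_M$ through this correspondence. System $\Sigma_M$: $x(t)=\int_{-1}^0 dM(\theta)\,x(t+\theta)$, $t\ge 0$. Solutions are continuous functions $x:[-1,+\infty)\to\mathbb R^d$ satisfying this for all $t\ge0$; write $x_t(\theta)=x(t+\theta)$, $\theta\in[-1,0]$; $x_0$ is the initial condition. Let $\mathcal C_0=\{\eta\in \mathcal C([-1,0],\mathbb R^d):\eta(0)=\int_{-1}^0 dM(\theta)\eta(\theta)\}$.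 Let $\mathcal W$ be the set of $M\in \mathrm{NBV}([-1,0],\mathcal M_d(\mathbb R))$ with $\det(\mathrm{Id}-(M(0)-M(0^-)))\ne0$; for $M\in\mathcal W$, every $\phi\in\mathcal C_0$ is the initial condition of a unique solution on $[-1,+\infty)$. Exponential rate, for $M\in\mathcal W$: $\omega_M$ is the infimum (in $[-\infty,+\infty)$) of the $\alpha\in\mathbb R$ for which there is $K>0$ such that for all $\phi\in\mathcal C_0$ the solution $x$ with $x_0=\phi$ satisfies $\|x_t\|_\infty\le Ke^{\alpha t}\|\phi\|_\infty$ for all $t\ge0$. $M$ is exponentially stable if $\omega_M<0$. Characteristic function: $\Delta_M(s)=\det\left(\mathrm{Id}-\int_{-1}^0 e^{s\theta}dM(\theta)\right)$, $s\in\mathbb C$. Spectral abscissa: $S_M=\sup\{\operatorname{Re}s:\Delta_M(s)=0\}$ ($=-\infty$ if there are no zeros). Set $\mathcal G=\{M\in\mathcal W: S_M=\omega_M\}$. $\rho_{\mathrm{HS}}(M)=\sup_{\xi}\rho\left(\int_{-1}^0 e^{i\xi(\theta)}dM(\theta)\right)$, the supremum being over all Borel-measurable $\xi:[-1,0]\to\mathbb R$. Let $\mathbf B$ be the set of Borel-measurable $\varphi:[-1,0]\to[-1,0]$, and let $\varphi_*\mu$ denote the pushforward, $\varphi_*\mu(A)=\mu(\varphi^{-1}(A))$. For $M\in\mathcal G$ with associated measure $\mu=\mu_M$: - $\Sigma_M$ is locally strongly stable if there exists $\epsilon>0$ such that $\varphi_*\mu$ is exponentially stable for all $\varphi\in\mathbf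 B$ with $\|\varphi-\mathrm{id}\|_\infty<\epsilon$ and $\varphi_*\mu\in\mathcal G$. - $\Sigma_M$ is strongly stable if $\varphi_*\mu$ is exponentially stable for all $\varphi\in\mathbf B$ with $\varphi_*\mu\in\mathcal G$. *)

theory Defs
  imports "HOL-Analysis.Analysis"
begin

definition is_norm :: "('v::real_vector \<Rightarrow> real) \<Rightarrow> bool" where
  "is_norm nrm \<longleftrightarrow>
     (\<forall>x. nrm x = 0 \<longleftrightarrow> x = 0) \<and>
     (\<forall>c x. nrm (c *\<^sub>R x) = \<bar>c\<bar> * nrm x) \<and>
     (\<forall>x y. nrm (x + y) \<le> nrm x + nrm y)"

definition sup_norm :: "('v \<Rightarrow> real) \<Rightarrow> (real \<Rightarrow> 'v) \<Rightarrow> real" where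
  "sup_norm nrm f = (SUP \<theta>\<in>{-1..0}. nrm (f \<theta>))"

definition spectral_radius :: "complex^'n^'n \<Rightarrow> real" where
  "spectral_radius A = Max {cmod k | k. \<exists>v. v \<noteq> 0 \<and> A *v v = k *s v}"


(* Real and matrix-valued measures on [-1,0] are set functions; the value 0 outside the
   Borel subsets of [-1,0] makes a measure a unique HOL function. *)

abbreviation borel_I :: "real measure" where
  "borel_I \<equiv> restrict_space borel {-1..0}"

definition vector_measure :: "(real set \<Rightarrow> 'v::real_normed_vector) \<Rightarrow> bool" where
  "vector_measure \<mu> \<longleftrightarrow>
     (\<forall>A. range A \<subseteq> sets borel_I \<and> disjoint_family A
          \<longrightarrow> (\<lambda>k::nat. \<mu> (A k)) sums \<mu> (\<Union>k. A k)) \<and>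
     (\<forall>A. A \<notin> sets borel_I \<longrightarrow> \<mu> A = 0)"

definition pushforward ::
    "(real \<Rightarrow> real) \<Rightarrow> (real set \<Rightarrow> 'v::real_normed_vector) \<Rightarrow> real set \<Rightarrow> 'v" where
  "pushforward \<phi> \<mu> A = (if A \<in> sets borel_I then \<mu> (\<phi> -` A \<inter> {-1..0}) else 0)"

(* Positive part of the Jordan decomposition; ennreal maps negative reals to 0, which does
   not affect the supremum because the empty set has measure 0. *)
definition pos_part :: "(real set \<Rightarrow> real) \<Rightarrow> real measure" where
  "pos_part \<nu> = measure_of {-1..0} (sets borel_I)
     (\<lambda>A. SUP B\<in>{B \<in> sets borel_I. B \<subseteq> A}. ennreal (\<nu> B))"

definition signed_integral ::
    "(real set \<Rightarrow> real) \<Rightarrow> (real \<Rightarrow> 'b::{banach, second_countable_topology}) \<Rightarrow> 'b" where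
  "signed_integral \<nu> f =
     integral\<^sup>L (pos_part \<nu>) f - integral\<^sup>L (pos_part (\<lambda>A. - \<nu> A)) f"


(* The choice of the norm on matrices is immaterial here: all of them are equivalent. *)
definition bounded_variation :: "(real \<Rightarrow> 'v::real_normed_vector) \<Rightarrow> bool" where
  "bounded_variation f \<longleftrightarrow>
     (\<exists>C. \<forall>(n::nat) t. (\<forall>k\<le>n. t k \<in> {-1..0}) \<and> (\<forall>k<n. t k \<le> t (Suc k))
          \<longrightarrow> (\<Sum>k<n. norm (f (t (Suc k)) - f (t k))) \<le> C)"

(* Values of M outside [-1,0] are irrelevant throughout. *)
definition NBV :: "(real \<Rightarrow> real^'n^'n) set" where
  "NBV = {M. bounded_variation M \<and> M (-1) = 0 \<and>
             (\<forall>t\<in>{-1<..<0}. continuous (at_right t) M)}"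

definition measure_of_nbv :: "(real \<Rightarrow> real^'n^'n) \<Rightarrow> real set \<Rightarrow> real^'n^'n" where
  "measure_of_nbv M = (THE \<mu>. vector_measure \<mu> \<and> (\<forall>t\<in>{-1<..0}. \<mu> {-1..t} = M t))"

definition nbv_of_measure :: "(real set \<Rightarrow> real^'n^'n) \<Rightarrow> real \<Rightarrow> real^'n^'n" where
  "nbv_of_measure \<mu> t = (if t \<in> {-1<..0} then \<mu> {-1..t} else 0)"

definition integral_vec :: "(real \<Rightarrow> real^'n^'n) \<Rightarrow> (real \<Rightarrow> real^'n) \<Rightarrow> real^'n" where
  "integral_vec M \<eta> =
     (\<chi> i. \<Sum>j\<in>UNIV. signed_integral (\<lambda>A. measure_of_nbv M A $ i $ j) (\<lambda>\<theta>. \<eta> \<theta> $ j))"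

definition integral_scal :: "(real \<Rightarrow> real^'n^'n) \<Rightarrow> (real \<Rightarrow> complex) \<Rightarrow> complex^'n^'n" where
  "integral_scal M f =
     (\<chi> i j. signed_integral (\<lambda>A. measure_of_nbv M A $ i $ j) f)"


definition solution :: "(real \<Rightarrow> real^'n^'n) \<Rightarrow> (real \<Rightarrow> real^'n) \<Rightarrow> bool" where
  "solution M x \<longleftrightarrow>
     continuous_on {-1..} x \<and> (\<forall>t\<ge>0. x t = integral_vec M (\<lambda>\<theta>. x (t + \<theta>)))"

definition C0 :: "(real \<Rightarrow> real^'n^'n) \<Rightarrow> (real \<Rightarrow> real^'n) set" where
  "C0 M = {\<eta>. continuous_on {-1..0} \<eta> \<and> \<eta> 0 = integral_vec M \<eta>}"

definition W :: "(real \<Rightarrow> real^'n^'n) set" where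
  "W = {M \<in> NBV. det (mat 1 - (M 0 - Lim (at_left 0) M)) \<noteq> 0}"

definition omega :: "(real^'n \<Rightarrow> real) \<Rightarrow> (real \<Rightarrow> real^'n^'n) \<Rightarrow> ereal" where
  "omega nrm M = Inf {ereal \<alpha> | \<alpha>. \<exists>K>0. \<forall>\<phi>\<in>C0 M. \<forall>x.
      solution M x \<and> (\<forall>\<theta>\<in>{-1..0}. x \<theta> = \<phi> \<theta>) \<longrightarrow>
      (\<forall>t\<ge>0. sup_norm nrm (\<lambda>\<theta>. x (t + \<theta>)) \<le> K * exp (\<alpha> * t) * sup_norm nrm \<phi>)}"

definition exponentially_stable ::
    "(real^'n \<Rightarrow> real) \<Rightarrow> (real \<Rightarrow> real^'n^'n) \<Rightarrow> bool" where
  "exponentially_stable nrm M \<longleftrightarrow> omega nrm M < 0"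

definition char_fun :: "(real \<Rightarrow> real^'n^'n) \<Rightarrow> complex \<Rightarrow> complex" where
  "char_fun M s = det (mat 1 - integral_scal M (\<lambda>\<theta>. exp (s * of_real \<theta>)))"

definition spectral_abscissa :: "(real \<Rightarrow> real^'n^'n) \<Rightarrow> ereal" where
  "spectral_abscissa M = Sup {ereal (Re s) | s. char_fun M s = 0}"

definition G :: "(real^'n \<Rightarrow> real) \<Rightarrow> (real \<Rightarrow> real^'n^'n) set" where
  "G nrm = {M \<in> W. spectral_abscissa M = omega nrm M}"

definition rho_HS :: "(real \<Rightarrow> real^'n^'n) \<Rightarrow> ereal" where
  "rho_HS M = (SUP \<xi>\<in>borel_measurable borel_I.
      ereal (spectral_radius (integral_scal M (\<lambda>\<theta>. exp (\<i> * of_real (\<xi> \<theta>))))))"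


definition pushforward_nbv :: "(real \<Rightarrow> real) \<Rightarrow> (real \<Rightarrow> real^'n^'n) \<Rightarrow> real \<Rightarrow> real^'n^'n" where
  "pushforward_nbv \<phi> M = nbv_of_measure (pushforward \<phi> (measure_of_nbv M))"

definition locally_strongly_stable ::
    "(real^'n \<Rightarrow> real) \<Rightarrow> (real \<Rightarrow> real^'n^'n) \<Rightarrow> bool" where
  "locally_strongly_stable nrm M \<longleftrightarrow>
     (\<exists>\<epsilon>>0. \<forall>\<phi>\<in>measurable borel_I borel_I.
        sup_norm abs (\<lambda>\<theta>. \<phi> \<theta> - \<theta>) < \<epsilon> \<and> pushforward_nbv \<phi> M \<in> G nrm
        \<longrightarrow> exponentially_stable nrm (pushforward_nbv \<phi> M))"

definition strongly_stable ::
    "(real^'n \<Rightarrow> real) \<Rightarrow> (real \<Rightarrow> real^'n^'n) \<Rightarrow> bool" where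
  "strongly_stable nrm M \<longleftrightarrow>
     (\<forall>\<phi>\<in>measurable borel_I borel_I.
        pushforward_nbv \<phi> M \<in> G nrm
        \<longrightarrow> exponentially_stable nrm (pushforward_nbv \<phi> M))"

end

theory Submission
  imports Defs "HOL-Complex_Analysis.Complex_Analysis" "HOL-Computational_Algebra.Fundamental_Theorem_Algebra"
begin

text \<open>
  \<^bold>\<open>Part (i).\<close> A zero \<open>s\<close> of the characteristic function of \<open>\<phi>\<^sub>*\<mu>\<close> with \<open>Re s \<ge> -\<delta>\<close> makes \<open>Id - w \<integral> z dM\<close>
  singular for some \<open>z\<close> with \<open>|z| \<le> 1\<close> and some \<open>w\<close> slightly larger than \<open>1\<close>. By \<open>\<rho>\<^sub>H\<^sub>S < 1\<close> this does not happen for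
  unimodular \<open>z\<close> as long as \<open>|w| < R\<close>, where \<open>R > 1\<close>. For a simple function \<open>z\<close> the determinant is a polynomial in each
  value of \<open>z\<close> separately; letting \<open>w\<close> grow from \<open>0\<close>, zeros inside the unit disc can only enter through the
  unit circle, so there are none. The general case follows by approximation and Hurwitz' theorem.

  \<^bold>\<open>Part (ii).\<close> If \<open>\<phi>\<close> takes values in \<open>{-k/N | 0 < k < N}\<close>, the pushed system is a linear recursion with step
  \<open>1/N\<close>, and comparing generating functions with Cauchy's inequality gives \<open>S = \<omega>\<close>: it lies in \<open>G\<close>.
  Let \<open>\<integral> e\<^bsup>i\<xi>\<^esup> dM\<close> have an eigenvalue outside the unit circle and let \<open>\<psi> < 0\<close> be close to the identity. As \<open>\<sigma>\<close>
  increases, that eigenvalue of \<open>\<integral> e\<^bsup>i\<xi>\<^esup>e\<^bsup>\<sigma>\<psi>\<^esup> dM\<close> must cross the circle; shifting \<open>\<xi>\<close> by a constant, it crosses at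
  \<open>1\<close> for some \<open>\<sigma> > 0\<close>. Lattice valued maps \<open>\<phi>\<^sub>m \<rightarrow> \<psi>\<close> with \<open>2\<pi>m\<phi>\<^sub>m \<approx> \<xi>\<close> modulo \<open>2\<pi>\<close> then have characteristic functions
  that, near \<open>\<sigma> + 2\<pi>im\<close>, approach a function vanishing at \<open>\<sigma>\<close>, so by Hurwitz' theorem they have zeros
  in the right half plane.
\<close>

text \<open>Zeros of the characteristic function control solutions only through membership in
  \<open>G\<close>. For (i) it is therefore enough to bound \<open>spectral_abscissa\<close> below
  0, whereas in (ii) a destabilising map is of use only if its pushforward is proved to lie in
  \<open>G\<close>; hence the choice of commensurable delays. Excluding the delay 0 leaves no jump
  at 0, hence membership in \<open>W\<close>, and makes the equation an explicit recursion. The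
  equality S = \<omega> is established for S > 0, the case that occurs. In (i) the margin R > 1
  matters because a supremum of negative real parts may be 0. In (ii) the crossing has to occur at a
  strictly positive \<sigma>: the integrands are controlled for Re \<ge> 0 only, and Hurwitz'
  theorem needs an open set. The height 2 pi m enters because a displacement of a delay by order 1/m
  disappears in the limit of the maps, yet changes the phase at that height by order 1. Keeping
  \<psi> away from 0 gives decay as \<sigma> grows; keeping it away from both ends leaves room for
  rounding.\<close>

no_notation fps_nth (infixl "$" 75)

section \<open>Signed measures on \<open>[-1,0]\<close>\<close>

text \<open>Signed measures are carried as explicit differences of finite measures: bounded
  variation delivers this form, it survives pushforward, and the Hahn decomposition of a pair of
  finite measures yields the Jordan parts from it.\<close>

definition diff_of_measures :: "(real set \<Rightarrow> real) \<Rightarrow> real measure \<Rightarrow> real measure \<Rightarrow> bool" where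
  "diff_of_measures \<nu> m1 m2 \<longleftrightarrow>
     finite_measure m1 \<and> finite_measure m2 \<and> sets m1 = sets borel_I \<and> sets m2 = sets borel_I \<and>
     (\<forall>A\<in>sets borel_I. \<nu> A = measure m1 A - measure m2 A)"

lemma space_borel_I [simp]: "space borel_I = {-1..0}"
  by (simp add: space_restrict_space)

lemma sets_borel_I_iff: "A \<in> sets borel_I \<longleftrightarrow> A \<in> sets borel \<and> A \<subseteq> {-1..0}"
  by (subst sets_restrict_space_iff) auto

lemma diff_of_measures_uminus:
  "diff_of_measures \<nu> m1 m2 \<Longrightarrow> diff_of_measures (\<lambda>A. - \<nu> A) m2 m1"
  by (auto simp: diff_of_measures_def)

lemma diff_of_measures_sums:
  assumes "diff_of_measures \<nu> m1 m2" "range A \<subseteq> sets borel_I" "disjoint_family A"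
  shows "(\<lambda>k::nat. \<nu> (A k)) sums \<nu> (\<Union>k. A k)"
proof -
  interpret m1: finite_measure m1 using assms by (simp add: diff_of_measures_def)
  interpret m2: finite_measure m2 using assms by (simp add: diff_of_measures_def)
  have s: "sets m1 = sets borel_I" "sets m2 = sets borel_I"
    using assms by (auto simp: diff_of_measures_def)
  have U: "(\<Union>k. A k) \<in> sets borel_I" using assms(2) by blast
  have "(\<lambda>k. measure m1 (A k) - measure m2 (A k)) sums (measure m1 (\<Union>k. A k) - measure m2 (\<Union>k. A k))"
    using assms s by (intro sums_diff m1.finite_measure_UNION m2.finite_measure_UNION) auto
  moreover have "\<nu> (A k) = measure m1 (A k) - measure m2 (A k)" for k
    using assms by (auto simp: diff_of_measures_def)
  ultimately show ?thesis using assms(1) U by (auto simp: diff_of_measures_def)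
qed

lemma diff_of_measures_Un:
  assumes "diff_of_measures \<nu> m1 m2" "A \<in> sets borel_I" "B \<in> sets borel_I" "A \<inter> B = {}"
  shows "\<nu> (A \<union> B) = \<nu> A + \<nu> B"
proof -
  interpret m1: finite_measure m1 using assms by (simp add: diff_of_measures_def)
  interpret m2: finite_measure m2 using assms by (simp add: diff_of_measures_def)
  have "A \<union> B \<in> sets borel_I" using assms by blast
  then show ?thesis
    using assms m1.finite_measure_Union[of A B] m2.finite_measure_Union[of A B]
    by (auto simp: diff_of_measures_def)
qed

lemma diff_of_measures_Int_Diff:
  assumes "diff_of_measures \<nu> m1 m2" "A \<in> sets borel_I" "Y \<in> sets borel_I"
  shows "\<nu> A = \<nu> (A \<inter> Y) + \<nu> (A - Y)"
proof -
  have "\<nu> ((A \<inter> Y) \<union> (A - Y)) = \<nu> (A \<inter> Y) + \<nu> (A - Y)"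
    using assms by (intro diff_of_measures_Un[OF assms(1)]) auto
  moreover have "(A \<inter> Y) \<union> (A - Y) = A" by auto
  ultimately show ?thesis by simp
qed

section \<open>Jordan decomposition\<close>

lemma sets_pos_part [simp]: "sets (pos_part \<nu>) = sets borel_I"
  unfolding pos_part_def
  by (rule trans[OF sets_measure_of[OF sets.space_closed[of borel_I, unfolded space_borel_I]]
        sets.sigma_sets_eq[of borel_I, unfolded space_borel_I]])

lemma space_pos_part [simp]: "space (pos_part \<nu>) = {-1..0}"
  using sets_eq_imp_space_eq[OF sets_pos_part, of \<nu>] by simp

text \<open>The supremum in \<open>pos_part\<close> is attained at the part of \<open>A\<close> in
  the positive set \<open>Y\<close>: for \<open>B\<close> inside \<open>A\<close>, discarding
  \<open>B - Y\<close> does not decrease \<nu>, and enlarging \<open>B \<inter> Y\<close> to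
  \<open>A \<inter> Y\<close> adds a nonnegative amount.\<close>

lemma emeasure_pos_part:
  assumes \<nu>: "diff_of_measures \<nu> m1 m2" and Y: "Y \<in> sets borel_I"
    and pos: "\<And>X. X \<in> sets borel_I \<Longrightarrow> X \<subseteq> Y \<Longrightarrow> 0 \<le> \<nu> X"
    and neg: "\<And>X. X \<in> sets borel_I \<Longrightarrow> X \<inter> Y = {} \<Longrightarrow> \<nu> X \<le> 0"
    and A: "A \<in> sets borel_I"
  shows "emeasure (pos_part \<nu>) A = ennreal (\<nu> (A \<inter> Y))"
proof -
  have sup: "(SUP B\<in>{B \<in> sets borel_I. B \<subseteq> A}. ennreal (\<nu> B)) = ennreal (\<nu> (A \<inter> Y))"
    if A: "A \<in> sets borel_I" for A
  proof (rule antisym)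
    show "(SUP B\<in>{B \<in> sets borel_I. B \<subseteq> A}. ennreal (\<nu> B)) \<le> ennreal (\<nu> (A \<inter> Y))"
    proof (rule SUP_least)
      fix B assume B: "B \<in> {B \<in> sets borel_I. B \<subseteq> A}"
      have "\<nu> B = \<nu> (B \<inter> Y) + \<nu> (B - Y)"
        using diff_of_measures_Int_Diff[OF \<nu> _ Y] B by auto
      moreover have "\<nu> (B - Y) \<le> 0" using B Y by (intro neg) auto
      moreover have "\<nu> (A \<inter> Y) = \<nu> ((A \<inter> Y) \<inter> (B \<inter> Y)) + \<nu> ((A \<inter> Y) - (B \<inter> Y))"
        using diff_of_measures_Int_Diff[OF \<nu>, of "A \<inter> Y" "B \<inter> Y"] A B Y by auto
      moreover have "(A \<inter> Y) \<inter> (B \<inter> Y) = B \<inter> Y" using B by auto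
      moreover have "\<nu> ((A \<inter> Y) - (B \<inter> Y)) \<ge> 0" using A B Y by (intro pos) auto
      ultimately show "ennreal (\<nu> B) \<le> ennreal (\<nu> (A \<inter> Y))"
        by (intro ennreal_leI) auto
    qed
    show "ennreal (\<nu> (A \<inter> Y)) \<le> (SUP B\<in>{B \<in> sets borel_I. B \<subseteq> A}. ennreal (\<nu> B))"
      using A Y by (intro SUP_upper) auto
  qed
  have sa: "sigma_algebra {-1..0} (sets borel_I)"
    using sets.sigma_algebra_axioms[of borel_I] by simp
  have e: "\<nu> {} = 0" using \<nu> by (auto simp: diff_of_measures_def)
  \<comment> \<open>\<open>measure_of\<close> returns the prescribed set function only if it is
    positive and countably additive; both follow from the closed form \<open>sup\<close>.\<close>
  have "countably_additive (sets borel_I) (\<lambda>A. SUP B\<in>{B \<in> sets borel_I. B \<subseteq> A}. ennreal (\<nu> B))"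
  proof (rule countably_additiveI)
    fix A :: "nat \<Rightarrow> real set"
    assume r: "range A \<subseteq> sets borel_I" and d: "disjoint_family A" and U: "(\<Union>i. A i) \<in> sets borel_I"
    have Ak: "A k \<in> sets borel_I" for k using r by auto
    have "(\<lambda>k. \<nu> (A k \<inter> Y)) sums \<nu> (\<Union>k. A k \<inter> Y)"
      using Ak Y d by (intro diff_of_measures_sums[OF \<nu>]) (auto simp: disjoint_family_on_def)
    moreover have "0 \<le> \<nu> (A k \<inter> Y)" for k using Ak Y by (intro pos) auto
    ultimately have "(\<Sum>k. ennreal (\<nu> (A k \<inter> Y))) = ennreal (\<nu> (\<Union>k. A k \<inter> Y))"
      by (intro suminf_ennreal_eq)
    then show "(\<Sum>i. SUP B\<in>{B \<in> sets borel_I. B \<subseteq> A i}. ennreal (\<nu> B)) =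
          (SUP B\<in>{B \<in> sets borel_I. B \<subseteq> (\<Union>i. A i)}. ennreal (\<nu> B))"
      by (simp only: sup[OF Ak] sup[OF U] Int_UN_distrib2) simp
  qed
  moreover have "positive (sets borel_I) (\<lambda>A. SUP B\<in>{B \<in> sets borel_I. B \<subseteq> A}. ennreal (\<nu> B))"
    using sup[of "{}"] e by (auto simp: positive_def)
  ultimately have "emeasure (pos_part \<nu>) A = (SUP B\<in>{B \<in> sets borel_I. B \<subseteq> A}. ennreal (\<nu> B))"
    unfolding pos_part_def using emeasure_measure_of_sigma[OF sa _ _ A] by blast
  then show ?thesis using sup[OF A] by simp
qed

text \<open>A Hahn set for the pair \<open>m1\<close>, \<open>m2\<close> is positive for \<nu>, and
  its complement is positive for -\<nu>; so the two suprema are \<nu>(A \<inter> Y) and -\<nu>(A -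
  Y).\<close>

lemma jordan_decomposition:
  assumes \<nu>: "diff_of_measures \<nu> m1 m2"
  shows "diff_of_measures \<nu> (pos_part \<nu>) (pos_part (\<lambda>A. - \<nu> A))"
proof -
  have s: "sets m1 = sets borel_I" "sets m2 = sets borel_I" and f: "finite_measure m1" "finite_measure m2"
    using \<nu> by (auto simp: diff_of_measures_def)
  obtain Y where Y: "Y \<in> sets borel_I"
    and Y1: "\<And>X. X \<in> sets borel_I \<Longrightarrow> X \<subseteq> Y \<Longrightarrow> m2 X \<le> m1 X"
    and Y2: "\<And>X. X \<in> sets borel_I \<Longrightarrow> X \<inter> Y = {} \<Longrightarrow> m1 X \<le> m2 X"
    using finite_unsigned_Hahn_decomposition[OF f] unfolding s by metis
  interpret m1: finite_measure m1 using \<nu> by (simp add: diff_of_measures_def)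
  interpret m2: finite_measure m2 using \<nu> by (simp add: diff_of_measures_def)
  have val: "\<nu> A = measure m1 A - measure m2 A" if "A \<in> sets borel_I" for A
    using \<nu> that by (simp add: diff_of_measures_def)
  have pos: "0 \<le> \<nu> X" if "X \<in> sets borel_I" "X \<subseteq> Y" for X
    using Y1[OF that] val[OF that(1)] by (simp add: m1.emeasure_eq_measure m2.emeasure_eq_measure)
  have neg: "\<nu> X \<le> 0" if "X \<in> sets borel_I" "X \<inter> Y = {}" for X
    using Y2[OF that] val[OF that(1)] by (simp add: m1.emeasure_eq_measure m2.emeasure_eq_measure)
  have P: "emeasure (pos_part \<nu>) A = ennreal (\<nu> (A \<inter> Y))" if "A \<in> sets borel_I" for A
    using emeasure_pos_part[OF \<nu> Y pos neg that] .
  let ?Z = "space borel_I - Y"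
  have Z: "?Z \<in> sets borel_I" using Y by blast
  have N: "emeasure (pos_part (\<lambda>A. - \<nu> A)) A = ennreal (- \<nu> (A \<inter> ?Z))" if "A \<in> sets borel_I" for A
  proof (rule emeasure_pos_part[OF diff_of_measures_uminus[OF \<nu>] Z _ _ that])
    fix X assume X: "X \<in> sets borel_I"
    show "X \<subseteq> ?Z \<Longrightarrow> 0 \<le> - \<nu> X" using neg[OF X] by auto
    have "X \<subseteq> {-1..0}" using X by (simp add: sets_borel_I_iff)
    then show "X \<inter> ?Z = {} \<Longrightarrow> - \<nu> X \<le> 0" using pos[OF X] by auto
  qed
  have fin: "finite_measure (pos_part \<nu>)" "finite_measure (pos_part (\<lambda>A. - \<nu> A))"
    using P[OF sets.top] N[OF sets.top] by (intro finite_measureI; simp)+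
  have "\<nu> A = measure (pos_part \<nu>) A - measure (pos_part (\<lambda>A. - \<nu> A)) A" if A: "A \<in> sets borel_I" for A
  proof -
    have eq: "A \<inter> ({-1..0} - Y) = A - Y" using A unfolding sets_borel_I_iff by blast
    have "0 \<le> \<nu> (A \<inter> Y)" by (rule pos[OF sets.Int[OF A Y]]) blast
    moreover have "\<nu> (A \<inter> ?Z) \<le> 0" by (rule neg[OF sets.Int[OF A Z]]) blast
    ultimately have "0 \<le> \<nu> (A \<inter> Y)" "\<nu> (A - Y) \<le> 0" by (simp_all add: eq)
    then show ?thesis
      using P[OF A] N[OF A] diff_of_measures_Int_Diff[OF \<nu> A Y]
      by (simp add: measure_def eq)
  qed
  with fin show ?thesis unfolding diff_of_measures_def sets_pos_part by blast
qed

section \<open>Integration against signed measures\<close>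

lemma integral_simple_function_compose:
  fixes g :: "real \<Rightarrow> 'a" and c :: "'a \<Rightarrow> 'b::{banach, second_countable_topology}"
  assumes "finite_measure m" "sets m = sets borel_I" "simple_function borel_I g"
  shows "integral\<^sup>L m (\<lambda>x. c (g x)) = (\<Sum>v\<in>g ` {-1..0}. measure m (g -` {v} \<inter> {-1..0}) *\<^sub>R c v)"
proof -
  interpret finite_measure m by fact
  have sp: "space m = {-1..0}" using sets_eq_imp_space_eq[OF assms(2)] by simp
  have fin: "finite (g ` {-1..0})" using simple_functionD(1)[OF assms(3)] by simp
  have ms: "g -` {v} \<inter> {-1..0} \<in> sets m" for v
    using simple_functionD(2)[OF assms(3), of "{v}"] assms(2) by simp
  have "integral\<^sup>L m (\<lambda>x. c (g x)) =
      integral\<^sup>L m (\<lambda>x. \<Sum>v\<in>g ` {-1..0}. indicator (g -` {v} \<inter> {-1..0}) x *\<^sub>R c v)"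
  proof (rule Bochner_Integration.integral_cong[OF refl])
    fix x assume x: "x \<in> space m"
    have "(\<Sum>v\<in>g ` {-1..0}. indicator (g -` {v} \<inter> {-1..0}) x *\<^sub>R c v) =
        (\<Sum>v\<in>{g x}. indicator (g -` {v} \<inter> {-1..0}) x *\<^sub>R c v)"
      using fin x sp by (intro sum.mono_neutral_right) (auto simp: indicator_def)
    also have "\<dots> = c (g x)" using x sp by (simp add: indicator_def)
    finally show "c (g x) = (\<Sum>v\<in>g ` {-1..0}. indicator (g -` {v} \<inter> {-1..0}) x *\<^sub>R c v)" by (rule sym)
  qed
  also have "\<dots> = (\<Sum>v\<in>g ` {-1..0}. measure m (g -` {v} \<inter> {-1..0}) *\<^sub>R c v)"
    using ms by (subst Bochner_Integration.integral_sum) (auto simp: emeasure_eq_measure less_top[symmetric])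
  finally show ?thesis .
qed

definition bounded_measurable :: "(real \<Rightarrow> 'b::{banach, second_countable_topology}) \<Rightarrow> bool" where
  "bounded_measurable f \<longleftrightarrow> f \<in> borel_measurable borel_I \<and> (\<exists>B. \<forall>x\<in>{-1..0}. norm (f x) \<le> B)"

lemma bounded_measurableI:
  "f \<in> borel_measurable borel_I \<Longrightarrow> (\<And>x. x \<in> {-1..0} \<Longrightarrow> norm (f x) \<le> B) \<Longrightarrow> bounded_measurable f"
  unfolding bounded_measurable_def by blast

lemma integrable_bounded_measurable:
  assumes "bounded_measurable f" "finite_measure m" "sets m = sets borel_I"
  shows "integrable m f"
proof -
  interpret finite_measure m by fact
  have sp: "space m = {-1..0}" using sets_eq_imp_space_eq[OF assms(3)] by simp
  obtain B where B: "\<And>x. x \<in> {-1..0} \<Longrightarrow> norm (f x) \<le> B" "f \<in> borel_measurable borel_I"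
    using assms(1) unfolding bounded_measurable_def by blast
  have "f \<in> borel_measurable m" using B(2) assms(3) by (simp cong: measurable_cong_sets)
  then show ?thesis using B(1) sp by (intro integrable_const_bound[where B=B]) auto
qed

lemma integral_bounded_convergence:
  fixes f :: "real \<Rightarrow> 'b::{banach, second_countable_topology}"
  assumes "finite_measure m" "sets m = sets borel_I"
    and "f \<in> borel_measurable borel_I" "\<And>k. s k \<in> borel_measurable borel_I"
    and "\<And>x. x \<in> {-1..0} \<Longrightarrow> (\<lambda>k::nat. s k x) \<longlonglongrightarrow> f x"
    and "\<And>k x. x \<in> {-1..0} \<Longrightarrow> norm (s k x) \<le> B"
  shows "(\<lambda>k. integral\<^sup>L m (s k)) \<longlonglongrightarrow> integral\<^sup>L m f"
proof (rule Bochner_Integration.integral_dominated_convergence[where w = "\<lambda>_. B"])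
  have sp: "space m = {-1..0}" using sets_eq_imp_space_eq[OF assms(2)] by simp
  show "f \<in> borel_measurable m" "\<And>k. s k \<in> borel_measurable m"
    using assms by (simp_all cong: measurable_cong_sets)
  show "integrable m (\<lambda>_. B)" using assms(1) by (simp add: finite_measure.integrable_const)
  show "AE x in m. (\<lambda>i. s i x) \<longlonglongrightarrow> f x" "\<And>i. AE x in m. norm (s i x) \<le> B"
    using assms sp by (auto intro!: AE_I2)
qed

text \<open>On simple functions both sides depend on the values of \<nu> alone, so every
  representing pair gives the same integral; bounded convergence extends this to bounded measurable
  functions. Later computations may thus leave the Jordan parts aside.\<close>

lemma signed_integral_eq_diff:
  assumes \<nu>: "diff_of_measures \<nu> m1 m2" and f: "bounded_measurable f"
  shows "signed_integral \<nu> f = integral\<^sup>L m1 f - integral\<^sup>L m2 f"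
proof -
  have diff: "integral\<^sup>L p g - integral\<^sup>L n g =
      (\<Sum>v\<in>g ` {-1..0}. \<nu> (g -` {v} \<inter> {-1..0}) *\<^sub>R v)"
    if "diff_of_measures \<nu> p n" "simple_function borel_I g" for p n and g :: "real \<Rightarrow> 'a"
  proof -
    have "g -` {v} \<inter> {-1..0} \<in> sets borel_I" for v
      using simple_functionD(2)[OF that(2), of "{v}"] by simp
    then have "\<nu> (g -` {v} \<inter> {-1..0}) = measure p (g -` {v} \<inter> {-1..0}) - measure n (g -` {v} \<inter> {-1..0})" for v
      using that(1) by (simp add: diff_of_measures_def)
    then show ?thesis
      using that by (simp add: integral_simple_function_compose[where c="\<lambda>v. v"] diff_of_measures_def scaleR_diff_left sum_subtractf)
  qed
  obtain B where B: "\<And>x. x \<in> {-1..0} \<Longrightarrow> norm (f x) \<le> B" and fm: "f \<in> borel_measurable borel_I"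
    using f unfolding bounded_measurable_def by blast
  obtain s where s: "\<And>i. simple_function borel_I (s i)" "\<And>x. x \<in> {-1..0} \<Longrightarrow> (\<lambda>i. s i x) \<longlonglongrightarrow> f x"
    and sb: "\<And>i x. x \<in> {-1..0} \<Longrightarrow> norm (s i x) \<le> 2 * norm (f x)"
    using borel_measurable_implies_sequence_metric[OF fm, of 0] unfolding space_borel_I dist_0_norm dist_norm diff_0_right
    by metis
  have sb': "norm (s i x) \<le> 2 * B" if "x \<in> {-1..0}" for i x
    using sb[OF that, of i] B[OF that] by simp
  have lim: "(\<lambda>k. \<Sum>v\<in>s k ` {-1..0}. \<nu> (s k -` {v} \<inter> {-1..0}) *\<^sub>R v) \<longlonglongrightarrow> integral\<^sup>L p f - integral\<^sup>L n f"
    if "diff_of_measures \<nu> p n" for p n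
    unfolding diff[OF that s(1), symmetric]
    using that s sb' fm by (intro tendsto_diff integral_bounded_convergence[where B="2*B"])
      (auto simp: diff_of_measures_def intro: borel_measurable_simple_function)
  show ?thesis
    unfolding signed_integral_def
    using LIMSEQ_unique[OF lim[OF jordan_decomposition[OF \<nu>]] lim[OF \<nu>]] .
qed

lemma signed_integral_diff:
  assumes "diff_of_measures \<nu> m1 m2" "bounded_measurable f" "bounded_measurable g"
  shows "signed_integral \<nu> (\<lambda>x. f x - g x) = signed_integral \<nu> f - signed_integral \<nu> g"
  using jordan_decomposition[OF assms(1)] assms(2,3)
  by (simp add: signed_integral_def integrable_bounded_measurable diff_of_measures_def)

lemma signed_integral_mult:
  fixes c :: "'b::{real_normed_field, banach, second_countable_topology}"
  shows "signed_integral \<nu> (\<lambda>x. c * f x) = c * signed_integral \<nu> f"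
  by (simp add: signed_integral_def right_diff_distrib)

lemma signed_integral_cong:
  "(\<And>x. x \<in> {-1..0} \<Longrightarrow> f x = g x) \<Longrightarrow> signed_integral \<nu> f = signed_integral \<nu> g"
  unfolding signed_integral_def
  by (intro arg_cong2[where f="(-)"] Bochner_Integration.integral_cong) auto

text \<open>The total variation of \<nu>, the constant in the later estimates of integrals.\<close>

definition total_mass :: "(real set \<Rightarrow> real) \<Rightarrow> real" where
  "total_mass \<nu> = measure (pos_part \<nu>) {-1..0} + measure (pos_part (\<lambda>A. - \<nu> A)) {-1..0}"

lemma total_mass_nonneg: "0 \<le> total_mass \<nu>" by (simp add: total_mass_def)

lemma norm_signed_integral_le:
  assumes \<nu>: "diff_of_measures \<nu> m1 m2" and "f \<in> borel_measurable borel_I"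
    and B: "\<And>x. x \<in> {-1..0} \<Longrightarrow> norm (f x) \<le> B"
  shows "norm (signed_integral \<nu> f) \<le> total_mass \<nu> * B"
proof -
  have bm: "bounded_measurable f" using assms by (intro bounded_measurableI)
  have *: "norm (integral\<^sup>L m f) \<le> measure m {-1..0} * B" if "finite_measure m" "sets m = sets borel_I" for m
  proof -
    interpret finite_measure m by fact
    have sp: "space m = {-1..0}" using sets_eq_imp_space_eq[OF that(2)] by simp
    have "norm (integral\<^sup>L m f) \<le> (\<integral>x. norm (f x) \<partial>m)" by simp
    also have "\<dots> \<le> (\<integral>x. B \<partial>m)"
      using integrable_bounded_measurable[OF bm that] B sp by (intro integral_mono) auto
    finally show ?thesis using sp by simp
  qed
  have "norm (signed_integral \<nu> f) \<le> norm (integral\<^sup>L (pos_part \<nu>) f) + norm (integral\<^sup>L (pos_part (\<lambda>A. - \<nu> A)) f)"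
    unfolding signed_integral_def by (rule norm_triangle_ineq4)
  also have "\<dots> \<le> total_mass \<nu> * B"
    unfolding total_mass_def distrib_right
    using jordan_decomposition[OF \<nu>] by (intro add_mono *) (auto simp: diff_of_measures_def)
  finally show ?thesis .
qed

lemma signed_integral_bounded_convergence:
  fixes f :: "real \<Rightarrow> 'b::{banach, second_countable_topology}"
  assumes \<nu>: "diff_of_measures \<nu> m1 m2"
    and "f \<in> borel_measurable borel_I" "\<And>k. s k \<in> borel_measurable borel_I"
    and "\<And>x. x \<in> {-1..0} \<Longrightarrow> (\<lambda>k::nat. s k x) \<longlonglongrightarrow> f x"
    and "\<And>k x. x \<in> {-1..0} \<Longrightarrow> norm (s k x) \<le> B"
  shows "(\<lambda>k. signed_integral \<nu> (s k)) \<longlonglongrightarrow> signed_integral \<nu> f"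
  unfolding signed_integral_def
  using jordan_decomposition[OF \<nu>] assms(2-5)
  by (intro tendsto_diff integral_bounded_convergence[where B=B]) (auto simp: diff_of_measures_def)

text \<open>The level sets of \<open>g\<close> stay fixed while its values are replaced through an
  arbitrary \<open>c\<close>: the integral becomes a finite sum that is linear in the numbers
  \<open>c v\<close>, which can then be varied independently.\<close>

lemma signed_integral_simple_compose:
  assumes \<nu>: "diff_of_measures \<nu> m1 m2" and g: "simple_function borel_I g"
  shows "signed_integral \<nu> (\<lambda>x. c (g x)) = (\<Sum>v\<in>g ` {-1..0}. \<nu> (g -` {v} \<inter> {-1..0}) *\<^sub>R c v)"
proof -
  have "g -` {v} \<inter> {-1..0} \<in> sets borel_I" for v
    using simple_functionD(2)[OF g, of "{v}"] by simp
  then have "\<nu> (g -` {v} \<inter> {-1..0}) = measure (pos_part \<nu>) (g -` {v} \<inter> {-1..0}) -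
      measure (pos_part (\<lambda>A. - \<nu> A)) (g -` {v} \<inter> {-1..0})" for v
    using jordan_decomposition[OF \<nu>] by (simp add: diff_of_measures_def)
  then show ?thesis
    using jordan_decomposition[OF \<nu>] g unfolding signed_integral_def
    by (simp add: integral_simple_function_compose diff_of_measures_def scaleR_diff_left sum_subtractf)
qed

section \<open>Pushforwards of signed measures\<close>

lemma diff_of_measures_pushforward:
  assumes \<nu>: "diff_of_measures \<nu> m1 m2" and \<phi>: "\<phi> \<in> measurable borel_I borel_I"
  shows "diff_of_measures (pushforward \<phi> \<nu>) (distr m1 borel_I \<phi>) (distr m2 borel_I \<phi>)"
proof -
  have s: "sets m1 = sets borel_I" "sets m2 = sets borel_I"
    and f: "finite_measure m1" "finite_measure m2"
    and val: "\<And>A. A \<in> sets borel_I \<Longrightarrow> \<nu> A = measure m1 A - measure m2 A"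
    using \<nu> by (auto simp: diff_of_measures_def)
  have sp: "space m1 = {-1..0}" "space m2 = {-1..0}"
    using s[THEN sets_eq_imp_space_eq] by auto
  have m: "\<phi> \<in> measurable m1 borel_I" "\<phi> \<in> measurable m2 borel_I"
    using \<phi> s by (simp_all cong: measurable_cong_sets)
  have "pushforward \<phi> \<nu> A = measure (distr m1 borel_I \<phi>) A - measure (distr m2 borel_I \<phi>) A"
    if A: "A \<in> sets borel_I" for A
    using val[of "\<phi> -` A \<inter> {-1..0}"] measurable_sets[OF \<phi> A] A m sp
    by (simp add: pushforward_def measure_distr)
  then show ?thesis
    using m f by (simp add: diff_of_measures_def finite_measure.finite_measure_distr)
qed

text \<open>\<phi> may merge positive and negative mass, so the images of the Jordan parts need not
  be the Jordan parts of the image. The integral is therefore computed from the images of an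
  arbitrary representing pair.\<close>

lemma signed_integral_pushforward:
  assumes \<nu>: "diff_of_measures \<nu> m1 m2" and \<phi>: "\<phi> \<in> measurable borel_I borel_I"
    and f: "bounded_measurable f"
  shows "signed_integral (pushforward \<phi> \<nu>) f = signed_integral \<nu> (\<lambda>x. f (\<phi> x))"
proof -
  have s: "sets m1 = sets borel_I" "sets m2 = sets borel_I"
    using \<nu> by (auto simp: diff_of_measures_def)
  have m: "\<phi> \<in> measurable m1 borel_I" "\<phi> \<in> measurable m2 borel_I"
    using \<phi> s by (simp_all cong: measurable_cong_sets)
  have fm: "f \<in> borel_measurable borel_I" using f by (simp add: bounded_measurable_def)
  have bm: "bounded_measurable (\<lambda>x. f (\<phi> x))"
    using f measurable_space[OF \<phi>] measurable_compose[OF \<phi> fm] by (force simp: bounded_measurable_def)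
  then show ?thesis
    using signed_integral_eq_diff[OF diff_of_measures_pushforward[OF \<nu> \<phi>] f]
      signed_integral_eq_diff[OF \<nu> bm] integral_distr[OF m(1) fm] integral_distr[OF m(2) fm]
    by simp
qed

section \<open>Functions of bounded variation and their measures\<close>

text \<open>For increasing \<open>P\<close> that is bounded below, this infimum is the limit from
  the right. A Stieltjes measure asks for a right-continuous distribution function, and the
  variation enters only as an increasing one.\<close>

definition right_limit :: "(real \<Rightarrow> real) \<Rightarrow> real \<Rightarrow> real" where
  "right_limit P t = Inf (P ` {t<..})"

lemma right_limit_bounds:
  assumes "mono P" "\<And>u. 0 \<le> P u" "t < u"
  shows "right_limit P t \<le> P u" "P t \<le> right_limit P t"
proof -
  show "right_limit P t \<le> P u"
    unfolding right_limit_def using assms by (intro cInf_lower bdd_belowI[where m=0]) auto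
  show "P t \<le> right_limit P t"
    unfolding right_limit_def using assms by (intro cInf_greatest) (auto simp: monoD less_imp_le)
qed

lemma right_limit_approx:
  assumes "mono P" "\<And>u. 0 \<le> P u" "0 < e"
  obtains u where "t < u" "P u < right_limit P t + e"
proof -
  have "\<exists>x\<in>P ` {t<..}. x < right_limit P t + e"
    using assms unfolding right_limit_def
    by (intro cInf_lessD) auto
  then show ?thesis using that by auto
qed

lemma mono_right_limit:
  assumes "mono P" "\<And>u. 0 \<le> P u" shows "mono (right_limit P)"
proof
  fix x y :: real assume "x \<le> y"
  then show "right_limit P x \<le> right_limit P y"
    unfolding right_limit_def using assms by (intro cInf_superset_mono bdd_belowI[where m=0]) auto
qed

lemma tendsto_right_limit:
  assumes "mono P" "\<And>u. 0 \<le> P u"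
  shows "(P \<longlongrightarrow> right_limit P t) (at_right t)"
proof (rule tendstoI)
  fix e :: real assume "0 < e"
  then obtain u where u: "t < u" "P u < right_limit P t + e" using right_limit_approx assms by metis
  have "dist (P v) (right_limit P t) < e" if "t < v" "v < u" for v
    using right_limit_bounds(1)[OF assms that(1)] monoD[OF assms(1), of v u] that u by (auto simp: dist_real_def)
  then show "\<forall>\<^sub>F v in at_right t. dist (P v) (right_limit P t) < e"
    using u(1) by (auto simp: eventually_at_right)
qed

lemma continuous_right_limit:
  assumes "mono P" "\<And>u. 0 \<le> P u"
  shows "continuous (at_right t) (right_limit P)"
  unfolding continuous_within
proof (rule tendstoI)
  fix e :: real assume "0 < e"
  then obtain u where u: "t < u" "P u < right_limit P t + e" using right_limit_approx assms by metis
  have "dist (right_limit P v) (right_limit P t) < e" if "t < v" "v < u" for v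
    using monoD[OF mono_right_limit[OF assms], of t v] right_limit_bounds(1)[OF assms that(2)] that u
    by (auto simp: dist_real_def)
  then show "\<forall>\<^sub>F v in at_right t. dist (right_limit P v) (right_limit P t) < e"
    using u(1) by (auto simp: eventually_at_right)
qed

text \<open>The Stieltjes measure on (-2,0] is moved to [-1,0] by clamping. Starting at -2, where
  the distribution function is 0, retains a jump at -1, which becomes an atom at -1.\<close>

lemma measure_of_increasing:
  assumes P: "mono P" "\<And>u. 0 \<le> P u" and P0: "\<And>u. u < -1 \<Longrightarrow> P u = 0"
  obtains m where "finite_measure m" "sets m = sets borel_I"
    "\<And>t. t \<in> {-1<..0} \<Longrightarrow> measure m {-1..t} = right_limit P t"
proof -
  let ?F = "right_limit P" and ?\<kappa> = "\<lambda>x::real. max (-1) (min 0 x)"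
  let ?r = "restrict_space (interval_measure ?F) {-2<..0}"
  have F2: "?F (-2) = 0"
    using right_limit_bounds[OF P, of "-2" "-3/2"] P0[of "-3/2"] P(2)[of "-2"] by simp
  have em: "emeasure (interval_measure ?F) {-2<..t} = ennreal (?F t)" if "-2 \<le> t" for t
    using emeasure_interval_measure_Ioc[of "-2" t ?F] that monoD[OF mono_right_limit[OF P]]
      continuous_right_limit[OF P] F2 by simp
  have sp: "space ?r = {-2<..0}" by (simp add: space_restrict_space)
  have fin: "finite_measure ?r"
    by (rule finite_measureI) (simp add: space_restrict_space emeasure_restrict_space em)
  have "?\<kappa> \<in> borel_measurable (interval_measure ?F)" by measurable
  then have "?\<kappa> \<in> borel_measurable ?r" by (rule measurable_restrict_space1)
  then have \<kappa>: "?\<kappa> \<in> measurable ?r borel_I"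
    by (intro measurable_restrict_space2) auto
  let ?m = "distr ?r borel_I ?\<kappa>"
  have "measure ?m {-1..t} = ?F t" if t: "t \<in> {-1<..0}" for t
  proof -
    have "{-1..t} \<in> sets borel_I" using t by (auto simp: sets_borel_I_iff)
    then have "measure ?m {-1..t} = measure ?r (?\<kappa> -` {-1..t} \<inter> space ?r)"
      using \<kappa> by (rule measure_distr[rotated])
    also have "?\<kappa> -` {-1..t} \<inter> space ?r = {-2<..t}" using t by (auto simp: sp)
    also have "measure ?r {-2<..t} = measure (interval_measure ?F) {-2<..t}"
      using t by (subst measure_restrict_space) auto
    also have "\<dots> = ?F t" using em[of t] t monoD[OF mono_right_limit[OF P], of "-2" t] F2
      by (simp add: measure_def)
    finally show ?thesis .
  qed
  with finite_measure.finite_measure_distr[OF fin \<kappa>] show ?thesis by (intro that[of ?m]) auto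
qed

definition variation :: "(real \<Rightarrow> real) \<Rightarrow> real \<Rightarrow> real" where
  "variation f x = Sup {(\<Sum>k<n. \<bar>f (t (Suc k)) - f (t k)\<bar>) | n t.
     (\<forall>k\<le>n. t k \<in> {-1..x}) \<and> (\<forall>k<n. t k \<le> t (Suc k))}"

text \<open>A partition of [-1,x] extended by the points x and y is a partition of [-1,y] whose sum
  is larger by at least |f y - f x|.\<close>

lemma variation_add_le:
  assumes bv: "bounded_variation f" and x: "-1 \<le> x" "x \<le> y" "y \<le> 0"
  shows "variation f x + \<bar>f y - f x\<bar> \<le> variation f y"
proof -
  let ?S = "\<lambda>x. {(\<Sum>k<n. \<bar>f (t (Suc k)) - f (t k)\<bar>) | (n::nat) t.
     (\<forall>k\<le>n. t k \<in> {-1..x}) \<and> (\<forall>k<n. t k \<le> t (Suc k))}"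
  obtain C where C: "\<And>(n::nat) t. (\<forall>k\<le>n. t k \<in> {-1..0}) \<Longrightarrow> (\<forall>k<n. t k \<le> t (Suc k)) \<Longrightarrow>
      (\<Sum>k<n. \<bar>f (t (Suc k)) - f (t k)\<bar>) \<le> C"
    using bv unfolding bounded_variation_def real_norm_def by blast
  have bdd: "bdd_above (?S y)"
  proof (rule bdd_aboveI[where M=C])
    fix s assume "s \<in> ?S y"
    then obtain n t where s: "s = (\<Sum>k<n. \<bar>f (t (Suc k)) - f (t k)\<bar>)"
      and t: "\<forall>k\<le>n. t k \<in> {-1..y}" "\<forall>k<n. t k \<le> t (Suc k)" by blast
    then show "s \<le> C" unfolding s using x by (intro C) force+
  qed
  have "s \<le> variation f y - \<bar>f y - f x\<bar>" if "s \<in> ?S x" for s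
  proof -
    obtain n t where s: "s = (\<Sum>k<n. \<bar>f (t (Suc k)) - f (t k)\<bar>)"
      and t: "\<forall>k\<le>n. t k \<in> {-1..x}" "\<forall>k<n. t k \<le> t (Suc k)" using \<open>s \<in> ?S x\<close> by blast
    define u where "u k = (if k \<le> n then t k else if k = Suc n then x else y)" for k
    have "(\<Sum>k<Suc (Suc n). \<bar>f (u (Suc k)) - f (u k)\<bar>) \<in> ?S y"
      using t x by (intro CollectI exI[of _ "Suc (Suc n)"] exI[of _ u])
        (auto simp: u_def less_Suc_eq_le le_Suc_eq; force)
    then have "(\<Sum>k<Suc (Suc n). \<bar>f (u (Suc k)) - f (u k)\<bar>) \<le> variation f y"
      unfolding variation_def using bdd by (rule cSup_upper)
    moreover have "(\<Sum>k<n. \<bar>f (u (Suc k)) - f (u k)\<bar>) = s"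
      unfolding s by (intro sum.cong) (auto simp: u_def)
    moreover have "u (Suc n) = x" "u (Suc (Suc n)) = y" by (auto simp: u_def)
    ultimately show ?thesis by simp
  qed
  moreover have "?S x \<noteq> {}"
  proof -
    have "(\<Sum>k<0. \<bar>f ((\<lambda>_. x) (Suc k)) - f ((\<lambda>_. x) k)\<bar>) \<in> ?S x"
      using x by (intro CollectI exI[of _ 0] exI[of _ "\<lambda>_. x"]) auto
    then show ?thesis by blast
  qed
  ultimately have "variation f x \<le> variation f y - \<bar>f y - f x\<bar>"
    unfolding variation_def[of f x] by (intro cSup_least) 
  then show ?thesis by simp
qed

text \<open>With V the variation, both V and V - f increase. Clamping extends them constantly
  outside [-1,0], and \<open>f (-1) = 0\<close> makes them vanish to the left of -1. Passing to
  right limits preserves the difference on (-1,0]: by right continuity inside, by the constant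
  extension at 0.\<close>

lemma bounded_variation_diff_of_measures:
  fixes f :: "real \<Rightarrow> real"
  assumes bv: "bounded_variation f" and f0: "f (-1) = 0"
    and rc: "\<And>t. t \<in> {-1<..<0} \<Longrightarrow> continuous (at_right t) f"
  obtains m1 m2 where "finite_measure m1" "finite_measure m2"
    "sets m1 = sets borel_I" "sets m2 = sets borel_I"
    "\<And>t. t \<in> {-1<..0} \<Longrightarrow> f t = measure m1 {-1..t} - measure m2 {-1..t}"
proof -
  define \<kappa> where "\<kappa> x = max (-1) (min 0 x)" for x :: real
  have \<kappa>: "-1 \<le> \<kappa> x" "\<kappa> x \<le> 0" "x \<le> y \<Longrightarrow> \<kappa> x \<le> \<kappa> y" for x y by (auto simp: \<kappa>_def)
  define V where "V x = variation f (\<kappa> x) - variation f (-1)" for x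
  define N where "N x = V x - f (\<kappa> x)" for x
  have V: "V x + \<bar>f (\<kappa> y) - f (\<kappa> x)\<bar> \<le> V y" if "x \<le> y" for x y
    using variation_add_le[OF bv \<kappa>(1) \<kappa>(3)[OF that] \<kappa>(2)] by (simp add: V_def)
  have low: "\<kappa> u = -1" if "u \<le> -1" for u using that by (simp add: \<kappa>_def)
  have V0: "V u = 0" if "u \<le> -1" for u using low[OF that] by (simp add: V_def)
  have N0: "N u = 0" if "u \<le> -1" for u using low[OF that] V0[OF that] f0 by (simp add: N_def)
  have Vm: "mono V" using V by (intro monoI) (smt (verit))
  have Nm: "mono N" unfolding N_def using V by (intro monoI) (smt (verit))
  have nn: "0 \<le> V u" "0 \<le> N u" for u
    using monoD[OF Vm, of "min u (-1)" u] monoD[OF Nm, of "min u (-1)" u] V0[of "min u (-1)"] N0[of "min u (-1)"] by auto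
  obtain m1 where m1: "finite_measure m1" "sets m1 = sets borel_I"
    "\<And>t. t \<in> {-1<..0} \<Longrightarrow> measure m1 {-1..t} = right_limit V t"
    using measure_of_increasing[OF Vm nn(1) V0] by (metis less_imp_le)
  obtain m2 where m2: "finite_measure m2" "sets m2 = sets borel_I"
    "\<And>t. t \<in> {-1<..0} \<Longrightarrow> measure m2 {-1..t} = right_limit N t"
    using measure_of_increasing[OF Nm nn(2) N0] by (metis less_imp_le)
  have "f t = right_limit V t - right_limit N t" if t: "t \<in> {-1<..0}" for t
  proof (rule tendsto_unique[OF trivial_limit_at_right_real])
    have "((\<lambda>x. V x - N x) \<longlongrightarrow> right_limit V t - right_limit N t) (at_right t)"
      by (intro tendsto_diff tendsto_right_limit Vm Nm nn)
    then show "((\<lambda>x. f (\<kappa> x)) \<longlongrightarrow> right_limit V t - right_limit N t) (at_right t)"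
      by (simp add: N_def)
    show "((\<lambda>x. f (\<kappa> x)) \<longlongrightarrow> f t) (at_right t)"
    proof (cases "t = 0")
      case True
      have "\<forall>\<^sub>F x in at_right t. f t = f (\<kappa> x)"
        unfolding eventually_at_right[OF less_add_one] using True by (auto simp: \<kappa>_def intro!: exI[of _ 1])
      then show ?thesis by (rule Lim_transform_eventually[OF tendsto_const])
    next
      case False
      then have t: "t \<in> {-1<..<0}" using t by auto
      have "\<forall>\<^sub>F x in at_right t. f x = f (\<kappa> x)"
        using t by (auto simp: \<kappa>_def eventually_at_right[of t 0] intro!: exI[of _ 0])
      moreover have "(f \<longlongrightarrow> f t) (at_right t)" using rc[OF t] by (simp add: continuous_within)
      ultimately show ?thesis by (rule Lim_transform_eventually[rotated])
    qed
  qed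
  with m1 m2 show ?thesis by (intro that[of m1 m2]) auto
qed

section \<open>Uniqueness of the measure with given distribution function\<close>

lemma sums_two:
  fixes f :: "real set \<Rightarrow> 'v::real_normed_vector"
  assumes "f {} = 0"
  shows "(\<lambda>k::nat. f (if k = 0 then A else if k = 1 then B else {})) sums (f A + f B)"
  using sums_finite[of "{0,1}" "\<lambda>k::nat. f (if k = 0 then A else if k = 1 then B else {})"] assms by auto

lemma vector_measure_empty:
  assumes "vector_measure \<mu>" shows "\<mu> {} = 0"
proof -
  have "(\<lambda>k::nat. \<mu> ((\<lambda>_. {}) k)) sums \<mu> (\<Union>k::nat. (\<lambda>_. {}) k)"
    using assms unfolding vector_measure_def by (auto simp: disjoint_family_on_def)
  then have "(\<lambda>k::nat. \<mu> {}) \<longlonglongrightarrow> 0" by (intro summable_LIMSEQ_zero) (auto simp: summable_def)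
  then show ?thesis using LIMSEQ_unique tendsto_const by blast
qed

lemma vector_measure_Un:
  assumes "vector_measure \<mu>" "A \<in> sets borel_I" "B \<in> sets borel_I" "A \<inter> B = {}"
  shows "\<mu> (A \<union> B) = \<mu> A + \<mu> B"
proof -
  let ?A = "\<lambda>k::nat. if k = 0 then A else if k = 1 then B else {}"
  have "range ?A \<subseteq> sets borel_I" using assms by auto
  moreover have "disjoint_family ?A" using assms by (auto simp: disjoint_family_on_def)
  ultimately have "(\<lambda>k. \<mu> (?A k)) sums \<mu> (\<Union>k. ?A k)"
    using assms(1) unfolding vector_measure_def by blast
  moreover have "(\<Union>k. ?A k) = A \<union> B"
    by (auto split: if_splits intro: exI[of _ 0] exI[of _ "Suc 0"])
  ultimately have "(\<lambda>k. \<mu> (?A k)) sums \<mu> (A \<union> B)" by (simp only:)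
  then show ?thesis
    by (rule sums_unique2[OF _ sums_two[where f=\<mu>, OF vector_measure_empty[OF assms(1)]]])
qed

text \<open>The generators {-1..t} with t > -1 are the sets on which M prescribes the measure; the
  single point -1 is recovered as a countable intersection.\<close>

lemma sigma_sets_borel_I:
  "sets borel_I = sigma_sets {-1..0} ((\<lambda>t. {-1..t}) ` {-1<..0::real})" (is "_ = sigma_sets _ ?G")
proof -
  have G: "?G \<subseteq> Pow {-1..0}" by auto
  have "sets borel_I = (\<inter>) {-1..0} ` sigma_sets UNIV (range (\<lambda>a::real. {..a}))"
    by (simp add: sets_restrict_space borel_eq_atMost)
  also have "\<dots> = sigma_sets {-1..0} ((\<inter>) {-1..0} ` range (\<lambda>a::real. {..a}))"
  proof (rule sigma_sets_Int)
    have "{-1..0::real} \<in> sets (sigma UNIV (range (\<lambda>a::real. {..a})))"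
      unfolding borel_eq_atMost[symmetric] by simp
    then show "{-1..0::real} \<in> sigma_sets UNIV (range (\<lambda>a::real. {..a}))" by simp
  qed auto
  also have "\<dots> = sigma_sets {-1..0} ?G"
  proof (rule sigma_sets_eqI)
    fix A assume "A \<in> (\<inter>) {-1..0} ` range (\<lambda>a::real. {..a})"
    then obtain a where A: "A = {-1..0} \<inter> {..a}" by blast
    consider "a < -1" | "a = -1" | "-1 < a" by linarith
    then show "A \<in> sigma_sets {-1..0} ?G"
    proof cases
      case 1
      then have "A = {}" by (auto simp: A)
      then show ?thesis by (simp add: sigma_sets.Empty)
    next
      case 2
      have "A = (\<Inter>i::nat. {-1..-1 + 1 / real (Suc i)})"
      proof (rule set_eqI)
        fix x
        have "x = -1" if "\<And>i::nat. -1 \<le> x \<and> x \<le> -1 + 1 / real (Suc i)"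
        proof (rule ccontr)
          assume "x \<noteq> -1"
          then have "0 < x + 1" using that[of 0] by auto
          then obtain i where "1 / real (Suc i) < x + 1" by (rule nat_approx_posE)
          then show False using that[of i] by simp
        qed
        then show "x \<in> A \<longleftrightarrow> x \<in> (\<Inter>i::nat. {-1..-1 + 1 / real (Suc i)})" by (auto simp: A 2)
      qed
      also have "\<dots> \<in> sigma_sets {-1..0} ?G"
        by (intro sigma_sets_Inter[OF G] sigma_sets.Basic imageI) (auto simp: field_simps)
      finally show ?thesis .
    next
      case 3
      then have "A = {-1..min a 0}" by (auto simp: A)
      then show ?thesis using 3 by (auto intro!: sigma_sets.Basic)
    qed
  next
    fix A assume "A \<in> ?G"
    then obtain t where "A = {-1..t}" "t \<le> 0" by auto
    then have "A = {-1..0} \<inter> {..t}" by auto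
    then have "A \<in> (\<inter>) {-1..0} ` range (\<lambda>a::real. {..a})" by blast
    then show "A \<in> sigma_sets {-1..0} ((\<inter>) {-1..0} ` range (\<lambda>a::real. {..a}))"
      by (rule sigma_sets.Basic)
  qed
  finally show ?thesis .
qed

text \<open>The generators are stable under intersection and the sets of agreement form a Dynkin
  system; complements use the case t = 0, the whole interval. Off the Borel sets both measures are 0
  by convention.\<close>

lemma vector_measure_unique:
  assumes v: "vector_measure \<mu>" "vector_measure \<mu>'"
    and eq: "\<And>t. t \<in> {-1<..0} \<Longrightarrow> \<mu> {-1..t} = \<mu>' {-1..t}"
  shows "\<mu> = \<mu>'"
proof
  fix A
  let ?G = "(\<lambda>t. {-1..t}) ` {-1<..0::real}"
  show "\<mu> A = \<mu>' A"
  proof (cases "A \<in> sets borel_I")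
    case True
    have 1: "Int_stable ?G"
    proof (rule Int_stableI)
      fix a b assume "a \<in> ?G" "b \<in> ?G"
      then obtain s t where "a = {-1..s}" "b = {-1..t}" "s \<in> {-1<..0}" "t \<in> {-1<..0}" by auto
      then show "a \<inter> b \<in> ?G" by (intro image_eqI[of _ _ "min s t"]) auto
    qed
    have 2: "?G \<subseteq> Pow {-1..0}" by auto
    have 3: "A \<in> sigma_sets {-1..0} ?G" using True by (simp only: sigma_sets_borel_I)
    from 1 2 3 show ?thesis
    proof (induction rule: sigma_sets_induct_disjoint)
      case (basic A) then show ?case using eq by auto
    next
      case empty then show ?case using v by (simp add: vector_measure_empty)
    next
      case (compl A)
      then have A: "A \<in> sets borel_I" by (simp add: sigma_sets_borel_I)
      have I: "{-1..0} - A \<in> sets borel_I" using sets.compl_sets[OF A] by simp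
      have U: "A \<union> ({-1..0} - A) = {-1..0}" using A by (auto simp: sets_borel_I_iff)
      have "\<mu> {-1..0} = \<mu> A + \<mu> ({-1..0} - A)" "\<mu>' {-1..0} = \<mu>' A + \<mu>' ({-1..0} - A)"
        using vector_measure_Un[OF v(1) A I] vector_measure_Un[OF v(2) A I] unfolding U by auto
      then show ?case using compl eq[of 0] by simp
    next
      case (union A)
      have "(\<lambda>k. \<mu> (A k)) sums \<mu> (\<Union>k. A k)" "(\<lambda>k. \<mu>' (A k)) sums \<mu>' (\<Union>k. A k)"
        using v union(1,2) unfolding vector_measure_def sigma_sets_borel_I by blast+
      then show ?case unfolding union(3) by (rule sums_unique2)
    qed
  next
    case False
    then show ?thesis using v by (auto simp: vector_measure_def)
  qed
qed

lemma measure_of_nbv_eqI: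
  assumes "vector_measure \<mu>" "\<And>t. t \<in> {-1<..0} \<Longrightarrow> \<mu> {-1..t} = M t"
  shows "measure_of_nbv M = \<mu>"
  unfolding measure_of_nbv_def
  using assms by (intro the_equality conjI ballI) (auto intro: vector_measure_unique)

lemma vector_measure_of_entries:
  fixes \<mu> :: "real set \<Rightarrow> real^'n^'n"
  assumes "\<And>i j. \<exists>m1 m2. diff_of_measures (\<lambda>A. \<mu> A $ i $ j) m1 m2"
    and "\<And>A. A \<notin> sets borel_I \<Longrightarrow> \<mu> A = 0"
  shows "vector_measure \<mu>"
  unfolding vector_measure_def
proof (intro conjI allI impI)
  fix A :: "nat \<Rightarrow> real set" assume A: "range A \<subseteq> sets borel_I \<and> disjoint_family A"
  have "(\<lambda>k. \<mu> (A k) $ i $ j) sums (\<mu> (\<Union>k. A k) $ i $ j)" for i j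
    using assms(1)[of i j] diff_of_measures_sums[of "\<lambda>A. \<mu> A $ i $ j"] A by blast
  then show "(\<lambda>k. \<mu> (A k)) sums \<mu> (\<Union>k. A k)"
    unfolding sums_def by (intro vec_tendstoI) simp
qed (use assms in auto)

text \<open>This gives content to the definite description \<open>measure_of_nbv\<close>: a measure
  is assembled entrywise from the bounded variation decomposition, set to 0 off the Borel sets, and
  identified by uniqueness.\<close>

lemma diff_of_measures_nbv:
  fixes M :: "real \<Rightarrow> real^'n^'n"
  assumes M: "M \<in> NBV"
  shows "\<exists>m1 m2. diff_of_measures (\<lambda>A. measure_of_nbv M A $ i $ j) m1 m2"
    and "A \<notin> sets borel_I \<Longrightarrow> measure_of_nbv M A = 0"
proof -
  have "\<exists>m1 m2. finite_measure m1 \<and> finite_measure m2 \<and> sets m1 = sets borel_I \<and> sets m2 = sets borel_I \<and>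
    (\<forall>t\<in>{-1<..0}. M t $ i $ j = measure m1 {-1..t} - measure m2 {-1..t})" for i j
  proof -
    obtain C where C: "\<And>(n::nat) t. (\<forall>k\<le>n. t k \<in> {-1..0}) \<Longrightarrow> (\<forall>k<n. t k \<le> t (Suc k)) \<Longrightarrow>
      (\<Sum>k<n. norm (M (t (Suc k)) - M (t k))) \<le> C"
      using M unfolding NBV_def bounded_variation_def by blast
    have "norm (M (x) $ i $ j - M (y) $ i $ j) \<le> norm (M x - M y)" for x y
      using Finite_Cartesian_Product.norm_nth_le[of "(M x - M y) $ i" j] Finite_Cartesian_Product.norm_nth_le[of "M x - M y" i] by simp
    then have "(\<Sum>k<n. norm (M (t (Suc k)) $ i $ j - M (t k) $ i $ j)) \<le> C"
      if "\<forall>k\<le>n. t k \<in> {-1..0}" "\<forall>k<n. t k \<le> t (Suc k)" for n t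
      using sum_mono[of "{..<n}"] C[OF that] by (smt (verit))
    then have "bounded_variation (\<lambda>t. M t $ i $ j)"
      unfolding bounded_variation_def by blast
    moreover have "continuous (at_right t) (\<lambda>t. M t $ i $ j)" if "t \<in> {-1<..<0}" for t
      using M that by (auto simp: NBV_def continuous_within intro!: tendsto_vec_nth)
    moreover have "M (-1) $ i $ j = 0" using M by (simp add: NBV_def)
    ultimately show ?thesis using bounded_variation_diff_of_measures[of "\<lambda>t. M t $ i $ j"] by metis
  qed
  then obtain m1 m2 where m: "\<And>i j. finite_measure (m1 i j) \<and> finite_measure (m2 i j) \<and>
      sets (m1 i j) = sets borel_I \<and> sets (m2 i j) = sets borel_I \<and>
    (\<forall>t\<in>{-1<..0}. M t $ i $ j = measure (m1 i j) {-1..t} - measure (m2 i j) {-1..t})" by metis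
  define \<mu> :: "real set \<Rightarrow> real^'n^'n" where
    "\<mu> A = (if A \<in> sets borel_I then \<chi> i j. measure (m1 i j) A - measure (m2 i j) A else 0)" for A
  have d: "diff_of_measures (\<lambda>A. \<mu> A $ i $ j) (m1 i j) (m2 i j)" for i j
    using m[of i j] by (simp add: diff_of_measures_def \<mu>_def)
  have v: "vector_measure \<mu>"
    using d by (intro vector_measure_of_entries) (auto simp: \<mu>_def)
  have "{-1..t} \<in> sets borel_I" if "t \<in> {-1<..0}" for t using that by (auto simp: sets_borel_I_iff)
  then have "measure_of_nbv M = \<mu>"
    using m by (intro measure_of_nbv_eqI[OF v]) (simp add: \<mu>_def vec_eq_iff)
  then show "\<exists>m1 m2. diff_of_measures (\<lambda>A. measure_of_nbv M A $ i $ j) m1 m2"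
    and "A \<notin> sets borel_I \<Longrightarrow> measure_of_nbv M A = 0"
    using d by (auto simp: \<mu>_def)
qed

lemma pushforward_entry:
  fixes \<mu> :: "real set \<Rightarrow> real^'n^'n"
  shows "(\<lambda>A. pushforward \<phi> \<mu> A $ i $ j) = pushforward \<phi> (\<lambda>A. \<mu> A $ i $ j)"
  by (auto simp: pushforward_def)

lemma measure_of_pushforward_nbv:
  assumes M: "M \<in> NBV" and \<phi>: "\<phi> \<in> measurable borel_I borel_I"
  shows "measure_of_nbv (pushforward_nbv \<phi> M) = pushforward \<phi> (measure_of_nbv M)"
  unfolding pushforward_nbv_def
proof (rule measure_of_nbv_eqI)
  show "vector_measure (pushforward \<phi> (measure_of_nbv M))"
  proof (rule vector_measure_of_entries)
    fix i j
    show "\<exists>m1 m2. diff_of_measures (\<lambda>A. pushforward \<phi> (measure_of_nbv M) A $ i $ j) m1 m2"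
      using diff_of_measures_nbv(1)[OF M, of i j] diff_of_measures_pushforward[OF _ \<phi>]
      unfolding pushforward_entry by blast
  qed (simp add: pushforward_def)
qed (simp add: nbv_of_measure_def)

lemma integral_scal_pushforward_nbv:
  assumes M: "M \<in> NBV" and \<phi>: "\<phi> \<in> measurable borel_I borel_I" and f: "bounded_measurable f"
  shows "integral_scal (pushforward_nbv \<phi> M) f = integral_scal M (\<lambda>x. f (\<phi> x))"
proof -
  have "signed_integral (\<lambda>A. pushforward \<phi> (measure_of_nbv M) A $ i $ j) f =
      signed_integral (\<lambda>A. measure_of_nbv M A $ i $ j) (\<lambda>x. f (\<phi> x))" for i j
    unfolding pushforward_entry
    using diff_of_measures_nbv(1)[OF M, of i j] signed_integral_pushforward[OF _ \<phi> f] by metis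
  then show ?thesis by (simp add: integral_scal_def measure_of_pushforward_nbv[OF M \<phi>])
qed

section \<open>Determinants and eigenvalues\<close>

definition cscale :: "complex \<Rightarrow> complex^'n^'n \<Rightarrow> complex^'n^'n" where
  "cscale w A = (\<chi> i j. w * A $ i $ j)"

lemma cscale_nth [simp]: "cscale w A $ i $ j = w * A $ i $ j"
  by (simp add: cscale_def)

lemma cscale_0 [simp]: "cscale 0 A = 0"
  by (simp add: cscale_def vec_eq_iff)

lemma cscale_mult_vector: "cscale w A *v x = w *s (A *v x)"
  by (simp add: vec_eq_iff matrix_vector_mult_def sum_distrib_left mult.assoc)

lemma det_eq_0_iff_kernel:
  fixes A :: "complex^'n^'n"
  shows "det A = 0 \<longleftrightarrow> (\<exists>v. v \<noteq> 0 \<and> A *v v = 0)"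
  using invertible_det_nz[of A] by (auto simp: invertible_left_inverse matrix_left_invertible_ker)

lemma mat_mult_vector: "(mat k :: complex^'n^'n) *v x = k *s x"
  by (vector matrix_vector_mult_def mat_def) (simp add: if_distrib if_distribR cong del: if_weak_cong)

lemma eigenvalue_iff_det:
  fixes A :: "complex^'n^'n"
  shows "(\<exists>v. v \<noteq> 0 \<and> A *v v = k *s v) \<longleftrightarrow> det (mat k - A) = 0"
  by (auto simp: det_eq_0_iff_kernel matrix_vector_mult_diff_rdistrib mat_mult_vector)

text \<open>The zeros w are the reciprocals of the nonzero eigenvalues, so eigenvalues outside the
  unit circle become zeros inside it. This form of the characteristic polynomial has the value det
  Id at w = 0, a starting point for homotopies.\<close>

lemma det_resolvent_eq_0_iff:
  fixes A :: "complex^'n^'n"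
  assumes "w \<noteq> 0"
  shows "det (mat 1 - cscale w A) = 0 \<longleftrightarrow> (\<exists>v. v \<noteq> 0 \<and> A *v v = inverse w *s v)"
proof -
  have "(mat 1 - cscale w A) *v v = 0 \<longleftrightarrow> A *v v = inverse w *s v" for v
    using assms by (simp add: matrix_vector_mult_diff_rdistrib cscale_mult_vector vec_eq_iff)
      (metis (no_types, opaque_lifting) field_class.field_inverse left_inverse mult.assoc mult.left_commute mult_1 mult.commute)
  then show ?thesis by (simp add: det_eq_0_iff_kernel)
qed

lemma tendsto_det:
  fixes f :: "'a \<Rightarrow> ('b::real_normed_field)^'n^'n"
  assumes "(f \<longlongrightarrow> A) F" shows "((\<lambda>x. det (f x)) \<longlongrightarrow> det A) F"
  unfolding det_def by (intro tendsto_intros assms)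

lemma continuous_on_det:
  fixes f :: "'a::topological_space \<Rightarrow> ('b::real_normed_field)^'n^'n"
  assumes "continuous_on S f" shows "continuous_on S (\<lambda>x. det (f x))"
  using assms unfolding continuous_on_def by (auto intro: tendsto_det)

lemma holomorphic_on_det:
  fixes f :: "complex \<Rightarrow> complex^'n^'n"
  assumes "\<And>i j. (\<lambda>z. f z $ i $ j) holomorphic_on S"
  shows "(\<lambda>z. det (f z)) holomorphic_on S"
  unfolding det_def by (intro holomorphic_intros assms)

lemma continuous_on_matrix:
  fixes f :: "'a::topological_space \<Rightarrow> ('b::real_normed_field)^'n^'m"
  assumes "\<And>i j. continuous_on S (\<lambda>z. f z $ i $ j)"
  shows "continuous_on S f"
proof -
  have "continuous_on S (\<lambda>z. \<chi> i j. f z $ i $ j)" by (intro continuous_on_vec_lambda assms)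
  then show ?thesis by simp
qed

lemma norm_matrix_le:
  fixes A :: "('b::real_normed_vector)^'n^'n"
  assumes "\<And>i j. norm (A $ i $ j) \<le> e"
  shows "norm A \<le> real CARD('n) * real CARD('n) * e"
proof -
  have "norm A \<le> (\<Sum>i\<in>UNIV. norm (A $ i))" unfolding norm_vec_def by (rule L2_set_le_sum) simp
  also have "\<dots> \<le> (\<Sum>i\<in>(UNIV::'n set). real CARD('n) * e)"
  proof (rule sum_mono)
    fix i
    have "norm (A $ i) \<le> (\<Sum>j\<in>UNIV. norm (A $ i $ j))" unfolding norm_vec_def by (rule L2_set_le_sum) simp
    also have "\<dots> \<le> real CARD('n) * e" using assms by (intro sum_bounded_above) auto
    finally show "norm (A $ i) \<le> real CARD('n) * e" .
  qed
  finally show ?thesis by simp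
qed

lemma uniform_limit_matrixI:
  fixes f :: "nat \<Rightarrow> 'a \<Rightarrow> ('b::real_normed_vector)^'n^'n"
  assumes "\<And>n x i j. x \<in> K \<Longrightarrow> norm (f n x $ i $ j - g x $ i $ j) \<le> e n" and "e \<longlonglongrightarrow> 0"
  shows "uniform_limit K f g sequentially"
proof (rule uniform_limitI)
  fix \<epsilon> :: real assume "0 < \<epsilon>"
  have "(\<lambda>n. real CARD('n) * real CARD('n) * e n) \<longlonglongrightarrow> 0" using assms(2) by (rule tendsto_mult_right_zero)
  then have "\<forall>\<^sub>F n in sequentially. real CARD('n) * real CARD('n) * e n < \<epsilon>"
    using \<open>0 < \<epsilon>\<close> by (rule order_tendstoD)
  then show "\<forall>\<^sub>F n in sequentially. \<forall>x\<in>K. dist (f n x) (g x) < \<epsilon>"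
  proof eventually_elim
    case (elim n)
    show ?case
    proof
      fix x assume "x \<in> K"
      then have "norm (f n x - g x) \<le> real CARD('n) * real CARD('n) * e n"
        using assms(1) by (intro norm_matrix_le) simp
      with elim show "dist (f n x) (g x) < \<epsilon>" by (simp add: dist_norm)
    qed
  qed
qed

text \<open>The determinant is uniformly continuous on a closed ball whose radius exceeds the bound
  of the limit by 1; eventually all \<open>f n\<close> take their values there.\<close>

lemma uniform_limit_det:
  fixes f :: "'i \<Rightarrow> 'a \<Rightarrow> complex^'n^'n"
  assumes lim: "uniform_limit K f g F" and "bounded (g ` K)"
  shows "uniform_limit K (\<lambda>n x. det (f n x)) (\<lambda>x. det (g x)) F"
proof -
  obtain B where B: "\<And>x. x \<in> K \<Longrightarrow> norm (g x) \<le> B" using assms(2) by (auto simp: bounded_iff)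
  let ?U = "cball (0::complex^'n^'n) (B + 1)"
  have uc: "uniformly_continuous_on ?U det"
    by (intro compact_uniformly_continuous continuous_on_det continuous_intros) auto
  have "\<forall>\<^sub>F n in F. f n ` K \<subseteq> ?U"
    using uniform_limitD[OF lim zero_less_one]
  proof eventually_elim
    case (elim n)
    show ?case
    proof
      fix y assume "y \<in> f n ` K"
      then obtain x where x: "x \<in> K" "y = f n x" by auto
      have "norm y \<le> norm (y - g x) + norm (g x)" using norm_triangle_ineq[of "y - g x" "g x"] by simp
      also have "\<dots> \<le> 1 + B" using elim x B by (intro add_mono) (auto simp: dist_norm less_imp_le)
      finally show "y \<in> ?U" by simp
    qed
  qed
  moreover have "g ` K \<subseteq> ?U" using B by force
  ultimately show ?thesis using uniform_limit_compose[OF lim uc] by (simp add: o_def)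
qed

lemma char_poly_exists:
  fixes A :: "complex^'n^'n"
  obtains p where "\<And>k. poly p k = det (mat k - A)"
proof -
  let ?p = "\<Sum>\<pi> | \<pi> permutes (UNIV::'n set). of_int (sign \<pi>) *
      (\<Prod>i\<in>UNIV. [: - A $ i $ \<pi> i, if i = \<pi> i then 1 else 0 :])"
  have "poly ?p k = det (mat k - A)" for k
    unfolding det_def poly_sum poly_mult poly_prod
    by (intro sum.cong refl arg_cong2[where f="(*)"] prod.cong) (auto simp: mat_def)
  then show ?thesis using that by blast
qed

lemma det_resolvent_scaling:
  fixes A :: "complex^'n^'n"
  assumes "w \<noteq> 0"
  shows "det (mat 1 - cscale w A) = w ^ CARD('n) * det (mat (inverse w) - A)"
proof -
  have "det (mat w :: complex^'n^'n) = w ^ CARD('n)"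
    by (subst det_diagonal) (auto simp: mat_def)
  moreover have "mat w ** (mat (inverse w) - A) = mat 1 - cscale w A"
    unfolding matrix_eq
    using assms
    by (simp add: matrix_vector_mul_assoc[symmetric] matrix_vector_mult_diff_rdistrib mat_mult_vector cscale_mult_vector
        vec_eq_iff right_diff_distrib mult.assoc[symmetric])
  ultimately show ?thesis by (metis det_mul)
qed

lemma tendsto_det_resolvent: "((\<lambda>w. det (mat 1 - cscale w A)) \<longlongrightarrow> det (mat 1 :: complex^'n^'n)) (at 0)"
proof -
  have "continuous_on UNIV (\<lambda>w. det (mat 1 - cscale w A))"
    by (intro continuous_on_det continuous_on_matrix) (auto intro!: continuous_intros)
  then have "((\<lambda>w. det (mat 1 - cscale w A)) \<longlongrightarrow> det (mat 1 - cscale 0 A)) (at 0)"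
    unfolding continuous_on_def by (drule_tac x=0 in bspec) simp_all
  then show ?thesis by simp
qed

text \<open>Needed for the \<open>Max\<close> in \<open>spectral_radius\<close> to be meaningful. If
  the characteristic polynomial were a constant c, then det (Id - wA) = w^d c for w \<noteq> 0 would
  tend to 0 as w tends to 0, whereas it tends to det Id.\<close>

lemma finite_eigenvalues:
  fixes A :: "complex^'n^'n"
  shows "finite {k. \<exists>v. v \<noteq> 0 \<and> A *v v = k *s v}" (is "finite ?E")
    and "{k. \<exists>v. v \<noteq> 0 \<and> A *v v = k *s v} \<noteq> {}"
proof -
  obtain p where p: "\<And>k. poly p k = det (mat k - A)" using char_poly_exists by blast
  have E: "?E = {k. poly p k = 0}" by (simp add: eigenvalue_iff_det p)
  have sc: "det (mat 1 - cscale w A) = w ^ CARD('n) * poly p (inverse w)" if "w \<noteq> 0" for w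
    using det_resolvent_scaling[OF that] by (simp add: p)
  have nconst: "\<not> (\<forall>k. poly p k = c)" for c
  proof
    assume c: "\<forall>k. poly p k = c"
    have "((\<lambda>w::complex. w ^ CARD('n) * c) \<longlongrightarrow> 0 ^ CARD('n) * c) (at 0)"
      by (intro tendsto_intros)
    moreover have "0 ^ CARD('n) * c = 0" by simp
    ultimately have "((\<lambda>w::complex. w ^ CARD('n) * c) \<longlongrightarrow> 0) (at 0)" by (simp only:)
    moreover have "\<forall>\<^sub>F w in at 0. w ^ CARD('n) * c = det (mat 1 - cscale w A)"
      using sc c by (auto simp: eventually_at_filter)
    ultimately have "((\<lambda>w. det (mat 1 - cscale w A)) \<longlongrightarrow> 0) (at 0)"
      by (rule Lim_transform_eventually)
    then show False using tendsto_unique[OF trivial_limit_at _ tendsto_det_resolvent] by fastforce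
  qed
  from nconst[of 0] have "p \<noteq> 0" by auto
  then show "finite ?E" unfolding E by (rule poly_roots_finite)
  have "\<not> (\<exists>a l. a \<noteq> 0 \<and> l = 0 \<and> p = pCons a l)"
  proof clarify
    fix a assume "p = [:a:]"
    with nconst[of a] show False by simp
  qed
  then show "?E \<noteq> {}" unfolding E using fundamental_theorem_of_algebra_alt by blast
qed

lemma spectral_radius_eigenvalue:
  fixes A :: "complex^'n^'n"
  shows "v \<noteq> 0 \<Longrightarrow> A *v v = k *s v \<Longrightarrow> cmod k \<le> spectral_radius A"
    and "\<exists>k v. v \<noteq> 0 \<and> A *v v = k *s v \<and> cmod k = spectral_radius A"
proof -
  have eq: "{cmod k | k. \<exists>v. v \<noteq> 0 \<and> A *v v = k *s v} = cmod ` {k. \<exists>v. v \<noteq> 0 \<and> A *v v = k *s v}" by auto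
  show "v \<noteq> 0 \<Longrightarrow> A *v v = k *s v \<Longrightarrow> cmod k \<le> spectral_radius A"
    unfolding spectral_radius_def eq using finite_eigenvalues by (intro Max_ge) auto
  have "spectral_radius A \<in> cmod ` {k. \<exists>v. v \<noteq> 0 \<and> A *v v = k *s v}"
    unfolding spectral_radius_def eq using finite_eigenvalues by (intro Max_in) auto
  then obtain k v where "v \<noteq> 0" "A *v v = k *s v" "spectral_radius A = cmod k" by blast
  then show "\<exists>k v. v \<noteq> 0 \<and> A *v v = k *s v \<and> cmod k = spectral_radius A" by metis
qed

lemma det_resolvent_nonzero:
  fixes A :: "complex^'n^'n"
  assumes "cmod w * spectral_radius A < 1"
  shows "det (mat 1 - cscale w A) \<noteq> 0"
proof (cases "w = 0")
  case False
  show ?thesis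
  proof
    assume "det (mat 1 - cscale w A) = 0"
    then obtain v where "v \<noteq> 0" "A *v v = inverse w *s v" using det_resolvent_eq_0_iff[OF False] by blast
    then have "cmod (inverse w) \<le> spectral_radius A" by (rule spectral_radius_eigenvalue)
    then have "cmod w * cmod (inverse w) \<le> cmod w * spectral_radius A" by (rule mult_left_mono) simp
    then show False using assms False by (simp add: norm_inverse)
  qed
qed simp

lemma det_resolvent_zero_exists:
  fixes A :: "complex^'n^'n"
  assumes "1 < spectral_radius A"
  obtains w where "cmod w < 1" "det (mat 1 - cscale w A) = 0"
proof -
  obtain k v where k: "v \<noteq> 0" "A *v v = k *s v" "cmod k = spectral_radius A"
    using spectral_radius_eigenvalue(2) by blast
  then have "k \<noteq> 0" using assms by auto
  then have "det (mat 1 - cscale (inverse k) A) = 0" using k by (subst det_resolvent_eq_0_iff) auto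
  moreover have "cmod (inverse k) < 1" using k assms by (simp add: norm_inverse inverse_less_1_iff)
  ultimately show ?thesis using that by blast
qed

text \<open>If there were a zero, compactness would give a least parameter t0 with a zero.
  Nonvanishing on the circle puts this zero into the open disc, while for s < t0 the disc is free of
  zeros; Hurwitz' theorem along parameters increasing to t0 excludes this.\<close>

lemma homotopy_nonvanishing:
  fixes q :: "real \<Rightarrow> complex \<Rightarrow> complex"
  assumes "0 < r" and cont: "continuous_on ({0..1} \<times> cball 0 r) (\<lambda>p. q (fst p) (snd p))"
    and hol: "\<And>t. t \<in> {0..1} \<Longrightarrow> q t holomorphic_on ball 0 r"
    and bd: "\<And>t z. t \<in> {0..1} \<Longrightarrow> cmod z = r \<Longrightarrow> q t z \<noteq> 0"
    and init: "\<And>z. cmod z \<le> r \<Longrightarrow> q 0 z \<noteq> 0"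
    and t: "t \<in> {0..1}" and z: "cmod z \<le> r"
  shows "q t z \<noteq> 0"
proof
  assume "q t z = 0"
  let ?X = "{0..1::real} \<times> cball (0::complex) r"
  define Z where "Z = ?X \<inter> (\<lambda>p. q (fst p) (snd p)) -` {0}"
  have cX: "compact ?X" by (intro compact_Times) auto
  then have "closed Z" unfolding Z_def
    by (intro continuous_closed_preimage cont compact_imp_closed closed_singleton)
  then have "compact (?X \<inter> Z)" by (rule compact_Int_closed[OF cX])
  moreover have "?X \<inter> Z = Z" by (auto simp: Z_def)
  ultimately have "compact Z" by simp
  then have cT: "compact (fst ` Z)" by (intro compact_continuous_image continuous_on_fst continuous_on_id)
  have "(t, z) \<in> Z" using \<open>q t z = 0\<close> t z by (simp add: Z_def)
  then have ne: "fst ` Z \<noteq> {}" by blast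
  obtain t0 where t0: "t0 \<in> fst ` Z" and least: "\<And>s. s \<in> fst ` Z \<Longrightarrow> t0 \<le> s"
    using compact_attains_inf[OF cT ne] by blast
  from t0 obtain z0 where z0: "t0 \<in> {0..1}" "cmod z0 \<le> r" "q t0 z0 = 0" by (auto simp: Z_def)
  have t0pos: "0 < t0" using z0 init[of z0] by (cases "t0 = 0") auto
  have z0r: "cmod z0 < r" using z0 bd[of t0 z0] by (cases "cmod z0 = r") auto
  have nz: "q s u \<noteq> 0" if "0 \<le> s" "s < t0" "cmod u \<le> r" for s u
  proof
    assume "q s u = 0"
    then have "(s, u) \<in> Z" using that z0 by (simp add: Z_def)
    then show False using least[of s] that by force
  qed
  define s where "s n = t0 * (1 - 1 / real (Suc n))" for n
  have s: "0 \<le> s n" "s n < t0" for n using t0pos by (auto simp: s_def field_simps)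
  have "s \<longlonglongrightarrow> t0 * (1 - 0)"
    unfolding s_def using LIMSEQ_inverse_real_of_nat by (intro tendsto_intros) (simp add: inverse_eq_divide)
  then have slim: "s \<longlonglongrightarrow> t0" by simp
  have uc: "uniformly_continuous_on ?X (\<lambda>p. q (fst p) (snd p))"
    using cont cX by (rule compact_uniformly_continuous)
  have ul: "uniform_limit (cball 0 r) (\<lambda>n. q (s n)) (q t0) sequentially"
  proof (rule uniform_limitI)
    fix e :: real assume "0 < e"
    then obtain d where d: "0 < d" "\<And>x y. x \<in> ?X \<Longrightarrow> y \<in> ?X \<Longrightarrow> dist y x < d \<Longrightarrow>
        dist (q (fst y) (snd y)) (q (fst x) (snd x)) < e"
      using uc unfolding uniformly_continuous_on_def by metis
    from tendstoD[OF slim d(1)] show "\<forall>\<^sub>F n in sequentially. \<forall>x\<in>cball 0 r. dist (q (s n) x) (q t0 x) < e"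
    proof eventually_elim
      case (elim n)
      have "dist (q (s n) x) (q t0 x) < e" if "x \<in> cball 0 r" for x
        using d(2)[of "(t0, x)" "(s n, x)"] that z0 s(1)[of n] less_imp_le[OF s(2)[of n]] elim
        by (simp add: dist_Pair_Pair)
      then show ?case by blast
    qed
  qed
  \<comment> \<open>Hurwitz' theorem excepts constant limits. Here the constant would be 0 and, by
    continuity, would also be attained on the circle.\<close>
  have "\<not> q t0 constant_on ball 0 r"
  proof
    assume "q t0 constant_on ball 0 r"
    then have 0: "q t0 x = 0" if "x \<in> ball 0 r" for x
      using that z0 z0r unfolding constant_on_def by (metis mem_ball_0)
    have "continuous_on (cball 0 r) (\<lambda>x. q (fst (t0, x)) (snd (t0, x)))"
      using z0 by (intro continuous_on_compose2[OF cont] continuous_intros) auto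
    then have c: "continuous_on (closure (ball 0 r)) (q t0)" using \<open>0 < r\<close> by simp
    have "q t0 (of_real r) = 0"
      using continuous_constant_on_closure[OF c 0] \<open>0 < r\<close> by simp
    then show False using bd[of t0 "of_real r"] z0 \<open>0 < r\<close> by simp
  qed
  moreover have "q (s n) holomorphic_on ball 0 r" for n
    using hol s[of n] z0 by simp
  ultimately have "q t0 z0 \<noteq> 0"
    using hol s z0 z0r nz
    by (intro Hurwitz_no_zeros[of "ball 0 r" "\<lambda>n. q (s n)" "q t0"] uniform_limit_on_subset[OF ul])
       (auto simp: less_imp_le order_trans[OF less_imp_le])
  with z0 show False by simp
qed

section \<open>Pushforwards under \<open>\<rho>\<^sub>H\<^sub>S < 1\<close>\<close>

definition entry :: "(real \<Rightarrow> real^'n^'n) \<Rightarrow> 'n \<Rightarrow> 'n \<Rightarrow> real set \<Rightarrow> real" where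
  "entry M i j A = measure_of_nbv M A $ i $ j"

lemma entry_diff_of_measures:
  assumes "M \<in> NBV" obtains m1 m2 where "diff_of_measures (entry M i j) m1 m2"
  using diff_of_measures_nbv(1)[OF assms, of i j] unfolding entry_def[abs_def] by blast

lemma integral_scal_nth: "integral_scal M f $ i $ j = signed_integral (entry M i j) f"
  by (simp add: integral_scal_def entry_def[abs_def])

lemma integral_scal_mult: "integral_scal M (\<lambda>x. w * f x) = cscale w (integral_scal M f)"
  by (simp add: vec_eq_iff integral_scal_nth signed_integral_mult)

lemma integral_scal_cong: "(\<And>x. x \<in> {-1..0} \<Longrightarrow> f x = g x) \<Longrightarrow> integral_scal M f = integral_scal M g"
  by (auto simp: vec_eq_iff integral_scal_nth intro!: signed_integral_cong)

lemma integral_scal_simple_compose: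
  assumes "M \<in> NBV" "simple_function borel_I g"
  shows "integral_scal M (\<lambda>x. c (g x)) =
    (\<Sum>v\<in>g ` {-1..0}. cscale (c v) (\<chi> i j. of_real (measure_of_nbv M (g -` {v} \<inter> {-1..0}) $ i $ j)))"
proof -
  have "integral_scal M (\<lambda>x. c (g x)) $ i $ j =
    (\<Sum>v\<in>g ` {-1..0}. cscale (c v) (\<chi> i j. of_real (measure_of_nbv M (g -` {v} \<inter> {-1..0}) $ i $ j))) $ i $ j" for i j
  proof -
    obtain m1 m2 where "diff_of_measures (entry M i j) m1 m2" using entry_diff_of_measures[OF assms(1)] .
    then show ?thesis
      using signed_integral_simple_compose[OF _ assms(2), of _ _ _ c]
      by (simp add: integral_scal_nth entry_def scaleR_conv_of_real mult.commute)
  qed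
  then show ?thesis by (simp add: vec_eq_iff)
qed

text \<open>Induction over the set J of coefficients already released from the circle into the
  closed disc; the next coefficient is the complex variable of the homotopy. \<open>w\<close> is
  quantified inside the induction because the homotopy scales it.\<close>

lemma det_nonvanishing_polydisc:
  fixes C :: "'k \<Rightarrow> complex^'n^'n"
  assumes "finite K"
    and circ: "\<And>c w. (\<forall>k\<in>K. cmod (c k) = 1) \<Longrightarrow> cmod w < R \<Longrightarrow> det (mat 1 - cscale w (\<Sum>k\<in>K. cscale (c k) (C k))) \<noteq> 0"
    and c: "\<forall>k\<in>K. cmod (c k) \<le> 1" and w: "cmod w < R"
  shows "det (mat 1 - cscale w (\<Sum>k\<in>K. cscale (c k) (C k))) \<noteq> 0"
proof -
  have "\<forall>c w. (\<forall>k\<in>J. cmod (c k) \<le> 1) \<and> (\<forall>k\<in>K-J. cmod (c k) = 1) \<and> cmod w < R \<longrightarrow>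
      det (mat 1 - cscale w (\<Sum>k\<in>K. cscale (c k) (C k))) \<noteq> 0" if "finite J" "J \<subseteq> K" for J
    using that
  proof (induction J)
    case empty then show ?case using circ by auto
  next
    case (insert j J)
    then have j: "j \<in> K" by auto
    have IH: "\<forall>c w. (\<forall>k\<in>J. cmod (c k) \<le> 1) \<and> (\<forall>k\<in>K-J. cmod (c k) = 1) \<and> cmod w < R \<longrightarrow>
      det (mat 1 - cscale w (\<Sum>k\<in>K. cscale (c k) (C k))) \<noteq> 0"
      using insert.IH insert.prems by blast
    show ?case
    proof (intro allI impI)
      fix c :: "'k \<Rightarrow> complex" and w
      assume cw: "(\<forall>k\<in>insert j J. cmod (c k) \<le> 1) \<and> (\<forall>k\<in>K - insert j J. cmod (c k) = 1) \<and> cmod w < R"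
      define B where "B = (\<Sum>k\<in>K-{j}. cscale (c k) (C k))"
      \<comment> \<open>The parameter t multiplies w: t = 0 gives det Id, t = 1 gives the claim, and
        on the circle the induction hypothesis applies because |t w| < R.\<close>
      define q where "q t z = det (mat 1 - cscale (of_real t * w) (B + cscale z (C j)))" for t :: real and z
      have split: "(\<Sum>k\<in>K. cscale ((c(j := z)) k) (C k)) = B + cscale z (C j)" for z
        using \<open>finite K\<close> j unfolding B_def by (subst sum.remove[of _ j]) (auto intro!: sum.cong)
      have "q 1 (c j) \<noteq> 0"
      proof (rule homotopy_nonvanishing[where q=q and r=1])
        show "continuous_on ({0..1} \<times> cball 0 1) (\<lambda>p. q (fst p) (snd p))"
          unfolding q_def by (intro continuous_on_det continuous_on_matrix) (auto intro!: continuous_intros)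
        show "q t holomorphic_on ball 0 1" for t
          unfolding q_def by (intro holomorphic_on_det) (auto intro!: holomorphic_intros)
        show "q 0 z \<noteq> 0" for z by (simp add: q_def)
        fix t :: real and z assume t: "t \<in> {0..1}" and z: "cmod z = 1"
        have "cmod (of_real t * w) \<le> cmod w" using t by (simp add: norm_mult mult_left_le_one_le)
        then have "cmod (of_real t * w) < R" using cw by simp
        moreover have "\<forall>k\<in>J. cmod ((c(j := z)) k) \<le> 1" "\<forall>k\<in>K - J. cmod ((c(j := z)) k) = 1" using cw z by auto
        ultimately have "det (mat 1 - cscale (of_real t * w) (\<Sum>k\<in>K. cscale ((c(j := z)) k) (C k))) \<noteq> 0"
          using IH by blast
        then show "q t z \<noteq> 0" unfolding q_def split .
      qed (use cw in auto)
      then show "det (mat 1 - cscale w (\<Sum>k\<in>K. cscale (c k) (C k))) \<noteq> 0"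
        using split[of "c j"] by (simp add: q_def)
    qed
  qed
  from this[OF \<open>finite K\<close> subset_refl] show ?thesis using c w by blast
qed

lemma simple_function_unit_disc_approx:
  fixes z :: "real \<Rightarrow> complex"
  assumes z: "z \<in> borel_measurable borel_I" and bd: "\<And>x. x \<in> {-1..0} \<Longrightarrow> cmod (z x) \<le> 1"
  obtains s where "\<And>n. simple_function borel_I (s n)" "\<And>n x. cmod (s n x) \<le> 1"
    "\<And>x. x \<in> {-1..0} \<Longrightarrow> (\<lambda>n::nat. s n x) \<longlonglongrightarrow> z x"
proof -
  obtain s where s: "\<And>n. simple_function borel_I (s n)" "\<And>x. x \<in> {-1..0} \<Longrightarrow> (\<lambda>n. s n x) \<longlonglongrightarrow> z x"
    using borel_measurable_implies_sequence_metric[OF z, of 0] unfolding space_borel_I by metis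
  \<comment> \<open>The radial retraction onto the closed unit disc: it is continuous and fixes the
    values of \<open>z\<close>, so the limit is preserved.\<close>
  define p where "p u = u / of_real (max 1 (cmod u))" for u :: complex
  have "(\<lambda>n. p (s n x)) \<longlonglongrightarrow> z x" if "x \<in> {-1..0}" for x
  proof -
    have "(\<lambda>n. p (s n x)) \<longlonglongrightarrow> p (z x)"
      unfolding p_def by (intro tendsto_intros s(2) that) (auto simp: max_def)
    moreover have "p (z x) = z x" using bd[OF that] by (simp add: p_def max_def)
    ultimately show ?thesis by simp
  qed
  moreover have "cmod (p u) \<le> 1" for u by (auto simp: p_def norm_divide max_def field_simps)
  moreover have "simple_function borel_I (\<lambda>x. p (s n x))" for n using s(1) by (rule simple_function_compose1)
  ultimately show ?thesis using that[of "\<lambda>n x. p (s n x)"] by blast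
qed

text \<open>Hurwitz' theorem in the variable w. In the exceptional constant case the value is the
  one at w = 0, the determinant of the identity.\<close>

lemma resolvent_nonvanishing_limit:
  fixes A :: "nat \<Rightarrow> complex^'n^'n"
  assumes lim: "A \<longlonglongrightarrow> B" and "0 < R"
    and nz: "\<And>n w. cmod w < R \<Longrightarrow> det (mat 1 - cscale w (A n)) \<noteq> 0" and w: "cmod w < R"
  shows "det (mat 1 - cscale w B) \<noteq> 0"
proof -
  have ul: "uniform_limit K (\<lambda>n w. det (mat 1 - cscale w (A n))) (\<lambda>w. det (mat 1 - cscale w B)) sequentially"
    if "K \<subseteq> ball 0 R" for K
  proof (rule uniform_limit_det)
    show "uniform_limit K (\<lambda>n w. mat 1 - cscale w (A n)) (\<lambda>w. mat 1 - cscale w B) sequentially"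
    proof (rule uniform_limit_matrixI)
      fix n x i j assume "x \<in> K"
      have "norm ((mat 1 - cscale x (A n)) $ i $ j - (mat 1 - cscale x B) $ i $ j) =
          cmod (x * ((A n - B) $ i $ j))"
        by (simp add: norm_minus_commute algebra_simps)
      also have "\<dots> = cmod x * cmod ((A n - B) $ i $ j)" by (rule norm_mult)
      also have "\<dots> \<le> R * norm (A n - B)"
        using \<open>x \<in> K\<close> that Finite_Cartesian_Product.norm_nth_le[of "(A n - B) $ i" j]
          Finite_Cartesian_Product.norm_nth_le[of "A n - B" i]
        by (intro mult_mono) (auto simp: less_imp_le \<open>0 < R\<close>)
      finally show "norm ((mat 1 - cscale x (A n)) $ i $ j - (mat 1 - cscale x B) $ i $ j)
          \<le> R * norm (A n - B)" .
    next
      show "(\<lambda>n. R * norm (A n - B)) \<longlonglongrightarrow> 0"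
        using lim by (intro tendsto_mult_right_zero tendsto_norm_zero LIM_zero)
    qed
    have "continuous_on (cball 0 R) (\<lambda>w. mat 1 - cscale w B)"
      by (intro continuous_on_matrix) (auto intro!: continuous_intros)
    then have "bounded ((\<lambda>w. mat 1 - cscale w B) ` cball 0 R)"
      by (intro compact_imp_bounded compact_continuous_image) auto
    then show "bounded ((\<lambda>w. mat 1 - cscale w B) ` K)"
      by (rule bounded_subset) (use that in \<open>auto simp: less_imp_le\<close>)
  qed
  show ?thesis
  proof (cases "(\<lambda>w. det (mat 1 - cscale w B)) constant_on ball 0 R")
    case True
    then have "det (mat 1 - cscale w B) = det (mat 1 - cscale 0 B)"
      using w \<open>0 < R\<close> unfolding constant_on_def by (metis centre_in_ball mem_ball_0)
    then show ?thesis by simp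
  next
    case False
    show ?thesis
      using False ul nz w
      by (intro Hurwitz_no_zeros[of "ball 0 R" "\<lambda>n w. det (mat 1 - cscale w (A n))" "\<lambda>w. det (mat 1 - cscale w B)" w]
          holomorphic_on_det) (auto intro!: holomorphic_intros)
  qed
qed

lemma det_nonvanishing_unit_disc:
  fixes M :: "real \<Rightarrow> real^'n^'n"
  assumes M: "M \<in> NBV" and "0 < R"
    and circ: "\<And>\<xi> w. \<xi> \<in> borel_measurable borel_I \<Longrightarrow> cmod w < R \<Longrightarrow>
      det (mat 1 - cscale w (integral_scal M (\<lambda>\<theta>. exp (\<i> * of_real (\<xi> \<theta>))))) \<noteq> 0"
    and z: "z \<in> borel_measurable borel_I" and bd: "\<And>x. x \<in> {-1..0} \<Longrightarrow> cmod (z x) \<le> 1" and w: "cmod w < R"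
  shows "det (mat 1 - cscale w (integral_scal M z)) \<noteq> 0"
proof -
  have simple: "det (mat 1 - cscale w (integral_scal M g)) \<noteq> 0"
    if g: "simple_function borel_I g" and b: "\<And>x. cmod (g x) \<le> 1" and w: "cmod w < R" for g w
  proof -
    let ?C = "\<lambda>v. \<chi> i j. complex_of_real (measure_of_nbv M (g -` {v} \<inter> {-1..0}) $ i $ j)"
    have "finite (g ` {-1..0})" using simple_functionD(1)[OF g] by simp
    then have "det (mat 1 - cscale w (\<Sum>v\<in>g ` {-1..0}. cscale v (?C v))) \<noteq> 0"
    proof (rule det_nonvanishing_polydisc[where R=R and c="\<lambda>v. v"])
      fix c w assume c: "\<forall>k\<in>g ` {-1..0}. cmod (c k) = 1" and w: "cmod w < R"
      \<comment> \<open>A unimodular number is the exponential of i times its argument, so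
        unimodular values on the level sets amount to a phase function as in
        \<open>rho_HS\<close>.\<close>
      have "simple_function borel_I (\<lambda>x. Arg (c (g x)))" using g by (rule simple_function_compose1)
      then have m: "(\<lambda>x. Arg (c (g x))) \<in> borel_measurable borel_I" by (rule borel_measurable_simple_function)
      have "integral_scal M (\<lambda>x. exp (\<i> * of_real (Arg (c (g x))))) = integral_scal M (\<lambda>x. c (g x))"
        using c by (intro integral_scal_cong) (metis Arg_eq imageI mult_1 norm_eq_zero of_real_1 zero_neq_one)
      also have "\<dots> = (\<Sum>v\<in>g ` {-1..0}. cscale (c v) (?C v))" by (rule integral_scal_simple_compose[OF M g])
      finally show "det (mat 1 - cscale w (\<Sum>v\<in>g ` {-1..0}. cscale (c v) (?C v))) \<noteq> 0"
        using circ[OF m w] by simp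
    qed (use b w in auto)
    then show ?thesis using integral_scal_simple_compose[OF M g, of "\<lambda>v. v"] by simp
  qed
  obtain s where s: "\<And>n. simple_function borel_I (s n)" "\<And>n x. cmod (s n x) \<le> 1"
    "\<And>x. x \<in> {-1..0} \<Longrightarrow> (\<lambda>n::nat. s n x) \<longlonglongrightarrow> z x"
    using simple_function_unit_disc_approx[OF z bd] by blast
  let ?I = "integral_scal M z"
  have lim: "(\<lambda>n. integral_scal M (s n)) \<longlonglongrightarrow> ?I"
  proof (intro vec_tendstoI)
    fix i j
    obtain m1 m2 where "diff_of_measures (entry M i j) m1 m2" using entry_diff_of_measures[OF M] .
    then show "(\<lambda>n. integral_scal M (s n) $ i $ j) \<longlonglongrightarrow> ?I $ i $ j"
      unfolding integral_scal_nth using s z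
      by (intro signed_integral_bounded_convergence[where B=1]) (auto intro: borel_measurable_simple_function)
  qed
  show ?thesis using resolvent_nonvanishing_limit[OF lim \<open>0 < R\<close> simple[OF s(1,2)] w] .
qed

section \<open>Location of the zeros after a pushforward\<close>

lemma borel_measurable_exp_borel_I [measurable]:
  "(\<lambda>x. exp (s * complex_of_real x)) \<in> borel_measurable borel_I"
  by (intro borel_measurable_continuous_on_restrict continuous_intros)

lemma bounded_measurable_exp: "bounded_measurable (\<lambda>x. exp (s * complex_of_real x))"
proof (rule bounded_measurableI)
  fix x :: real assume x: "x \<in> {-1..0}"
  then have "\<bar>Re s * x\<bar> \<le> \<bar>Re s\<bar> * 1" unfolding abs_mult by (intro mult_left_mono) auto
  then show "norm (exp (s * complex_of_real x)) \<le> exp \<bar>Re s\<bar>" by simp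
qed measurable

lemma char_fun_pushforward_nbv:
  assumes "M \<in> NBV" "\<phi> \<in> measurable borel_I borel_I"
  shows "char_fun (pushforward_nbv \<phi> M) s = det (mat 1 - integral_scal M (\<lambda>x. exp (s * of_real (\<phi> x))))"
  unfolding char_fun_def integral_scal_pushforward_nbv[OF assms bounded_measurable_exp] ..

text \<open>Any \<rho> strictly between \<open>rho_HS M\<close> and 1 yields R = 1/\<rho>; it is
  positive because spectral radii are nonnegative.\<close>

lemma rho_HS_less_one_resolvent:
  fixes M :: "real \<Rightarrow> real^'n^'n"
  assumes "rho_HS M < 1"
  obtains R where "1 < R" "\<And>\<xi> w. \<xi> \<in> borel_measurable borel_I \<Longrightarrow> cmod w < R \<Longrightarrow>
      det (mat 1 - cscale w (integral_scal M (\<lambda>\<theta>. exp (\<i> * of_real (\<xi> \<theta>))))) \<noteq> 0"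
proof -
  let ?A = "\<lambda>\<xi>. integral_scal M (\<lambda>\<theta>. exp (\<i> * of_real (\<xi> \<theta>)))"
  obtain \<rho> where \<rho>: "rho_HS M < ereal \<rho>" "ereal \<rho> < 1" using assms ereal_dense2 by blast
  have le: "spectral_radius (?A \<xi>) < \<rho>" if "\<xi> \<in> borel_measurable borel_I" for \<xi>
  proof -
    have "ereal (spectral_radius (?A \<xi>)) \<le> rho_HS M"
      unfolding rho_HS_def using that by (intro SUP_upper)
    then have "ereal (spectral_radius (?A \<xi>)) < ereal \<rho>" using \<rho>(1) by (rule le_less_trans)
    then show ?thesis by simp
  qed
  have "0 \<le> spectral_radius (?A (\<lambda>_. 0))"
    using spectral_radius_eigenvalue(2)[of "?A (\<lambda>_. 0)"] by (metis norm_ge_zero)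
  also have "\<dots> < \<rho>" by (rule le) simp
  finally have pos: "0 < \<rho>" .
  have lt1: "\<rho> < 1" using \<rho>(2) by (simp add: one_ereal_def)
  show ?thesis
  proof (rule that[of "1 / \<rho>"])
    show "1 < 1 / \<rho>" using pos lt1 by simp
    fix \<xi> :: "real \<Rightarrow> real" and w assume \<xi>: "\<xi> \<in> borel_measurable borel_I" and w: "cmod w < 1 / \<rho>"
    have "cmod w * spectral_radius (?A \<xi>) \<le> cmod w * \<rho>"
      using le[OF \<xi>] by (intro mult_left_mono) auto
    also have "\<dots> < 1" using w pos by (simp add: field_simps)
    finally show "det (mat 1 - cscale w (?A \<xi>)) \<noteq> 0" by (rule det_resolvent_nonzero)
  qed
qed

lemma spectral_abscissa_pushforward_neg:
  fixes M :: "real \<Rightarrow> real^'n^'n"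
  assumes M: "M \<in> NBV" and rho: "rho_HS M < 1" and \<phi>: "\<phi> \<in> measurable borel_I borel_I"
  shows "spectral_abscissa (pushforward_nbv \<phi> M) < 0"
proof -
  obtain R where R: "1 < R" "\<And>\<xi> w. \<xi> \<in> borel_measurable borel_I \<Longrightarrow> cmod w < R \<Longrightarrow>
      det (mat 1 - cscale w (integral_scal M (\<lambda>\<theta>. exp (\<i> * of_real (\<xi> \<theta>))))) \<noteq> 0"
    using rho_HS_less_one_resolvent[OF rho] by blast
  \<comment> \<open>Half of ln R leaves exp \<delta> < R, so exp \<delta> can serve as w. The same
    \<delta> works for all zeros and hence bounds their supremum.\<close>
  define \<delta> where "\<delta> = ln R / 2"
  have "0 < ln R" using R(1) by simp
  then have "0 < \<delta>" "exp \<delta> < exp (ln R)" by (auto simp: \<delta>_def)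
  then have \<delta>: "0 < \<delta>" "exp \<delta> < R" using R(1) by auto
  have "Re s < - \<delta>" if z: "char_fun (pushforward_nbv \<phi> M) s = 0" for s
  proof (rule ccontr)
    assume "\<not> Re s < - \<delta>"
    then have s: "- \<delta> \<le> Re s" by simp
    \<comment> \<open>For \<phi> in [-1,0] and Re s \<ge> -\<delta>, the modulus of exp (s \<phi>)
      is at most exp \<delta>. The factor exp (-\<delta>) brings the integrand into the unit disc
      and is compensated by w.\<close>
    define f where "f x = exp (- of_real \<delta>) * exp (s * of_real (\<phi> x))" for x
    have fm: "f \<in> borel_measurable borel_I"
      unfolding f_def using measurable_compose[OF \<phi> borel_measurable_exp_borel_I[of s]] by (intro borel_measurable_times) auto
    have "cmod (f x) \<le> 1" if "x \<in> {-1..0}" for x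
    proof -
      have "\<phi> x \<in> {-1..0}" using measurable_space[OF \<phi>] that by simp
      then have p: "-1 \<le> \<phi> x" "\<phi> x \<le> 0" by auto
      have "(Re s + \<delta>) * \<phi> x \<le> 0" using p s by (intro mult_nonneg_nonpos) auto
      moreover have "- \<delta> * \<phi> x \<le> \<delta>" using mult_left_mono[OF p(1), of \<delta>] \<delta> by simp
      ultimately have "Re s * \<phi> x - \<delta> \<le> 0" by (simp add: algebra_simps)
      then show ?thesis by (simp add: f_def norm_mult exp_minus field_simps exp_diff[symmetric])
    qed
    from det_nonvanishing_unit_disc[OF M _ R(2) fm this, of R "exp (of_real \<delta>)"]
    have "det (mat 1 - cscale (exp (of_real \<delta>)) (integral_scal M f)) \<noteq> 0"
      using R(1) \<delta> by simp
    moreover have "cscale (exp (of_real \<delta>)) (integral_scal M f) = integral_scal M (\<lambda>x. exp (s * of_real (\<phi> x)))"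
      unfolding integral_scal_mult[symmetric] by (intro integral_scal_cong) (simp add: f_def exp_minus)
    ultimately show False using z by (simp add: char_fun_pushforward_nbv[OF M \<phi>])
  qed
  then have "spectral_abscissa (pushforward_nbv \<phi> M) \<le> ereal (- \<delta>)"
    unfolding spectral_abscissa_def by (intro Sup_least) (auto simp: less_imp_le)
  also have "\<dots> < 0" using \<delta> by simp
  finally show ?thesis .
qed

lemma rho_HS_less_one_strongly_stable:
  assumes "M \<in> NBV" "rho_HS M < 1"
  shows "strongly_stable nrm M" "locally_strongly_stable nrm M"
proof -
  have "exponentially_stable nrm (pushforward_nbv \<phi> M)"
    if "\<phi> \<in> measurable borel_I borel_I" "pushforward_nbv \<phi> M \<in> G nrm" for \<phi>
    using spectral_abscissa_pushforward_neg[OF assms that(1)] that(2)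
    by (simp add: exponentially_stable_def G_def)
  then show "strongly_stable nrm M" "locally_strongly_stable nrm M"
    by (auto simp: strongly_stable_def locally_strongly_stable_def intro: exI[of _ 1])
qed

section \<open>Linear recursions and commensurable delays\<close>

lemma matrix_vector_mult_bounded:
  fixes B :: "complex^'n^'n"
  obtains b where "0 \<le> b" "\<And>x. norm (B *v x) \<le> b * norm x"
proof -
  have "linear (\<lambda>x. B *v x)"
    by (rule linearI) (simp_all add: vec_eq_iff matrix_vector_mult_def scaleR_sum_right ring_distribs sum.distrib)
  then obtain b where b: "\<And>x. norm (B *v x) \<le> b * norm x" using linear_bounded by blast
  have "norm (B *v x) \<le> \<bar>b\<bar> * norm x" for x
    by (rule order_trans[OF b]) (simp add: mult_right_mono)
  then show ?thesis using that[of "\<bar>b\<bar>"] by simp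
qed

lemma norm_vector_scalar_mult: "norm (c *s x) = cmod c * norm x" for x :: "complex^'n"
  by (simp add: norm_vec_def norm_mult L2_set_right_distrib)

text \<open>A crude geometric bound: it gives the generating series a positive radius of
  convergence, and with D = 0 it shows that zero initial values force the zero sequence.\<close>

lemma recursion_growth:
  fixes B :: "nat \<Rightarrow> complex^'n^'n"
  assumes b: "\<And>k. 0 \<le> b k" "\<And>k x. norm (B k *v x) \<le> b k * norm x"
    and L: "L = 1 + (\<Sum>k=1..N. b k)" and "0 \<le> D"
    and init: "\<And>n. n < N \<Longrightarrow> norm (y n) \<le> D"
    and rec: "\<And>n. N \<le> n \<Longrightarrow> y n = (\<Sum>k=1..N. B k *v y (n - k))"
  shows "norm (y n) \<le> D * L ^ n"
proof (induction n rule: less_induct)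
  case (less n)
  have L1: "1 \<le> L" using b(1) by (simp add: L sum_nonneg)
  show ?case
  proof (cases "n < N")
    case True
    have "D * 1 \<le> D * L ^ n" using L1 \<open>0 \<le> D\<close> by (intro mult_left_mono one_le_power) auto
    then show ?thesis using init[OF True] by simp
  next
    case False
    show ?thesis
    proof (cases "n = 0")
      case True
      then show ?thesis using False rec[of 0] \<open>0 \<le> D\<close> by simp
    next
      case n: False
      have "norm (y n) \<le> (\<Sum>k=1..N. norm (B k *v y (n - k)))"
        using rec[of n] False by (simp add: norm_sum)
      also have "\<dots> \<le> (\<Sum>k=1..N. b k * (D * L ^ (n - 1)))"
      proof (rule sum_mono)
        fix k assume k: "k \<in> {1..N}"
        have "norm (B k *v y (n - k)) \<le> b k * norm (y (n - k))" by (rule b(2))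
        also have "\<dots> \<le> b k * (D * L ^ (n - k))" using k n by (intro mult_left_mono less.IH b(1)) auto
        also have "\<dots> \<le> b k * (D * L ^ (n - 1))"
          using k L1 \<open>0 \<le> D\<close> b(1) by (intro mult_left_mono power_increasing) auto
        finally show "norm (B k *v y (n - k)) \<le> b k * (D * L ^ (n - 1))" .
      qed
      also have "\<dots> = (L - 1) * (D * L ^ (n - 1))" by (simp add: L sum_distrib_right)
      also have "\<dots> \<le> L * (D * L ^ (n - 1))" using L1 \<open>0 \<le> D\<close> by (intro mult_right_mono) auto
      also have "\<dots> = D * L ^ n" using n by (cases n) auto
      finally show ?thesis .
    qed
  qed
qed

text \<open>Comparison of the coefficients of z^n: for n \<ge> N the recursion cancels them, so the
  symbol times the generating function is a polynomial in the first N values. The guard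
  \<open>k \<le> n\<close> keeps truncated subtraction out of the sum.\<close>

lemma generating_function_identity:
  fixes B :: "nat \<Rightarrow> complex^'n^'n" and y :: "nat \<Rightarrow> complex^'n"
  assumes sm: "\<And>j. (\<lambda>n. y n $ j * z ^ n) sums (Y $ j)"
    and rec: "\<And>n. N \<le> n \<Longrightarrow> y n = (\<Sum>k=1..N. B k *v y (n - k))"
  shows "(mat 1 - (\<Sum>k=1..N. cscale (z ^ k) (B k))) *v Y =
    (\<Sum>n<N. z ^ n *s (y n - (\<Sum>k=1..N. if k \<le> n then B k *v y (n - k) else 0)))"
proof -
  let ?c = "\<lambda>n. y n - (\<Sum>k=1..N. if k \<le> n then B k *v y (n - k) else 0)"
  have "((mat 1 - (\<Sum>k=1..N. cscale (z ^ k) (B k))) *v Y) $ i = (\<Sum>n<N. z ^ n *s ?c n) $ i" for i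
  proof -
    have shift: "(\<lambda>n. if k \<le> n then y (n - k) $ j * z ^ n else 0) sums (z ^ k * Y $ j)" for k j
    proof -
      have "(\<lambda>n. z ^ k * (y n $ j * z ^ n)) sums (z ^ k * Y $ j)" by (intro sums_mult sm)
      then have "(\<lambda>n. (if k \<le> n + k then y (n + k - k) $ j * z ^ (n + k) else 0)) sums (z ^ k * Y $ j)"
        by (simp add: power_add mult.commute mult.left_commute)
      then show ?thesis by (subst (asm) sums_iff_shift) simp
    qed
    have "(\<lambda>n. y n $ i * z ^ n - (\<Sum>k=1..N. \<Sum>j\<in>UNIV. B k $ i $ j * (if k \<le> n then y (n - k) $ j * z ^ n else 0)))
        sums (Y $ i - (\<Sum>k=1..N. \<Sum>j\<in>UNIV. B k $ i $ j * (z ^ k * Y $ j)))"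
      by (intro sums_diff sums_sum sums_mult sm shift)
    moreover have "y n $ i * z ^ n - (\<Sum>k=1..N. \<Sum>j\<in>UNIV. B k $ i $ j * (if k \<le> n then y (n - k) $ j * z ^ n else 0))
        = z ^ n * ?c n $ i" for n
      by (simp add: matrix_vector_mult_def right_diff_distrib sum_distrib_left if_distrib[of "\<lambda>v. v $ i"] mult.commute mult.left_commute
          cong: if_cong) (auto intro!: sum.cong simp: sum_distrib_left mult.commute mult.left_commute)
    moreover have "Y $ i - (\<Sum>k=1..N. \<Sum>j\<in>UNIV. B k $ i $ j * (z ^ k * Y $ j)) =
        ((mat 1 - (\<Sum>k=1..N. cscale (z ^ k) (B k))) *v Y) $ i"
      by (simp add: matrix_vector_mult_diff_rdistrib) (simp add: matrix_vector_mult_def sum_distrib_left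
          sum.swap[of _ UNIV] mult.commute mult.left_commute)
    ultimately have "(\<lambda>n. z ^ n * ?c n $ i) sums (((mat 1 - (\<Sum>k=1..N. cscale (z ^ k) (B k))) *v Y) $ i)" by simp
    moreover have "?c n = 0" if "n \<notin> {..<N}" for n
    proof -
      have "N \<le> n" using that by simp
      moreover have "(\<Sum>k=1..N. if k \<le> n then B k *v y (n - k) else 0) = (\<Sum>k=1..N. B k *v y (n - k))"
        using \<open>N \<le> n\<close> by (intro sum.cong) auto
      ultimately show ?thesis using rec[of n] by simp
    qed
    then have "(\<lambda>n. z ^ n * ?c n $ i) sums (\<Sum>n<N. z ^ n * ?c n $ i)"
      by (intro sums_finite) auto
    ultimately have "((mat 1 - (\<Sum>k=1..N. cscale (z ^ k) (B k))) *v Y) $ i = (\<Sum>n<N. z ^ n * ?c n $ i)"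
      by (rule sums_unique2)
    then show ?thesis by (simp add: right_diff_distrib)
  qed
  then show ?thesis by (simp add: vec_eq_iff)
qed

text \<open>Cramer's rule continues each component of the generating function to the closed disc of
  radius r, where the symbol is invertible, and Cauchy's inequality bounds the coefficients.
  \<open>C\<close> is chosen before \<open>y\<close>, hence the compactness argument in the pair (z,
  g).\<close>

lemma recursion_decay:
  fixes B :: "nat \<Rightarrow> complex^'n^'n"
  assumes r: "0 < r" "r \<le> 1"
    and nz: "\<And>z. cmod z \<le> r \<Longrightarrow> det (mat 1 - (\<Sum>k=1..N. cscale (z ^ k) (B k))) \<noteq> 0"
  obtains C where "0 \<le> C" "\<And>y D n. 0 \<le> D \<Longrightarrow> (\<And>n. n < N \<Longrightarrow> norm (y n) \<le> D) \<Longrightarrow>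
      (\<And>n. N \<le> n \<Longrightarrow> y n = (\<Sum>k=1..N. B k *v y (n - k))) \<Longrightarrow> norm (y n) \<le> C * D / r ^ n"
proof -
  have "\<exists>b. 0 \<le> b \<and> (\<forall>x. norm (B k *v x) \<le> b * norm x)" for k using matrix_vector_mult_bounded by metis
  then obtain b where b: "\<And>k. 0 \<le> b k" "\<And>k x. norm (B k *v x) \<le> b k * norm x" by metis
  define L where "L = 1 + (\<Sum>k=1..N. b k)"
  have L1: "1 \<le> L" using b(1) by (simp add: L_def sum_nonneg)
  let ?A = "\<lambda>z. mat 1 - (\<Sum>k=1..N. cscale (z ^ k) (B k))"
  \<comment> \<open>The k-th Cramer quotient: column k of the symbol is replaced by the right-hand
    side, kept as a free argument \<open>g\<close>.\<close>
  define H where "H k g z = det (\<chi> i j. if j = k then g $ i else ?A z $ i $ j) / det (?A z)" for k and g :: "complex^'n" and z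
  \<comment> \<open>N * L bounds the right-hand side polynomial for initial values of norm at most
    1: it has N terms, each at most 1 plus the sum of the \<open>b k\<close>.\<close>
  let ?X = "cball (0::complex) r \<times> cball (0::complex^'n) (real N * L)"
  have contA: "continuous_on S (\<lambda>p. ?A (f p))" if "continuous_on S f" for S and f :: "'b::topological_space \<Rightarrow> complex"
    by (intro continuous_on_matrix) (auto intro!: continuous_intros that)
  have contH: "continuous_on S (\<lambda>p. H k (g p) (f p))"
    if "continuous_on S f" "continuous_on S g" "\<And>p. p \<in> S \<Longrightarrow> cmod (f p) \<le> r"
    for S k and f :: "'b::topological_space \<Rightarrow> complex" and g
    unfolding H_def
  proof (intro continuous_on_divide continuous_on_det contA ballI nz that(3))
    show "continuous_on S (\<lambda>p. \<chi> i j. if j = k then g p $ i else ?A (f p) $ i $ j)"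
    proof (rule continuous_on_matrix)
      fix i j
      show "continuous_on S (\<lambda>p. (\<chi> i j. if j = k then g p $ i else ?A (f p) $ i $ j) $ i $ j)"
        by (cases "j = k") (auto intro!: continuous_intros that(1,2))
    qed
  qed (use that in auto)
  have "\<exists>C. \<forall>p\<in>?X. cmod (H k (snd p) (fst p)) \<le> C" for k
  proof -
    have "compact ?X" by (intro compact_Times) auto
    moreover have "continuous_on ?X (\<lambda>p. H k (snd p) (fst p))"
      by (intro contH continuous_intros) auto
    ultimately have "bounded ((\<lambda>p. H k (snd p) (fst p)) ` ?X)"
      by (intro compact_imp_bounded compact_continuous_image)
    then show ?thesis by (auto simp: bounded_iff)
  qed
  then obtain C where C': "\<And>k p. p \<in> ?X \<Longrightarrow> cmod (H k (snd p) (fst p)) \<le> C k" by metis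
  have C: "cmod (H k g z) \<le> C k" if "cmod z \<le> r" "norm g \<le> real N * L" for k g z
    using C'[of "(z, g)" k] that by simp
  have C0: "0 \<le> C k" for k
    using order_trans[OF norm_ge_zero C[of 0 0 k]] r L1 by simp
  have one: "norm (y n) \<le> (\<Sum>k\<in>UNIV. C k) / r ^ n"
    if init: "\<And>n. n < N \<Longrightarrow> norm (y n) \<le> 1" and rec: "\<And>n. N \<le> n \<Longrightarrow> y n = (\<Sum>k=1..N. B k *v y (n - k))" for y n
  proof -
    have gr: "norm (y n) \<le> L ^ n" for n
      using recursion_growth[OF b L_def _ init rec, of n] by simp
    let ?c = "\<lambda>n. y n - (\<Sum>k=1..N. if k \<le> n then B k *v y (n - k) else 0)"
    define g where "g z = (\<Sum>n<N. z ^ n *s ?c n)" for z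
    have gb: "norm (g z) \<le> real N * L" if z: "cmod z \<le> r" for z
    proof -
      have "norm (g z) \<le> (\<Sum>n<N. norm (z ^ n *s ?c n))" unfolding g_def by (rule norm_sum)
      also have "\<dots> \<le> (\<Sum>n<N. L)"
      proof (rule sum_mono)
        fix n assume n: "n \<in> {..<N}"
        have "norm (z ^ n *s ?c n) = cmod (z ^ n) * norm (?c n)"
          by (rule norm_vector_scalar_mult)
        also have "\<dots> \<le> 1 * norm (?c n)"
          using z r by (intro mult_right_mono) (auto simp: norm_power intro!: power_le_one)
        also have "norm (?c n) \<le> norm (y n) + norm (\<Sum>k=1..N. if k \<le> n then B k *v y (n - k) else 0)"
          by (rule norm_triangle_ineq4)
        also have "norm (\<Sum>k=1..N. if k \<le> n then B k *v y (n - k) else 0) \<le> (\<Sum>k=1..N. b k)"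
        proof (rule order_trans[OF norm_sum], rule sum_mono)
          fix k
          have "b k * norm (y (n - k)) \<le> b k * 1" using n by (intro mult_left_mono init b(1)) auto
          then show "norm (if k \<le> n then B k *v y (n - k) else 0) \<le> b k"
            using b(1)[of k] order_trans[OF b(2)[of k "y (n - k)"]] by auto
        qed
        also have "norm (y n) \<le> 1" using n by (intro init) simp
        finally show "norm (z ^ n *s ?c n) \<le> L" by (simp add: L_def)
      qed
      finally show ?thesis by simp
    qed
    have coeff: "cmod (y n $ k) \<le> C k / r ^ n" for k
    proof -
      \<comment> \<open>Within radius \<epsilon> the bound L^n gives a geometric majorant of ratio
        at most 1/2, so the series converges and equals the Cramer quotient. Equality near 0
        identifies all Taylor coefficients.\<close>
      define \<epsilon> where "\<epsilon> = min r (1 / (2 * L))"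
      have \<epsilon>: "0 < \<epsilon>" "\<epsilon> \<le> r" "\<epsilon> * L < 1" using r L1 by (auto simp: \<epsilon>_def min_def field_simps)
      have sm: "summable (\<lambda>n. y n $ j * z ^ n)" if "cmod z \<le> \<epsilon>" for z j
      proof (rule summable_comparison_test')
        show "summable (\<lambda>n. (\<epsilon> * L) ^ n)" using \<epsilon> L1 by (intro summable_geometric) (auto simp: abs_mult)
        fix n
        have "norm (y n $ j * z ^ n) = cmod (y n $ j) * cmod z ^ n" by (simp add: norm_mult norm_power)
        also have "\<dots> \<le> L ^ n * \<epsilon> ^ n"
          using that L1 order_trans[OF Finite_Cartesian_Product.norm_nth_le gr] by (intro mult_mono power_mono) auto
        finally show "norm (y n $ j * z ^ n) \<le> (\<epsilon> * L) ^ n" by (simp add: power_mult_distrib mult.commute)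
      qed
      have eq: "(\<Sum>n. y n $ k * z ^ n) = H k (g z) z" if z: "cmod z \<le> \<epsilon>" for z
      proof -
        let ?Y = "\<chi> j. \<Sum>n. y n $ j * z ^ n"
        have gz: "?A z *v ?Y = g z"
          unfolding g_def using summable_sums[OF sm[OF z]] by (intro generating_function_identity rec) simp_all
        have "det (\<chi> i j. if j = k then g z $ i else ?A z $ i $ j) = ?Y $ k * det (?A z)"
          using cramer_lemma[of k "?A z" ?Y] unfolding gz .
        then show ?thesis using nz[of z] z \<epsilon> by (simp add: H_def)
      qed
      let ?F = "Abs_fps (\<lambda>n. y n $ k)"
      have "(\<lambda>z. H k (g z) z) has_fps_expansion ?F"
        unfolding has_fps_expansion_def
      proof
        have "ereal \<epsilon> \<le> fps_conv_radius ?F"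
          unfolding fps_conv_radius_def using sm[of "of_real \<epsilon>" k] \<epsilon>
            conv_radius_geI[of "\<lambda>n. y n $ k" "of_real \<epsilon>"] by simp
        then show "0 < fps_conv_radius ?F" using \<epsilon>(1) by (metis ereal_less(2) less_le_trans)
        have "\<forall>\<^sub>F z in nhds 0. z \<in> ball (0::complex) \<epsilon>" using \<epsilon>(1) by (intro eventually_nhds_in_open) auto
        then show "\<forall>\<^sub>F z in nhds 0. eval_fps ?F z = H k (g z) z"
          by eventually_elim (simp add: eval_fps_def eq)
      qed
      then have "y n $ k = (deriv ^^ n) (\<lambda>z. H k (g z) z) 0 / fact n"
        using fps_nth_fps_expansion[of _ ?F n] by simp
      moreover have "cmod ((deriv ^^ n) (\<lambda>z. H k (g z) z) 0) \<le> fact n * C k / r ^ n"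
      proof (rule Cauchy_inequality)
        show "(\<lambda>z. H k (g z) z) holomorphic_on ball 0 r"
          unfolding H_def
        proof (intro holomorphic_on_divide holomorphic_on_det nz)
          fix i j
          show "(\<lambda>z. (\<chi> i j. if j = k then g z $ i else ?A z $ i $ j) $ i $ j) holomorphic_on ball 0 r"
            by (cases "j = k") (auto simp: g_def intro!: holomorphic_intros)
        qed (auto intro!: holomorphic_intros)
        have "continuous_on (cball 0 r) (\<lambda>z. \<chi> i. g z $ i)"
          unfolding g_def vector_smult_component sum_component
          by (intro continuous_on_vec_lambda continuous_on_sum continuous_on_mult continuous_on_power continuous_on_id continuous_on_const)
        then have "continuous_on (cball 0 r) g" by simp
        then show "continuous_on (cball 0 r) (\<lambda>z. H k (g z) z)" by (intro contH continuous_intros) auto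
        show "cmod (H k (g x) x) \<le> C k" if "cmod (0 - x) = r" for x
          using that by (intro C gb) auto
      qed (fact r(1))
      ultimately show ?thesis by (simp add: norm_divide pos_divide_le_eq mult.commute)
    qed
    have "norm (y n) \<le> (\<Sum>k\<in>UNIV. norm (y n $ k))" unfolding norm_vec_def by (rule L2_set_le_sum) simp
    also have "\<dots> \<le> (\<Sum>k\<in>UNIV. C k / r ^ n)" by (intro sum_mono coeff)
    finally show ?thesis by (simp add: sum_divide_distrib)
  qed
  show ?thesis
  proof (rule that[of "\<Sum>k\<in>UNIV. C k"])
    show "0 \<le> (\<Sum>k\<in>UNIV. C k)" by (intro sum_nonneg C0)
    fix y :: "nat \<Rightarrow> complex^'n" and D n
    assume D: "0 \<le> D" and init: "\<And>n. n < N \<Longrightarrow> norm (y n) \<le> D"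
      and rec: "\<And>n. N \<le> n \<Longrightarrow> y n = (\<Sum>k=1..N. B k *v y (n - k))"
    show "norm (y n) \<le> (\<Sum>k\<in>UNIV. C k) * D / r ^ n"
    \<comment> \<open>Homogeneity reduces to D = 1; for D = 0, where rescaling is impossible, the
      sequence vanishes.\<close>
    proof (cases "D = 0")
      case True
      then show ?thesis using recursion_growth[OF b L_def D init rec, of n] by simp
    next
      case False
      have lin: "B k *v (c *\<^sub>R x) = c *\<^sub>R (B k *v x)" for k c x
        by (simp add: vec_eq_iff matrix_vector_mult_def scaleR_sum_right)
      have "norm (inverse D *\<^sub>R y n) \<le> (\<Sum>k\<in>UNIV. C k) / r ^ n"
      proof (rule one)
        fix n
        show "n < N \<Longrightarrow> norm (inverse D *\<^sub>R y n) \<le> 1"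
          using init[of n] D False by (simp add: field_simps)
        show "N \<le> n \<Longrightarrow> inverse D *\<^sub>R y n = (\<Sum>k=1..N. B k *v (inverse D *\<^sub>R y (n - k)))"
          using rec[of n] by (simp add: lin scaleR_sum_right)
      qed
      then show ?thesis using D False by (simp add: field_simps)
    qed
  qed
qed

section \<open>Equivalence of norms and suprema over a history\<close>

lemma is_norm_zero: "is_norm nrm \<Longrightarrow> nrm 0 = 0"
  by (simp add: is_norm_def)

lemma is_norm_nonneg:
  assumes "is_norm nrm" shows "0 \<le> nrm x"
proof -
  have "nrm (x + (-1) *\<^sub>R x) \<le> nrm x + \<bar>-1\<bar> * nrm x" using assms unfolding is_norm_def by metis
  then show ?thesis using is_norm_zero[OF assms] by simp
qed

text \<open>Expansion in the standard basis gives the upper bound and makes the norm Lipschitz; its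
  minimum on the unit sphere, positive by definiteness, gives the lower bound. One constant serves
  both directions.\<close>

lemma is_norm_equivalent:
  fixes nrm :: "real^'n \<Rightarrow> real"
  assumes nrm: "is_norm nrm"
  obtains c where "0 < c" "\<And>x. nrm x \<le> c * norm x" "\<And>x. norm x \<le> c * nrm x"
proof -
  have add: "nrm (x + y) \<le> nrm x + nrm y" and scale: "nrm (r *\<^sub>R x) = \<bar>r\<bar> * nrm x"
    and zero: "nrm x = 0 \<longleftrightarrow> x = 0" for x y r
    using nrm by (auto simp: is_norm_def)
  note nonneg = is_norm_nonneg[OF nrm]
  define b where "b = (\<Sum>i\<in>UNIV. nrm (axis i 1 :: real^'n))"
  have sum_le: "nrm (\<Sum>i\<in>F. f i) \<le> (\<Sum>i\<in>F. nrm (f i))" if "finite F" for F and f :: "'n \<Rightarrow> real^'n"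
    using that
  proof (induction F)
    case empty
    then show ?case by (simp add: is_norm_zero[OF nrm])
  next
    case (insert i F)
    then show ?case using add[of "f i" "\<Sum>i\<in>F. f i"] by simp
  qed
  have up: "nrm x \<le> b * norm x" for x
  proof -
    have "nrm x = nrm (\<Sum>i\<in>UNIV. x $ i *\<^sub>R axis i 1)"
      using basis_expansion[of x] by (simp add: scalar_mult_eq_scaleR)
    also have "\<dots> \<le> (\<Sum>i\<in>UNIV. nrm (x $ i *\<^sub>R axis i 1))" by (rule sum_le) simp
    also have "\<dots> \<le> (\<Sum>i\<in>UNIV. norm x * nrm (axis i 1 :: real^'n))"
      unfolding scale by (intro sum_mono mult_right_mono component_le_norm_cart nonneg)
    finally show ?thesis by (simp add: b_def sum_distrib_left mult.commute)
  qed
  have b0: "0 \<le> b" unfolding b_def by (intro sum_nonneg nonneg)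
  have diff: "nrm x \<le> nrm y + b * norm (x - y)" for x y
    using add[of y "x - y"] up[of "x - y"] by simp
  have lip: "\<bar>nrm x - nrm y\<bar> \<le> b * norm (x - y)" for x y
    using diff[of x y] diff[of y x] by (simp add: norm_minus_commute)
  have "continuous_on UNIV nrm"
  proof (rule lipschitz_on_continuous_on[of b], rule lipschitz_onI)
    show "dist (nrm x) (nrm y) \<le> b * dist x y" for x y using lip[of x y] by (simp add: dist_norm)
  qed (rule b0)
  then have "continuous_on (sphere (0::real^'n) 1) nrm" by (rule continuous_on_subset) simp
  moreover have "sphere (0::real^'n) 1 \<noteq> {}" by simp
  ultimately obtain u where u: "u \<in> sphere (0::real^'n) 1" "\<And>x. x \<in> sphere 0 1 \<Longrightarrow> nrm u \<le> nrm x"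
    using continuous_attains_inf[OF compact_sphere] by metis
  have "u \<noteq> 0" using u(1) by auto
  then have u0: "0 < nrm u" using nonneg[of u] zero[of u] by (simp add: less_le)
  have low: "norm x \<le> inverse (nrm u) * nrm x" for x
  proof (cases "x = 0")
    case False
    then have "nrm u \<le> nrm (inverse (norm x) *\<^sub>R x)" by (intro u(2)) simp
    then show ?thesis using False u0 by (simp add: scale field_simps)
  qed (simp add: is_norm_zero[OF nrm])
  show ?thesis
  proof (rule that[of "max (b + 1) (inverse (nrm u))"])
    show "0 < max (b + 1) (inverse (nrm u))" using b0 by simp
    show "nrm x \<le> max (b + 1) (inverse (nrm u)) * norm x" for x
      by (rule order_trans[OF up]) (intro mult_right_mono, auto)
    show "norm x \<le> max (b + 1) (inverse (nrm u)) * nrm x" for x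
      by (rule order_trans[OF low]) (intro mult_right_mono nonneg, auto)
  qed
qed

lemma sup_norm_upper:
  fixes nrm :: "real^'n \<Rightarrow> real"
  assumes nrm: "is_norm nrm" and f: "continuous_on {-1..0} f" and \<theta>: "\<theta> \<in> {-1..0}"
  shows "nrm (f \<theta>) \<le> sup_norm nrm f"
proof -
  obtain c where c: "0 < c" "\<And>x. nrm x \<le> c * norm x" using is_norm_equivalent[OF nrm] by metis
  have "bounded (f ` {-1..0})" using f by (intro compact_imp_bounded compact_continuous_image) auto
  then obtain B where B: "\<And>\<theta>. \<theta> \<in> {-1..0} \<Longrightarrow> norm (f \<theta>) \<le> B" unfolding bounded_iff by blast
  have "nrm (f \<theta>) \<le> c * B" if "\<theta> \<in> {-1..0}" for \<theta>
    using order_trans[OF c(2) mult_left_mono[OF B[OF that]]] c(1) by simp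
  then have "bdd_above ((\<lambda>\<theta>. nrm (f \<theta>)) ` {-1..0})" unfolding bdd_above_def by blast
  then show ?thesis unfolding sup_norm_def using \<theta> by (intro cSUP_upper)
qed

lemma sup_norm_least:
  assumes "\<And>\<theta>. \<theta> \<in> {-1..0} \<Longrightarrow> nrm (f \<theta>) \<le> B"
  shows "sup_norm nrm f \<le> B"
  unfolding sup_norm_def using assms by (intro cSUP_least) auto

section \<open>Systems with delays in a lattice\<close>

definition complex_mat :: "real^'n^'n \<Rightarrow> complex^'n^'n" where
  "complex_mat A = (\<chi> i j. of_real (A $ i $ j))"

definition complex_vec :: "real^'n \<Rightarrow> complex^'n" where
  "complex_vec x = (\<chi> i. of_real (x $ i))"

lemma norm_complex_vec: "norm (complex_vec x) = norm x"
  by (simp add: norm_vec_def complex_vec_def)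

lemma complex_mat_mult_vec: "complex_mat A *v complex_vec x = complex_vec (A *v x)"
  by (simp add: vec_eq_iff matrix_vector_mult_def complex_mat_def complex_vec_def)

lemma complex_vec_sum: "complex_vec (\<Sum>k\<in>K. f k) = (\<Sum>k\<in>K. complex_vec (f k))"
  by (simp add: vec_eq_iff complex_vec_def)

text \<open>The equation x(t) = \<Sum> A_k x(t - k/N), described by its action on continuous
  histories and by its characteristic function, so that the growth estimates can be made without
  measures. The sum starts at k = 1: there is no instantaneous term.\<close>

definition lattice_system :: "nat \<Rightarrow> (nat \<Rightarrow> real^'n^'n) \<Rightarrow> (real \<Rightarrow> real^'n^'n) \<Rightarrow> bool" where
  "lattice_system N A P \<longleftrightarrow> 0 < N \<and>
     (\<forall>\<eta>. continuous_on {-1..0} \<eta> \<longrightarrow> integral_vec P \<eta> = (\<Sum>k=1..N. A k *v \<eta> (- (real k / real N)))) \<and>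
     (\<forall>s. char_fun P s =
        det (mat 1 - (\<Sum>k=1..N. cscale (exp (- (s * of_real (real k / real N)))) (complex_mat (A k)))))"

definition growth_bound :: "(real^'n \<Rightarrow> real) \<Rightarrow> (real \<Rightarrow> real^'n^'n) \<Rightarrow> real \<Rightarrow> bool" where
  "growth_bound nrm M \<alpha> \<longleftrightarrow> (\<exists>K>0. \<forall>\<phi>\<in>C0 M. \<forall>x.
      solution M x \<and> (\<forall>\<theta>\<in>{-1..0}. x \<theta> = \<phi> \<theta>) \<longrightarrow>
      (\<forall>t\<ge>0. sup_norm nrm (\<lambda>\<theta>. x (t + \<theta>)) \<le> K * exp (\<alpha> * t) * sup_norm nrm \<phi>))"

lemma omega_eq_Inf_growth_bound: "omega nrm M = Inf {ereal \<alpha> | \<alpha>. growth_bound nrm M \<alpha>}"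
  by (simp add: omega_def growth_bound_def)

text \<open>On each grid \<tau> + m/N a solution is a sequence obeying a linear recursion. The
  substitution z = exp (-s/N) turns the half plane Re s \<ge> \<alpha> into the punctured disc of
  radius r = exp (-\<alpha>/N), and \<alpha> > 0 gives r \<le> 1.\<close>

lemma growth_bound_lattice:
  fixes nrm :: "real^'n \<Rightarrow> real"
  assumes nrm: "is_norm nrm" and P: "lattice_system N A P" and \<alpha>: "0 < \<alpha>"
    and zeros: "\<And>s. char_fun P s = 0 \<Longrightarrow> Re s < \<alpha>"
  shows "growth_bound nrm P \<alpha>"
proof -
  have N: "0 < N"
    and ivec: "\<And>\<eta>. continuous_on {-1..0} \<eta> \<Longrightarrow> integral_vec P \<eta> = (\<Sum>k=1..N. A k *v \<eta> (- (real k / real N)))"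
    and char: "\<And>s. char_fun P s =
        det (mat 1 - (\<Sum>k=1..N. cscale (exp (- (s * of_real (real k / real N)))) (complex_mat (A k))))"
    using P by (auto simp: lattice_system_def)
  obtain c where c: "0 < c" "\<And>x. nrm x \<le> c * norm x" "\<And>x. norm x \<le> c * nrm x"
    using is_norm_equivalent[OF nrm] by metis
  define r where "r = exp (- \<alpha> / real N)"
  have r: "0 < r" "r \<le> 1" using \<alpha> by (auto simp: r_def)
  have nz: "det (mat 1 - (\<Sum>k=1..N. cscale (z ^ k) (complex_mat (A k)))) \<noteq> 0" if z: "cmod z \<le> r" for z
  proof (cases "z = 0")
    case True
    then have "(\<Sum>k=1..N. cscale (z ^ k) (complex_mat (A k))) = 0" by (intro sum.neutral) (auto simp: power_0_left)
    then show ?thesis by simp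
  next
    case False
    \<comment> \<open>A preimage of z under s \<mapsto> exp (-s/N). The branch of the logarithm is
      immaterial because all delays are multiples of 1/N.\<close>
    define s where "s = - of_nat N * Ln z"
    have "exp (- (s * of_real (real k / real N))) = z ^ k" for k
    proof -
      have "- (s * of_real (real k / real N)) = of_nat k * Ln z" using N by (simp add: s_def)
      then show ?thesis using False by (simp add: exp_of_nat_mult)
    qed
    then have "char_fun P s = det (mat 1 - (\<Sum>k=1..N. cscale (z ^ k) (complex_mat (A k))))"
      unfolding char by simp
    moreover have "\<alpha> \<le> Re s"
    proof -
      have "ln (cmod z) \<le> ln r" using z False r(1) by (subst ln_le_cancel_iff) auto
      then have "ln (cmod z) \<le> - \<alpha> / real N" by (simp add: r_def)
      then show ?thesis using N False by (simp add: s_def field_simps)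
    qed
    ultimately show ?thesis using zeros[of s] by auto
  qed
  obtain C where C: "0 \<le> C" "\<And>y D n. 0 \<le> D \<Longrightarrow> (\<And>n. n < N \<Longrightarrow> norm (y n) \<le> D) \<Longrightarrow>
      (\<And>n. N \<le> n \<Longrightarrow> y n = (\<Sum>k=1..N. complex_mat (A k) *v y (n - k))) \<Longrightarrow> norm (y n) \<le> C * D / r ^ n"
    using recursion_decay[OF r nz] by blast
  \<comment> \<open>One factor \<open>c\<close> for each passage between the two norms; exp \<alpha>
    pays for counting time from -1, and the summand 1 makes K positive.\<close>
  define K where "K = c * (C * c * exp \<alpha>) + 1"
  have K: "0 < K" using c(1) C(1) by (simp add: K_def add_nonneg_pos)
  show ?thesis
    unfolding growth_bound_def
  proof (intro exI[of _ K] conjI K ballI allI impI)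
    fix \<phi> x and t :: real
    assume \<phi>: "\<phi> \<in> C0 P" and x: "solution P x \<and> (\<forall>\<theta>\<in>{-1..0}. x \<theta> = \<phi> \<theta>)" and t: "0 \<le> t"
    let ?S = "sup_norm nrm \<phi>"
    have \<phi>c: "continuous_on {-1..0} \<phi>" using \<phi> by (simp add: C0_def)
    have S0: "0 \<le> ?S" using order_trans[OF is_norm_nonneg[OF nrm] sup_norm_upper[OF nrm \<phi>c, of 0]] by simp
    have xc: "continuous_on {-1..} x" using x by (simp add: solution_def)
    have rec: "x t = (\<Sum>k=1..N. A k *v x (t - real k / real N))" if "0 \<le> t" for t
    proof -
      have "x t = integral_vec P (\<lambda>\<theta>. x (t + \<theta>))" using x that by (auto simp: solution_def)
      also have "\<dots> = (\<Sum>k=1..N. A k *v x (t + - (real k / real N)))"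
        using that by (intro ivec continuous_on_compose2[OF xc] continuous_intros) auto
      finally show ?thesis by simp
    qed
    have bound: "norm (x t) \<le> C * (c * ?S) * exp (\<alpha> * (t + 1))" if t: "-1 \<le> t" for t
    proof -
      \<comment> \<open>n counts whole steps from the left end -1, which puts \<tau> into [-1, -1 +
        1/N). Grid points with m < N then lie in the initial interval, and those with m \<ge> N at
        nonnegative times, where the equation holds.\<close>
      define n where "n = nat \<lfloor>(t + 1) * real N\<rfloor>"
      define \<tau> where "\<tau> = t - real n / real N"
      have "0 \<le> (t + 1) * real N" using t by simp
      then have n: "real n \<le> (t + 1) * real N" "(t + 1) * real N < real n + 1"
        unfolding n_def by linarith+
      have nN: "real n / real N \<le> t + 1" "t + 1 < (real n + 1) / real N"
        using n N by (simp_all add: pos_divide_le_eq pos_less_divide_eq)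
      have \<tau>: "-1 \<le> \<tau>" "\<tau> < -1 + 1 / real N"
        using nN by (auto simp: \<tau>_def add_divide_distrib)
      define y where "y m = complex_vec (x (\<tau> + real m / real N))" for m
      have "norm (y n) \<le> C * (c * ?S) / r ^ n"
      proof (rule C(2))
        show "0 \<le> c * ?S" using c(1) S0 by simp
        fix m
        show "norm (y m) \<le> c * ?S" if "m < N"
        proof -
          have "real m + 1 \<le> real N" using that by linarith
          then have "real m / real N + 1 / real N \<le> 1" using N by (simp add: field_simps)
          then have i: "\<tau> + real m / real N \<in> {-1..0}" using \<tau> by (auto intro: order_trans[of _ \<tau>])
          have "norm (y m) \<le> c * nrm (x (\<tau> + real m / real N))" unfolding y_def norm_complex_vec by (rule c(3))
          also have "x (\<tau> + real m / real N) = \<phi> (\<tau> + real m / real N)" using x i by blast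
          also have "c * nrm (\<phi> (\<tau> + real m / real N)) \<le> c * ?S"
            using c(1) by (intro mult_left_mono sup_norm_upper[OF nrm \<phi>c i]) auto
          finally show ?thesis .
        qed
        show "y m = (\<Sum>k=1..N. complex_mat (A k) *v y (m - k))" if "N \<le> m"
        proof -
          have "1 \<le> real m / real N" using that N by simp
          then have "x (\<tau> + real m / real N) = (\<Sum>k=1..N. A k *v x (\<tau> + real m / real N - real k / real N))"
            using \<tau> by (intro rec) simp
          also have "\<dots> = (\<Sum>k=1..N. A k *v x (\<tau> + real (m - k) / real N))"
            using that by (intro sum.cong refl arg_cong2[where f="(*v)"] arg_cong[where f=x])
              (auto simp: of_nat_diff diff_divide_distrib)
          finally show ?thesis by (simp add: y_def complex_mat_mult_vec complex_vec_sum)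
        qed
      qed
      then have "norm (x t) \<le> C * (c * ?S) * (1 / r ^ n)"
        by (simp add: y_def \<tau>_def norm_complex_vec)
      also have "1 / r ^ n = exp (\<alpha> * (real n / real N))"
        by (simp add: r_def exp_of_nat_mult[symmetric] exp_minus field_simps)
      also have "C * (c * ?S) * exp (\<alpha> * (real n / real N)) \<le> C * (c * ?S) * exp (\<alpha> * (t + 1))"
        using C(1) c(1) S0 mult_left_mono[OF nN(1), of \<alpha>] \<alpha> by (intro mult_left_mono) auto
      finally show ?thesis .
    qed
    show "sup_norm nrm (\<lambda>\<theta>. x (t + \<theta>)) \<le> K * exp (\<alpha> * t) * ?S"
    proof (rule sup_norm_least)
      fix \<theta> :: real assume \<theta>: "\<theta> \<in> {-1..0}"
      have "nrm (x (t + \<theta>)) \<le> c * norm (x (t + \<theta>))" by (rule c(2))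
      also have "\<dots> \<le> c * (C * (c * ?S) * exp (\<alpha> * (t + \<theta> + 1)))"
        using c(1) t \<theta> by (intro mult_left_mono bound) auto
      also have "\<dots> \<le> c * (C * (c * ?S) * exp (\<alpha> * (t + 1)))"
        using c(1) C(1) S0 \<theta> \<alpha> by (intro mult_left_mono) auto
      also have "\<dots> = (c * (C * c * exp \<alpha>)) * (exp (\<alpha> * t) * ?S)"
        by (simp add: distrib_left exp_add)
      also have "\<dots> \<le> K * (exp (\<alpha> * t) * ?S)"
        using S0 by (intro mult_right_mono) (auto simp: K_def)
      finally show "nrm (x (t + \<theta>)) \<le> K * exp (\<alpha> * t) * ?S" by (simp add: mult.assoc)
    qed
  qed
qed

text \<open>The real part of exp (s t) v is a real solution whose initial segment lies in
  \<open>C0\<close>, so the growth bound applies to it.\<close>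

lemma exponential_solution_bound:
  fixes nrm :: "real^'n \<Rightarrow> real" and v :: "complex^'n"
  assumes nrm: "is_norm nrm" and P: "lattice_system N A P"
    and v: "(\<Sum>k=1..N. cscale (exp (- (s * of_real (real k / real N)))) (complex_mat (A k))) *v v = v"
    and gb: "growth_bound nrm P \<alpha>"
  obtains C where "\<And>t i. 0 \<le> t \<Longrightarrow> \<bar>Re (exp (s * of_real t) * v $ i)\<bar> \<le> C * exp (\<alpha> * t)"
proof -
  have ivec: "\<And>\<eta>. continuous_on {-1..0} \<eta> \<Longrightarrow> integral_vec P \<eta> = (\<Sum>k=1..N. A k *v \<eta> (- (real k / real N)))"
    using P by (auto simp: lattice_system_def)
  obtain c where c: "0 < c" "\<And>x. norm x \<le> c * nrm x"
    using is_norm_equivalent[OF nrm] by metis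
  define x where "x t = (\<chi> i. Re (exp (s * of_real t) * v $ i))" for t :: real
  have xc: "continuous_on T x" for T
    unfolding x_def by (intro continuous_on_vec_lambda continuous_intros)
  have "(\<Sum>k=1..N. A k *v x (t + - (real k / real N))) $ i = x t $ i" for t i
  proof -
    let ?e = "\<lambda>k. exp (- (s * of_real (real k / real N)))"
    have e: "exp (s * of_real (t + - (real k / real N))) = exp (s * of_real t) * ?e k" for k
      by (simp add: exp_add[symmetric] algebra_simps)
    have "x t $ i = Re (exp (s * of_real t) * ((\<Sum>k=1..N. cscale (?e k) (complex_mat (A k))) *v v) $ i)"
      by (simp only: v) (simp add: x_def)
    also have "((\<Sum>k=1..N. cscale (?e k) (complex_mat (A k))) *v v) $ i =
        (\<Sum>k=1..N. \<Sum>j\<in>UNIV. of_real (A k $ i $ j) * (?e k * v $ j))"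
      by (simp add: matrix_vector_mult_def complex_mat_def sum_distrib_left sum.swap[of _ UNIV] mult.commute mult.left_commute)
    also have "Re (exp (s * of_real t) * (\<Sum>k=1..N. \<Sum>j\<in>UNIV. of_real (A k $ i $ j) * (?e k * v $ j))) =
        (\<Sum>k=1..N. \<Sum>j\<in>UNIV. A k $ i $ j * Re (exp (s * of_real t) * ?e k * v $ j))"
      unfolding sum_distrib_left Re_sum
    proof (intro sum.cong refl)
      fix k j
      have "exp (s * of_real t) * (of_real (A k $ i $ j) * (?e k * v $ j)) =
          of_real (A k $ i $ j) * (exp (s * of_real t) * ?e k * v $ j)" by (simp only: mult.assoc mult.left_commute)
      then show "Re (exp (s * of_real t) * (of_real (A k $ i $ j) * (?e k * v $ j))) =
          A k $ i $ j * Re (exp (s * of_real t) * ?e k * v $ j)"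
        by (simp only: scaleR_conv_of_real[symmetric] scaleR_complex.sel)
    qed
    also have "\<dots> = (\<Sum>k=1..N. A k *v x (t + - (real k / real N))) $ i"
      unfolding sum_component matrix_vector_mult_def x_def vec_lambda_beta e ..
    finally show ?thesis by simp
  qed
  then have eq: "integral_vec P (\<lambda>\<theta>. x (t + \<theta>)) = x t" for t
    by (subst ivec) (auto intro!: continuous_on_compose2[OF xc[of UNIV]] continuous_intros simp: vec_eq_iff)
  have sol: "solution P x" using xc eq by (simp add: solution_def)
  have "x \<in> C0 P" using xc eq[of 0] by (simp add: C0_def)
  with gb sol obtain K where K: "\<And>t. 0 \<le> t \<Longrightarrow> sup_norm nrm (\<lambda>\<theta>. x (t + \<theta>)) \<le> K * exp (\<alpha> * t) * sup_norm nrm x"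
    unfolding growth_bound_def by blast
  show ?thesis
  proof (rule that)
    fix t :: real and i assume t: "0 \<le> t"
    have "\<bar>Re (exp (s * of_real t) * v $ i)\<bar> \<le> norm (x t)"
      using component_le_norm_cart[of "x t" i] by (simp add: x_def)
    also have "\<dots> \<le> c * nrm (x t)" by (rule c(2))
    also have "nrm (x t) \<le> sup_norm nrm (\<lambda>\<theta>. x (t + \<theta>))"
      using sup_norm_upper[OF nrm, of "\<lambda>\<theta>. x (t + \<theta>)" 0]
      by (simp add: continuous_on_compose2[OF xc[of UNIV]] continuous_intros)
    also have "\<dots> \<le> K * exp (\<alpha> * t) * sup_norm nrm x" by (rule K[OF t])
    finally show "\<bar>Re (exp (s * of_real t) * v $ i)\<bar> \<le> (c * K * sup_norm nrm x) * exp (\<alpha> * t)"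
      using c(1) by (simp add: mult.commute mult.left_commute mult_left_mono)
  qed
qed

text \<open>The estimate for v and for -i v controls real and imaginary part, hence exp (Re s t)
  times the modulus of a nonzero component of v; with Re s > \<alpha> this would outgrow exp
  (\<alpha> t).\<close>

lemma zero_le_growth_bound:
  fixes nrm :: "real^'n \<Rightarrow> real"
  assumes nrm: "is_norm nrm" and P: "lattice_system N A P"
    and s: "char_fun P s = 0" and gb: "growth_bound nrm P \<alpha>"
  shows "Re s \<le> \<alpha>"
proof (rule ccontr)
  assume "\<not> Re s \<le> \<alpha>"
  let ?B = "\<Sum>k=1..N. cscale (exp (- (s * of_real (real k / real N)))) (complex_mat (A k))"
  have "det (mat 1 - ?B) = 0" using P s by (simp add: lattice_system_def)
  then obtain v where v: "v \<noteq> 0" "?B *v v = v"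
    by (auto simp: det_eq_0_iff_kernel matrix_vector_mult_diff_rdistrib)
  have "?B *v ((- \<i>) *s v) = (- \<i>) *s (?B *v v)" by (rule vector_scalar_commute)
  then have iv: "?B *v ((- \<i>) *s v) = (- \<i>) *s v" using v(2) by simp
  obtain C1 where C1: "\<And>t i. 0 \<le> t \<Longrightarrow> \<bar>Re (exp (s * of_real t) * v $ i)\<bar> \<le> C1 * exp (\<alpha> * t)"
    using exponential_solution_bound[OF nrm P v(2) gb] by blast
  obtain C2 where C2: "\<And>t i. 0 \<le> t \<Longrightarrow> \<bar>Re (exp (s * of_real t) * ((- \<i>) *s v) $ i)\<bar> \<le> C2 * exp (\<alpha> * t)"
    using exponential_solution_bound[OF nrm P iv gb] by blast
  obtain i where i: "v $ i \<noteq> 0" using v(1) by (auto simp: vec_eq_iff)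
  have le: "exp ((Re s - \<alpha>) * t) \<le> (C1 + C2) / cmod (v $ i)" if t: "0 \<le> t" for t
  proof -
    let ?w = "exp (s * of_real t) * v $ i"
    have "exp (s * of_real t) * ((- \<i>) *s v) $ i = - \<i> * ?w" by simp
    then have "Re (exp (s * of_real t) * ((- \<i>) *s v) $ i) = Im ?w" by simp
    then have "\<bar>Re ?w\<bar> + \<bar>Im ?w\<bar> \<le> (C1 + C2) * exp (\<alpha> * t)"
      using C1[OF t, of i] C2[OF t, of i] by (simp only: distrib_right)
    moreover have "cmod ?w = exp (Re s * t) * cmod (v $ i)" by (simp add: norm_mult)
    ultimately have "exp (Re s * t) * cmod (v $ i) \<le> (C1 + C2) * exp (\<alpha> * t)"
      using cmod_le[of ?w] by linarith
    moreover have "exp (Re s * t) = exp ((Re s - \<alpha>) * t) * exp (\<alpha> * t)"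
      by (simp add: exp_add[symmetric] algebra_simps)
    ultimately have "(exp ((Re s - \<alpha>) * t) * cmod (v $ i)) * exp (\<alpha> * t) \<le> (C1 + C2) * exp (\<alpha> * t)"
      by (simp add: mult.commute mult.left_commute)
    then have "exp ((Re s - \<alpha>) * t) * cmod (v $ i) \<le> C1 + C2" by simp
    then show ?thesis using i by (simp add: pos_le_divide_eq)
  qed
  define B where "B = (C1 + C2) / cmod (v $ i)"
  have d: "0 < Re s - \<alpha>" using \<open>\<not> Re s \<le> \<alpha>\<close> by simp
  \<comment> \<open>At the time |B| / (Re s - \<alpha>), the inequality 1 + u \<le> exp u gives 1 +
    |B| \<le> B.\<close>
  have "1 + (Re s - \<alpha>) * (\<bar>B\<bar> / (Re s - \<alpha>)) \<le> exp ((Re s - \<alpha>) * (\<bar>B\<bar> / (Re s - \<alpha>)))"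
    by (rule exp_ge_add_one_self)
  also have "\<dots> \<le> B" unfolding B_def using d by (intro le) simp
  finally show False using d by simp
qed

text \<open>The given zero makes the abscissa positive, so every \<alpha> above it meets the sign
  condition of \<open>growth_bound_lattice\<close>; the reverse inequality holds zero by
  zero.\<close>

lemma spectral_abscissa_eq_omega_lattice:
  fixes nrm :: "real^'n \<Rightarrow> real"
  assumes nrm: "is_norm nrm" and P: "lattice_system N A P"
    and s0: "char_fun P s0 = 0" "0 < Re s0"
  shows "spectral_abscissa P = omega nrm P" "0 < omega nrm P"
proof -
  have upper: "ereal (Re s) \<le> spectral_abscissa P" if "char_fun P s = 0" for s
    unfolding spectral_abscissa_def using that by (intro Sup_upper) auto
  have pos: "0 < spectral_abscissa P" using upper[OF s0(1)] s0(2)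
    by (metis ereal_less(2) less_le_trans)
  have "spectral_abscissa P \<le> omega nrm P"
    unfolding spectral_abscissa_def omega_eq_Inf_growth_bound
    using zero_le_growth_bound[OF nrm P] by (auto intro!: Sup_least Inf_greatest)
  moreover have "omega nrm P \<le> spectral_abscissa P"
  proof (rule ccontr)
    assume "\<not> omega nrm P \<le> spectral_abscissa P"
    then obtain \<alpha> where \<alpha>: "spectral_abscissa P < ereal \<alpha>" "ereal \<alpha> < omega nrm P"
      using ereal_dense2[of "spectral_abscissa P" "omega nrm P"] by (auto simp: not_le)
    have "growth_bound nrm P \<alpha>"
    proof (rule growth_bound_lattice[OF nrm P])
      show "0 < \<alpha>" using less_trans[OF pos \<alpha>(1)] by simp
      show "Re s < \<alpha>" if "char_fun P s = 0" for s using le_less_trans[OF upper[OF that] \<alpha>(1)] by simp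
    qed
    then have "omega nrm P \<le> ereal \<alpha>" unfolding omega_eq_Inf_growth_bound by (intro Inf_lower) auto
    then show False using \<alpha>(2) by simp
  qed
  ultimately show "spectral_abscissa P = omega nrm P" by (rule antisym)
  then show "0 < omega nrm P" using pos by simp
qed

section \<open>Lattice valued pushforwards\<close>

lemma vector_measure_nbv:
  assumes "M \<in> NBV" shows "vector_measure (measure_of_nbv M)"
  using diff_of_measures_nbv[OF assms] by (intro vector_measure_of_entries) auto

lemma vector_measure_finite_UN:
  assumes \<mu>: "vector_measure \<mu>" and "finite K"
    and "\<And>k. k \<in> K \<Longrightarrow> S k \<in> sets borel_I" and "disjoint_family_on S K"
  shows "\<mu> (\<Union>k\<in>K. S k) = (\<Sum>k\<in>K. \<mu> (S k))"
  using assms(2-4)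
proof (induction K)
  case empty
  then show ?case using vector_measure_empty[OF \<mu>] by simp
next
  case (insert k K)
  have "(\<Union>k\<in>K. S k) \<in> sets borel_I" using insert.prems insert.hyps by (intro sets.finite_UN) auto
  moreover have "S k \<inter> (\<Union>k\<in>K. S k) = {}"
    using insert.prems(2) insert.hyps(2) by (auto simp: disjoint_family_on_def)
  ultimately have "\<mu> (S k \<union> (\<Union>k\<in>K. S k)) = \<mu> (S k) + \<mu> (\<Union>k\<in>K. S k)"
    using insert.prems by (intro vector_measure_Un[OF \<mu>]) auto
  moreover have "\<mu> (\<Union>k\<in>K. S k) = (\<Sum>k\<in>K. \<mu> (S k))"
    using insert.prems by (intro insert.IH) (auto simp: disjoint_family_on_def)
  ultimately show ?case using insert.hyps by simp
qed

text \<open>Each jump contributes an indicator increasing in t, whose increments telescope to at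
  most 1; the sum of the norms of the jumps bounds every partition sum.\<close>

lemma bounded_variation_step:
  fixes A :: "'k \<Rightarrow> 'v::real_normed_vector" and c :: "'k \<Rightarrow> real"
  shows "bounded_variation (\<lambda>t. \<Sum>k\<in>K. if c k \<le> t then A k else 0)"
  unfolding bounded_variation_def
proof (intro exI allI impI)
  fix n :: nat and t :: "nat \<Rightarrow> real"
  assume "(\<forall>k\<le>n. t k \<in> {-1..0}) \<and> (\<forall>k<n. t k \<le> t (Suc k))"
  then have t: "\<And>k. k < n \<Longrightarrow> t k \<le> t (Suc k)" by auto
  let ?h = "\<lambda>k s. if c k \<le> s then 1 else 0 :: real"
  have "(\<Sum>m<n. norm ((\<Sum>k\<in>K. if c k \<le> t (Suc m) then A k else 0) - (\<Sum>k\<in>K. if c k \<le> t m then A k else 0)))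
      \<le> (\<Sum>m<n. \<Sum>k\<in>K. norm (A k) * (?h k (t (Suc m)) - ?h k (t m)))"
  proof (rule sum_mono)
    fix m assume m: "m \<in> {..<n}"
    have "norm ((\<Sum>k\<in>K. if c k \<le> t (Suc m) then A k else 0) - (\<Sum>k\<in>K. if c k \<le> t m then A k else 0))
        \<le> (\<Sum>k\<in>K. norm ((if c k \<le> t (Suc m) then A k else 0) - (if c k \<le> t m then A k else 0)))"
      unfolding sum_subtractf[symmetric] by (rule norm_sum)
    also have "\<dots> \<le> (\<Sum>k\<in>K. norm (A k) * (?h k (t (Suc m)) - ?h k (t m)))"
      using t[of m] m by (intro sum_mono) auto
    finally show "norm ((\<Sum>k\<in>K. if c k \<le> t (Suc m) then A k else 0) - (\<Sum>k\<in>K. if c k \<le> t m then A k else 0))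
        \<le> (\<Sum>k\<in>K. norm (A k) * (?h k (t (Suc m)) - ?h k (t m)))" .
  qed
  also have "\<dots> = (\<Sum>k\<in>K. norm (A k) * (\<Sum>m<n. ?h k (t (Suc m)) - ?h k (t m)))"
    unfolding sum_distrib_left by (rule sum.swap)
  also have "\<dots> = (\<Sum>k\<in>K. norm (A k) * (?h k (t n) - ?h k (t 0)))"
    by (intro sum.cong refl arg_cong2[where f="(*)"] sum_lessThan_telescope[of "\<lambda>m. ?h _ (t m)" n])
  also have "\<dots> \<le> (\<Sum>k\<in>K. norm (A k))" by (intro sum_mono mult_left_le) auto
  finally show "(\<Sum>m<n. norm ((\<Sum>k\<in>K. if c k \<le> t (Suc m) then A k else 0) - (\<Sum>k\<in>K. if c k \<le> t m then A k else 0)))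
      \<le> (\<Sum>k\<in>K. norm (A k))" .
qed

lemma right_continuous_step:
  fixes A :: "'k \<Rightarrow> 'v::real_normed_vector" and c :: "'k \<Rightarrow> real"
  shows "((\<lambda>t. \<Sum>k\<in>K. if c k \<le> t then A k else 0) \<longlongrightarrow> (\<Sum>k\<in>K. if c k \<le> s then A k else 0)) (at_right s)"
proof (intro tendsto_sum)
  fix k assume "k \<in> K"
  have "\<forall>\<^sub>F t in at_right s. (if c k \<le> s then A k else 0) = (if c k \<le> t then A k else 0)"
  proof (cases "c k \<le> s")
    case True
    have "\<forall>\<^sub>F t in at_right s. c k \<le> t"
      using eventually_at_right_less[of s] by eventually_elim (use True in simp)
    then show ?thesis by eventually_elim (use True in simp)
  next
    case False
    then have "\<forall>\<^sub>F t in at_right s. t < c k" by (intro order_tendstoD(2)[OF tendsto_ident_at]) simp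
    then show ?thesis by eventually_elim (use False in simp)
  qed
  then show "((\<lambda>t. if c k \<le> t then A k else 0) \<longlongrightarrow> (if c k \<le> s then A k else 0)) (at_right s)"
    by (rule Lim_transform_eventually[OF tendsto_const])
qed

lemma integral_vec_nth: "integral_vec M \<eta> $ i = (\<Sum>j\<in>UNIV. signed_integral (entry M i j) (\<lambda>\<theta>. \<eta> \<theta> $ j))"
  by (simp add: integral_vec_def entry_def[abs_def])

lemma entry_pushforward_nbv:
  assumes "M \<in> NBV" "\<phi> \<in> measurable borel_I borel_I"
  shows "entry (pushforward_nbv \<phi> M) i j = pushforward \<phi> (entry M i j)"
  unfolding entry_def[abs_def] measure_of_pushforward_nbv[OF assms] by (rule pushforward_entry)

lemma lattice_map_measurable:
  assumes \<kappa>: "simple_function borel_I \<kappa>" and range: "\<And>x. x \<in> {-1..0} \<Longrightarrow> \<kappa> x \<in> {1..<N}"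
  shows "(\<lambda>x. - (real (\<kappa> x) / real N)) \<in> measurable borel_I borel_I"
proof (rule measurable_restrict_space2)
  show "(\<lambda>x. - (real (\<kappa> x) / real N)) \<in> borel_measurable borel_I"
    by (rule borel_measurable_simple_function[OF simple_function_compose1[OF \<kappa>]])
  show "(\<lambda>x. - (real (\<kappa> x) / real N)) \<in> space borel_I \<rightarrow> {-1..0}"
    using range by (fastforce simp: field_simps)
qed

text \<open>The pushforward lives on finitely many points -k/N, so its distribution function is a
  step function. As k \<ge> 1, there is no atom at 0, and the determinant in \<open>W\<close> is
  that of the identity.\<close>

lemma lattice_pushforward_W:
  fixes M :: "real \<Rightarrow> real^'n^'n"
  assumes M: "M \<in> NBV" and \<kappa>: "simple_function borel_I \<kappa>" and range: "\<And>x. x \<in> {-1..0} \<Longrightarrow> \<kappa> x \<in> {1..<N}"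
  shows "pushforward_nbv (\<lambda>x. - (real (\<kappa> x) / real N)) M \<in> W" (is "?P \<in> W")
proof -
  let ?\<phi> = "\<lambda>x. - (real (\<kappa> x) / real N)"
  let ?S = "\<lambda>k. \<kappa> -` {k} \<inter> {-1..0}"
  let ?\<mu> = "measure_of_nbv M"
  define J where "J t = (\<Sum>k\<in>{1..<N}. if - (real k / real N) \<le> t then ?\<mu> (?S k) else 0)" for t
  have N: "0 < N" using range[of 0] by auto
  have S: "?S k \<in> sets borel_I" for k using simple_functionD(2)[OF \<kappa>, of "{k}"] by simp
  have PJ: "?P t = J t" if t: "t \<in> {-1..0}" for t
  proof (cases "t = -1")
    case True
    \<comment> \<open>Here k < N matters: no jump is counted at -1, so the step function has the
      value 0 that \<open>nbv_of_measure\<close> prescribes there.\<close>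
    have "J t = 0" unfolding J_def True using N by (intro sum.neutral) (auto simp: field_simps)
    then show ?thesis using True by (simp add: pushforward_nbv_def nbv_of_measure_def)
  next
    case False
    let ?K = "{k\<in>{1..<N}. - (real k / real N) \<le> t}"
    have "{-1..t} \<in> sets borel_I" using t by (auto simp: sets_borel_I_iff)
    then have "?P t = ?\<mu> (?\<phi> -` {-1..t} \<inter> {-1..0})"
      using False t by (simp add: pushforward_nbv_def nbv_of_measure_def pushforward_def)
    also have "?\<phi> -` {-1..t} \<inter> {-1..0} = (\<Union>k\<in>?K. ?S k)"
      using range N by (fastforce simp: field_simps)
    also have "?\<mu> (\<Union>k\<in>?K. ?S k) = (\<Sum>k\<in>?K. ?\<mu> (?S k))"
      by (intro vector_measure_finite_UN vector_measure_nbv M S) (auto simp: disjoint_family_on_def)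
    also have "\<dots> = J t" unfolding J_def by (rule sum.inter_filter) simp
    finally show ?thesis .
  qed
  have "bounded_variation J" unfolding J_def by (rule bounded_variation_step)
  then have "bounded_variation ?P"
    unfolding bounded_variation_def
  proof (elim exE, intro exI allI impI)
    fix C and n :: nat and t :: "nat \<Rightarrow> real"
    assume C: "\<forall>(n::nat) t. (\<forall>k\<le>n. t k \<in> {-1..0}) \<and> (\<forall>k<n. t k \<le> t (Suc k)) \<longrightarrow>
        (\<Sum>k<n. norm (J (t (Suc k)) - J (t k))) \<le> C"
      and t: "(\<forall>k\<le>n. t k \<in> {-1..0}) \<and> (\<forall>k<n. t k \<le> t (Suc k))"
    have "(\<Sum>k<n. norm (?P (t (Suc k)) - ?P (t k))) = (\<Sum>k<n. norm (J (t (Suc k)) - J (t k)))"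
      using t by (intro sum.cong refl) (simp add: PJ Suc_le_eq)
    then show "(\<Sum>k<n. norm (?P (t (Suc k)) - ?P (t k))) \<le> C" using C t by simp
  qed
  moreover have "continuous (at_right t) ?P" if t: "t \<in> {-1<..<0}" for t
  proof -
    have "(J \<longlongrightarrow> J t) (at_right t)" unfolding J_def by (rule right_continuous_step)
    moreover have "\<forall>\<^sub>F u in at_right t. J u = ?P u"
      unfolding eventually_at_right[of t 0, OF conjunct2[OF t[unfolded greaterThanLessThan_iff]]]
      using t by (intro exI[of _ 0]) (auto simp: PJ)
    ultimately have "(?P \<longlongrightarrow> J t) (at_right t)" by (rule Lim_transform_eventually)
    then show ?thesis using t PJ[of t] by (simp add: continuous_within)
  qed
  moreover have "?P (-1) = 0" by (simp add: pushforward_nbv_def nbv_of_measure_def)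
  ultimately have "?P \<in> NBV" by (simp add: NBV_def)
  moreover have "Lim (at_left 0) ?P = ?P 0"
  proof (rule tendsto_Lim)
    \<comment> \<open>All atoms lie at or to the left of -1/N, so the function is constant on (-1/N,
      0].\<close>
    have "?P u = ?P 0" if u: "- 1 / real N < u" "u < 0" for u
    proof -
      have "-1 \<le> - 1 / real N" using N by (simp add: field_simps)
      then have "u \<in> {-1..0}" using u by auto
      moreover have "- (real k / real N) \<le> u \<longleftrightarrow> - (real k / real N) \<le> 0" if "k \<in> {1..<N}" for k
      proof -
        have "1 / real N \<le> real k / real N" using that N by (intro divide_right_mono) auto
        then show ?thesis using u by simp
      qed
      then have "J u = J 0" unfolding J_def by (intro sum.cong) auto
      ultimately show ?thesis using PJ[of u] PJ[of 0] by simp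
    qed
    then have "\<forall>\<^sub>F u in at_left 0. ?P 0 = ?P u"
      using N by (intro eventually_at_leftI[of "- 1 / real N"]) auto
    then show "(?P \<longlongrightarrow> ?P 0) (at_left 0)" by (rule Lim_transform_eventually[OF tendsto_const])
  qed simp
  ultimately show ?thesis by (simp add: W_def)
qed

text \<open>The measures of the level sets of \<kappa> are the coefficient matrices; indices that
  \<kappa> does not attain, among them N, have empty level sets and contribute 0.\<close>

lemma lattice_pushforward_system:
  fixes M :: "real \<Rightarrow> real^'n^'n"
  assumes M: "M \<in> NBV" and \<kappa>: "simple_function borel_I \<kappa>" and range: "\<And>x. x \<in> {-1..0} \<Longrightarrow> \<kappa> x \<in> {1..<N}"
  shows "lattice_system N (\<lambda>k. measure_of_nbv M (\<kappa> -` {k} \<inter> {-1..0})) (pushforward_nbv (\<lambda>x. - (real (\<kappa> x) / real N)) M)"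
    (is "lattice_system N ?A ?P")
proof -
  let ?\<phi> = "\<lambda>x. - (real (\<kappa> x) / real N)"
  have \<phi>: "?\<phi> \<in> measurable borel_I borel_I" by (rule lattice_map_measurable[OF \<kappa> range])
  have N: "0 < N" using range[of 0] by auto
  have sub: "\<kappa> ` {-1..0} \<subseteq> {1..N}" using range by fastforce
  have zero: "?A k = 0" if "k \<notin> \<kappa> ` {-1..0}" for k
  proof -
    have "\<kappa> -` {k} \<inter> {-1..0} = {}" using that by auto
    then show ?thesis using vector_measure_empty[OF vector_measure_nbv[OF M]] by simp
  qed
  have "integral_vec ?P \<eta> = (\<Sum>k=1..N. ?A k *v \<eta> (- (real k / real N)))" if \<eta>: "continuous_on {-1..0} \<eta>" for \<eta>
  proof -
    have "signed_integral (entry ?P i j) (\<lambda>\<theta>. \<eta> \<theta> $ j) = (\<Sum>k=1..N. ?A k $ i $ j * \<eta> (- (real k / real N)) $ j)" for i j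
    proof -
      obtain m1 m2 where d: "diff_of_measures (entry M i j) m1 m2" using entry_diff_of_measures[OF M] .
      have c: "continuous_on {-1..0} (\<lambda>\<theta>. \<eta> \<theta> $ j)" by (intro continuous_intros \<eta>)
      have "bounded ((\<lambda>\<theta>. \<eta> \<theta> $ j) ` {-1..0})" using c by (intro compact_imp_bounded compact_continuous_image) auto
      then obtain B where "\<And>\<theta>. \<theta> \<in> {-1..0} \<Longrightarrow> norm (\<eta> \<theta> $ j) \<le> B" unfolding bounded_iff by blast
      moreover have "(\<lambda>\<theta>. \<eta> \<theta> $ j) \<in> borel_measurable borel_I" using c by (rule borel_measurable_continuous_on_restrict)
      ultimately have "bounded_measurable (\<lambda>\<theta>. \<eta> \<theta> $ j)" by (rule bounded_measurableI[rotated])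
      then have "signed_integral (entry ?P i j) (\<lambda>\<theta>. \<eta> \<theta> $ j) = signed_integral (entry M i j) (\<lambda>x. \<eta> (?\<phi> x) $ j)"
        unfolding entry_pushforward_nbv[OF M \<phi>] by (rule signed_integral_pushforward[OF d \<phi>])
      also have "\<dots> = (\<Sum>k\<in>\<kappa> ` {-1..0}. entry M i j (\<kappa> -` {k} \<inter> {-1..0}) *\<^sub>R \<eta> (- (real k / real N)) $ j)"
        by (rule signed_integral_simple_compose[OF d \<kappa>, of "\<lambda>k. \<eta> (- (real k / real N)) $ j"])
      also have "\<dots> = (\<Sum>k\<in>\<kappa> ` {-1..0}. ?A k $ i $ j * \<eta> (- (real k / real N)) $ j)" by (simp add: entry_def)
      also have "\<dots> = (\<Sum>k=1..N. ?A k $ i $ j * \<eta> (- (real k / real N)) $ j)"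
        by (intro sum.mono_neutral_left sub) (auto simp: zero)
      finally show ?thesis .
    qed
    then show ?thesis
      by (simp add: vec_eq_iff integral_vec_nth matrix_vector_mult_def sum.swap[of _ UNIV])
  qed
  moreover have "char_fun ?P s =
      det (mat 1 - (\<Sum>k=1..N. cscale (exp (- (s * of_real (real k / real N)))) (complex_mat (?A k))))" for s
  proof -
    have "integral_scal M (\<lambda>x. exp (s * of_real (?\<phi> x))) =
        (\<Sum>k\<in>\<kappa> ` {-1..0}. cscale (exp (s * of_real (- (real k / real N)))) (complex_mat (?A k)))"
      unfolding complex_mat_def
      by (rule integral_scal_simple_compose[OF M \<kappa>, of "\<lambda>k. exp (s * of_real (- (real k / real N)))"])
    also have "\<dots> = (\<Sum>k=1..N. cscale (exp (s * of_real (- (real k / real N)))) (complex_mat (?A k)))"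
      by (intro sum.mono_neutral_left sub) (auto simp: zero complex_mat_def vec_eq_iff)
    finally show ?thesis by (simp add: char_fun_pushforward_nbv[OF M \<phi>])
  qed
  ultimately show ?thesis using N by (simp add: lattice_system_def)
qed

section \<open>Instability under \<open>\<rho>\<^sub>H\<^sub>S > 1\<close>\<close>

text \<open>Mean value inequality on a convex half plane in which the derivative has modulus at most
  1.\<close>

lemma norm_exp_diff_le:
  fixes a b :: complex
  assumes "Re a \<le> 0" "Re b \<le> 0"
  shows "cmod (exp a - exp b) \<le> cmod (a - b)"
proof -
  have "cmod (exp a - exp b) \<le> 1 * cmod (a - b)"
  proof (rule field_differentiable_bound[where S="{z. Re z \<le> 0}" and f'=exp])
    show "convex {z. Re z \<le> 0}" by (rule convex_halfspace_Re_le)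
    show "(exp has_field_derivative exp z) (at z within {z. Re z \<le> 0})" for z :: complex
      by (rule DERIV_subset[OF DERIV_exp]) simp
  qed (use assms in auto)
  then show ?thesis by simp
qed

definition total_mass_nbv :: "(real \<Rightarrow> real^'n^'n) \<Rightarrow> real" where
  "total_mass_nbv M = (\<Sum>i\<in>UNIV. \<Sum>j\<in>UNIV. total_mass (entry M i j))"

lemma total_mass_nbv_nonneg: "0 \<le> total_mass_nbv M"
  unfolding total_mass_nbv_def by (intro sum_nonneg total_mass_nonneg)

lemma total_mass_entry_le: "total_mass (entry M i j) \<le> total_mass_nbv M"
proof -
  have "total_mass (entry M i j) \<le> (\<Sum>j\<in>UNIV. total_mass (entry M i j))"
    by (rule member_le_sum) (auto intro: total_mass_nonneg)
  also have "\<dots> \<le> total_mass_nbv M" unfolding total_mass_nbv_def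
    by (rule member_le_sum) (auto intro: sum_nonneg total_mass_nonneg)
  finally show ?thesis .
qed

lemma integral_scal_entry_le:
  assumes M: "M \<in> NBV" and f: "f \<in> borel_measurable borel_I"
    and e: "\<And>x. x \<in> {-1..0} \<Longrightarrow> cmod (f x) \<le> e"
  shows "cmod (integral_scal M f $ i $ j) \<le> total_mass_nbv M * e"
proof -
  obtain m1 m2 where d: "diff_of_measures (entry M i j) m1 m2" using entry_diff_of_measures[OF M] .
  have e0: "0 \<le> e" using order_trans[OF norm_ge_zero e[of 0]] by simp
  have "cmod (integral_scal M f $ i $ j) \<le> total_mass (entry M i j) * e"
    unfolding integral_scal_nth by (rule norm_signed_integral_le[OF d f e])
  also have "\<dots> \<le> total_mass_nbv M * e" by (intro mult_right_mono total_mass_entry_le e0)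
  finally show ?thesis .
qed

lemma integral_scal_diff_entry_le:
  assumes M: "M \<in> NBV" and f: "bounded_measurable f" and g: "bounded_measurable g"
    and e: "\<And>x. x \<in> {-1..0} \<Longrightarrow> cmod (f x - g x) \<le> e"
  shows "cmod (integral_scal M f $ i $ j - integral_scal M g $ i $ j) \<le> total_mass_nbv M * e"
proof -
  obtain m1 m2 where d: "diff_of_measures (entry M i j) m1 m2" using entry_diff_of_measures[OF M] .
  have "integral_scal M f $ i $ j - integral_scal M g $ i $ j = integral_scal M (\<lambda>x. f x - g x) $ i $ j"
    unfolding integral_scal_nth using signed_integral_diff[OF d f g] by simp
  then show ?thesis
    using integral_scal_entry_le[where f="\<lambda>x. f x - g x", OF M _ e] f g
    by (simp add: bounded_measurable_def borel_measurable_diff)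
qed

lemma det_near_identity:
  obtains d where "0 < d" "\<And>X :: complex^'n^'n. norm X < d \<Longrightarrow> det (mat 1 - X) \<noteq> 0"
proof -
  have "((\<lambda>X::complex^'n^'n. det (mat 1 - X)) \<longlongrightarrow> det (mat 1 - (0::complex^'n^'n))) (at 0)"
    by (intro tendsto_det tendsto_intros)
  then have "\<forall>\<^sub>F X in at (0::complex^'n^'n). dist (det (mat 1 - X)) (det (mat 1 - (0::complex^'n^'n))) < 1"
    by (rule tendstoD) simp
  then obtain d where d: "0 < d"
    "\<And>X::complex^'n^'n. X \<noteq> 0 \<Longrightarrow> dist X 0 < d \<Longrightarrow> dist (det (mat 1 - X)) (det (mat 1 - (0::complex^'n^'n))) < 1"
    unfolding eventually_at by auto
  have "det (mat 1 - X) \<noteq> 0" if "norm X < d" for X :: "complex^'n^'n"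
  proof (cases "X = 0")
    case False
    then show ?thesis using d(2)[of X] that by auto
  qed simp
  with d(1) show ?thesis by (rule that)
qed

text \<open>Replacing \<open>\<theta>\<close> by a map \<open>\<psi>\<close> bounded away from \<open>0\<close> makes \<open>\<integral> e\<^bsup>i\<xi>\<^esup> e\<^bsup>\<sigma>\<psi>\<^esup> dM\<close> vanish as
  \<open>\<sigma> \<rightarrow> \<infinity>\<close>, so the eigenvalue outside the unit circle present at \<open>\<sigma> = 0\<close> must cross the circle.\<close>

locale damped_integral =
  fixes M :: "real \<Rightarrow> real^'n^'n" and \<xi> \<psi> :: "real \<Rightarrow> real" and h :: real
  assumes M: "M \<in> NBV" and \<xi>: "\<xi> \<in> borel_measurable borel_I" and \<psi>: "\<psi> \<in> borel_measurable borel_I"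
    and h: "0 < h" and \<psi>_bounds: "\<And>x. x \<in> {-1..0} \<Longrightarrow> -1 + h \<le> \<psi> x \<and> \<psi> x \<le> - h"
begin

definition B :: "complex \<Rightarrow> complex^'n^'n" where
  "B \<zeta> = integral_scal M (\<lambda>x. exp (\<i> * of_real (\<xi> x)) * exp (\<zeta> * of_real (\<psi> x)))"

lemma integrand_measurable: "(\<lambda>x. exp (\<i> * of_real (\<xi> x)) * exp (\<zeta> * of_real (\<psi> x))) \<in> borel_measurable borel_I"
  using \<xi> \<psi> by measurable

lemma integrand_bound:
  assumes "0 \<le> Re \<zeta>" "x \<in> {-1..0}"
  shows "cmod (exp (\<i> * of_real (\<xi> x)) * exp (\<zeta> * of_real (\<psi> x))) \<le> exp (- (Re \<zeta> * h))"
proof -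
  have "Re \<zeta> * \<psi> x \<le> Re \<zeta> * (- h)" using \<psi>_bounds[OF assms(2)] assms(1) by (intro mult_left_mono) auto
  then show ?thesis by (simp add: norm_mult)
qed

lemma integrand_bounded_measurable:
  "0 \<le> Re \<zeta> \<Longrightarrow> bounded_measurable (\<lambda>x. exp (\<i> * of_real (\<xi> x)) * exp (\<zeta> * of_real (\<psi> x)))"
  by (rule bounded_measurableI[OF integrand_measurable integrand_bound])

lemma B_entry_le: "0 \<le> Re \<zeta> \<Longrightarrow> cmod (B \<zeta> $ i $ j) \<le> total_mass_nbv M * exp (- (Re \<zeta> * h))"
  unfolding B_def by (intro integral_scal_entry_le[OF M integrand_measurable] integrand_bound)

text \<open>Since |\<psi>| \<le> 1, the integrand is 1-Lipschitz in \<zeta> on the closed right half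
  plane. This yields continuity up to the imaginary axis; holomorphy inside comes later from a
  locally uniform limit.\<close>

lemma B_diff_entry_le:
  assumes "0 \<le> Re \<zeta>" "0 \<le> Re \<zeta>'"
  shows "cmod (B \<zeta> $ i $ j - B \<zeta>' $ i $ j) \<le> total_mass_nbv M * cmod (\<zeta> - \<zeta>')"
  unfolding B_def
proof (rule integral_scal_diff_entry_le[OF M integrand_bounded_measurable[OF assms(1)] integrand_bounded_measurable[OF assms(2)]])
  fix x :: real assume x: "x \<in> {-1..0}"
  have p: "-1 \<le> \<psi> x" "\<psi> x \<le> 0" using \<psi>_bounds[OF x] h by auto
  have "cmod (exp (\<i> * of_real (\<xi> x)) * exp (\<zeta> * of_real (\<psi> x)) - exp (\<i> * of_real (\<xi> x)) * exp (\<zeta>' * of_real (\<psi> x)))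
      = cmod (exp (\<zeta> * of_real (\<psi> x)) - exp (\<zeta>' * of_real (\<psi> x)))"
    unfolding right_diff_distrib[symmetric] norm_mult by simp
  also have "\<dots> \<le> cmod (\<zeta> * of_real (\<psi> x) - \<zeta>' * of_real (\<psi> x))"
    using p assms by (intro norm_exp_diff_le) (auto simp: mult_nonneg_nonpos)
  also have "\<dots> = cmod (\<zeta> - \<zeta>') * \<bar>\<psi> x\<bar>" unfolding left_diff_distrib[symmetric] norm_mult by simp
  also have "\<dots> \<le> cmod (\<zeta> - \<zeta>') * 1" using p by (intro mult_left_mono) auto
  finally show "cmod (exp (\<i> * of_real (\<xi> x)) * exp (\<zeta> * of_real (\<psi> x)) - exp (\<i> * of_real (\<xi> x)) * exp (\<zeta>' * of_real (\<psi> x)))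
      \<le> cmod (\<zeta> - \<zeta>')" by simp
qed

lemma continuous_on_B_entry: "continuous_on {\<zeta>. 0 \<le> Re \<zeta>} (\<lambda>\<zeta>. B \<zeta> $ i $ j)"
  by (rule lipschitz_on_continuous_on[of "total_mass_nbv M"])
    (auto intro!: lipschitz_onI B_diff_entry_le simp: total_mass_nbv_nonneg dist_norm)

lemma B_large:
  obtains \<sigma> where "\<And>s w. \<sigma> \<le> s \<Longrightarrow> cmod w \<le> 1 \<Longrightarrow> det (mat 1 - cscale w (B (of_real s))) \<noteq> 0"
proof -
  obtain d where d: "0 < d" "\<And>X :: complex^'n^'n. norm X < d \<Longrightarrow> det (mat 1 - X) \<noteq> 0"
    using det_near_identity by blast
  define c where "c = real CARD('n) * real CARD('n) * total_mass_nbv M"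
  have "((\<lambda>s. c * exp (- (s * h))) \<longlongrightarrow> 0) at_top"
    using h by real_asymp
  then have "\<forall>\<^sub>F s in at_top. c * exp (- (s * h)) < d" using d(1) by (rule order_tendstoD)
  then obtain \<sigma> where \<sigma>: "\<And>s. \<sigma> \<le> s \<Longrightarrow> c * exp (- (s * h)) < d" unfolding eventually_at_top_linorder by blast
  show ?thesis
  proof (rule that[of "max \<sigma> 0"])
    fix s w assume s: "max \<sigma> 0 \<le> s" and w: "cmod w \<le> 1"
    have "norm (cscale w (B (of_real s))) \<le> real CARD('n) * real CARD('n) * (total_mass_nbv M * exp (- (s * h)))"
    proof (rule norm_matrix_le)
      fix i j
      have "cmod (cscale w (B (of_real s)) $ i $ j) \<le> 1 * (total_mass_nbv M * exp (- (s * h)))"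
        using B_entry_le[of "of_real s" i j] s w unfolding cscale_nth norm_mult by (intro mult_mono) auto
      then show "cmod (cscale w (B (of_real s)) $ i $ j) \<le> total_mass_nbv M * exp (- (s * h))" by simp
    qed
    also have "\<dots> < d" using \<sigma>[of s] s by (simp add: c_def mult.assoc)
    finally show "det (mat 1 - cscale w (B (of_real s))) \<noteq> 0" by (rule d(2))
  qed
qed

text \<open>w stands for the reciprocal of an eigenvalue, so the zero starts inside the unit disc.
  If the circle were never hit, lowering the parameter from large values, where the closed disc is
  free of zeros, would keep it free of zeros.\<close>

lemma eigenvalue_crosses_circle:
  assumes w0: "cmod w0 < 1" "det (mat 1 - cscale w0 (B 0)) = 0"
  obtains \<sigma> w where "0 < \<sigma>" "cmod w = 1" "det (mat 1 - cscale w (B (of_real \<sigma>))) = 0"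
proof -
  \<comment> \<open>To cross at a strictly positive parameter, the zero is first moved from 0 to
    some s > 0: otherwise the resolvents at 1/(n+1) would have no zeros in the open disc, and
    neither would their limit.\<close>
  have "\<exists>s>0. \<exists>w. cmod w < 1 \<and> det (mat 1 - cscale w (B (of_real s))) = 0"
  proof (rule ccontr)
    assume neg: "\<not> ?thesis"
    have lim: "(\<lambda>n. B (of_real (inverse (real (Suc n))))) \<longlonglongrightarrow> B 0"
    proof (intro vec_tendstoI)
      fix i j
      have "((\<lambda>n. complex_of_real (inverse (real (Suc n)))) \<longlonglongrightarrow> of_real 0)"
        by (intro tendsto_of_real LIMSEQ_inverse_real_of_nat)
      then show "(\<lambda>n. B (of_real (inverse (real (Suc n)))) $ i $ j) \<longlonglongrightarrow> B 0 $ i $ j"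
        by (intro continuous_on_tendsto_compose[OF continuous_on_B_entry]) auto
    qed
    have "det (mat 1 - cscale w0 (B 0)) \<noteq> 0"
    proof (rule resolvent_nonvanishing_limit[OF lim zero_less_one _ w0(1)])
      fix n w assume "cmod w < 1"
      moreover have "0 < inverse (real (Suc n))" by simp
      ultimately show "det (mat 1 - cscale w (B (of_real (inverse (real (Suc n)))))) \<noteq> 0"
        using neg by blast
    qed
    with w0(2) show False by simp
  qed
  then obtain s w1 where s: "0 < s" and w1: "cmod w1 < 1" "det (mat 1 - cscale w1 (B (of_real s))) = 0" by blast
  obtain S where S: "\<And>s w. S \<le> s \<Longrightarrow> cmod w \<le> 1 \<Longrightarrow> det (mat 1 - cscale w (B (of_real s))) \<noteq> 0"
    using B_large by blast
  \<comment> \<open>The path runs from s + |S|, which is at least S, down to s through positive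
    values.\<close>
  define \<gamma> where "\<gamma> t = s + (1 - t) * \<bar>S\<bar>" for t :: real
  have \<gamma>: "0 < \<gamma> t" if "t \<in> {0..1}" for t using that s by (simp add: \<gamma>_def add_pos_nonneg)
  let ?q = "\<lambda>t w. det (mat 1 - cscale w (B (of_real (\<gamma> t))))"
  have "\<exists>t\<in>{0..1}. \<exists>w. cmod w = 1 \<and> ?q t w = 0"
  proof (rule ccontr)
    assume neg: "\<not> ?thesis"
    have "?q 1 w1 \<noteq> 0"
    proof (rule homotopy_nonvanishing[where q="?q" and r=1])
      have c: "continuous_on ({0..1} \<times> cball (0::complex) 1) (\<lambda>p. complex_of_real (\<gamma> (fst p)))"
        unfolding \<gamma>_def by (intro continuous_intros)
      have "complex_of_real (\<gamma> (fst p)) \<in> {\<zeta>. 0 \<le> Re \<zeta>}" if "p \<in> {0..1} \<times> cball (0::complex) 1" for p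
        using that \<gamma>[of "fst p"] by (simp add: mem_Times_iff less_imp_le)
      then have BC: "continuous_on ({0..1} \<times> cball (0::complex) 1) (\<lambda>p. B (of_real (\<gamma> (fst p))) $ i $ j)" for i j
        by (intro continuous_on_compose2[OF continuous_on_B_entry c]) blast
      show "continuous_on ({0..1} \<times> cball 0 1) (\<lambda>p. ?q (fst p) (snd p))"
        by (intro continuous_on_det continuous_on_matrix, unfold vector_minus_component cscale_nth)
          (intro continuous_intros BC)
      show "?q t holomorphic_on ball 0 1" for t
        by (intro holomorphic_on_det) (auto intro!: holomorphic_intros)
      show "?q 0 z \<noteq> 0" if "cmod z \<le> 1" for z
        using that s by (intro S) (auto simp: \<gamma>_def)
    qed (use neg w1 in auto)
    with w1(2) show False by (simp add: \<gamma>_def)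
  qed
  then show ?thesis using \<gamma> that by blast
qed

section \<open>Lattice valued maps with prescribed phase\<close>

definition phase :: "real \<Rightarrow> real" where "phase x = frac (\<xi> x / (2 * pi))"

text \<open>\<open>lattice m\<close> takes values in \<open>m\<^sup>-\<^sup>2 \<int>\<close>: the multiple of \<open>1/m\<close> follows \<open>\<psi>\<close>, while the correction of size
  less than \<open>1/m\<close> makes \<open>2\<pi>m\<cdot>lattice m\<close> agree with \<open>\<xi>\<close> modulo \<open>2\<pi>\<close> up to \<open>2\<pi>/m\<close>.\<close>

definition lattice :: "nat \<Rightarrow> real \<Rightarrow> real" where
  "lattice m x = (of_int \<lfloor>m * \<psi> x\<rfloor> + of_int \<lfloor>m * phase x\<rfloor> / m) / m"

text \<open>Minus m^2 times the value of \<open>lattice m\<close>, an integer that is positive on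
  [-1,0] once m > 1/h, so that \<open>nat\<close> truncates nothing.\<close>

definition lattice_index :: "nat \<Rightarrow> real \<Rightarrow> nat" where
  "lattice_index m x = nat (- (int m * \<lfloor>m * \<psi> x\<rfloor> + \<lfloor>m * phase x\<rfloor>))"

lemma phase_measurable: "phase \<in> borel_measurable borel_I"
  unfolding phase_def[abs_def] frac_def using \<xi> by measurable

lemma phase_bounds: "0 \<le> phase x" "phase x < 1"
  by (simp_all add: phase_def frac_lt_1)

lemma exp_2pi_int: "exp (2 * of_real pi * \<i> * of_int k) = 1"
proof -
  have eq: "2 * of_real pi * \<i> * of_int k = complex_of_real (2 * real_of_int k * pi) * \<i>" by simp
  show ?thesis unfolding eq by (rule exp_integer_2pi) simp
qed

lemma exp_phase: "exp (\<i> * of_real (\<xi> x)) = exp (2 * of_real pi * \<i> * of_real (phase x))"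
proof -
  have "\<i> * of_real (\<xi> x) = 2 * of_real pi * \<i> * of_real (phase x) + 2 * of_real pi * \<i> * of_int \<lfloor>\<xi> x / (2 * pi)\<rfloor>"
  proof -
    have "\<xi> x = 2 * pi * (phase x + of_int \<lfloor>\<xi> x / (2 * pi)\<rfloor>)" by (simp add: phase_def frac_def)
    then have "complex_of_real (\<xi> x) = of_real (2 * pi * (phase x + of_int \<lfloor>\<xi> x / (2 * pi)\<rfloor>))" by (rule arg_cong)
    then show ?thesis by (simp add: algebra_simps)
  qed
  then show ?thesis by (simp only: exp_add exp_2pi_int mult_1_right)
qed

text \<open>Before division by m, rounding errs downwards by less than 1 and the phase correction
  upwards by less than 1; having opposite signs, the two do not add up.\<close>

lemma lattice_close:
  assumes "0 < m" shows "\<bar>lattice m x - \<psi> x\<bar> < 1 / m"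
proof -
  have m: "0 < real m" using assms by simp
  have f: "0 \<le> of_int \<lfloor>m * phase x\<rfloor> / real m" using phase_bounds(1)[of x] m by (intro divide_nonneg_nonneg) auto
  have "of_int \<lfloor>m * phase x\<rfloor> \<le> m * phase x" by simp
  also have "\<dots> < real m * 1" using phase_bounds(2)[of x] m by (intro mult_strict_left_mono)
  finally have g: "of_int \<lfloor>m * phase x\<rfloor> / real m < 1" using m by simp
  have "of_int \<lfloor>m * \<psi> x\<rfloor> \<le> m * \<psi> x" "m * \<psi> x < of_int \<lfloor>m * \<psi> x\<rfloor> + 1" by linarith+
  then have "\<bar>(of_int \<lfloor>m * \<psi> x\<rfloor> + of_int \<lfloor>m * phase x\<rfloor> / m) - m * \<psi> x\<bar> < 1" using f g by linarith
  moreover have "lattice m x - \<psi> x = ((of_int \<lfloor>m * \<psi> x\<rfloor> + of_int \<lfloor>m * phase x\<rfloor> / m) - m * \<psi> x) / m"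
    using m by (simp add: lattice_def diff_divide_distrib)
  ultimately show ?thesis using m by (simp add: abs_divide divide_strict_right_mono)
qed

text \<open>A deviation below 1/m < h from a value in [-1 + h, -h] stays inside (-1,0).\<close>

lemma lattice_range:
  assumes "1 / h < real m" "x \<in> {-1..0}"
  shows "-1 < lattice m x" "lattice m x < 0"
proof -
  have "0 < 1 / h" using h by simp
  then have m: "0 < real m" using assms(1) by linarith
  then have "1 / real m < h" using assms(1) h by (simp add: field_simps)
  then show "-1 < lattice m x" "lattice m x < 0"
    using lattice_close[of m x] \<psi>_bounds[OF assms(2)] m by (auto simp: abs_less_iff)
qed

lemma lattice_index_range:
  assumes "1 / h < real m" "x \<in> {-1..0}"
  shows "lattice_index m x \<in> {1..<m * m}" "lattice m x = - (real (lattice_index m x) / real (m * m))"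
proof -
  have "0 < 1 / h" using h by simp
  then have m: "0 < real m" using assms(1) by linarith
  let ?j = "- (int m * \<lfloor>m * \<psi> x\<rfloor> + \<lfloor>m * phase x\<rfloor>)"
  have eq: "lattice m x = - (of_int ?j / real (m * m))"
    using m by (simp add: lattice_def field_simps)
  have "0 < real_of_int ?j"
    using lattice_range(2)[OF assms] m unfolding eq by (simp add: zero_less_divide_iff)
  moreover have "real_of_int ?j < real (m * m)"
    using lattice_range(1)[OF assms] m unfolding eq by (simp add: divide_less_eq)
  ultimately have j: "0 < ?j" "?j < int (m * m)" by linarith+
  obtain k where k: "?j = int k" using zero_le_imp_eq_int[of ?j] j(1) by auto
  then have "lattice_index m x = k" by (simp only: lattice_index_def nat_int)
  moreover have "0 < k" "k < m * m" using j unfolding k by (simp_all only: of_nat_0_less_iff of_nat_less_iff)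
  ultimately show "lattice_index m x \<in> {1..<m * m}"
    "lattice m x = - (real (lattice_index m x) / real (m * m))"
    unfolding eq k by auto
qed

lemma lattice_index_simple:
  assumes "1 / h < real m" shows "simple_function borel_I (lattice_index m)"
  unfolding simple_function_def
proof
  have "lattice_index m ` space borel_I \<subseteq> {1..<m * m}" using lattice_index_range(1)[OF assms] by auto
  then show "finite (lattice_index m ` space borel_I)" by (rule finite_subset) simp
  have m: "lattice_index m \<in> measurable borel_I (count_space UNIV)"
    unfolding lattice_index_def[abs_def] using \<psi> phase_measurable by measurable
  show "\<forall>y\<in>lattice_index m ` space borel_I. lattice_index m -` {y} \<inter> space borel_I \<in> sets borel_I"
    by (intro ballI measurable_sets[OF m]) simp
qed

text \<open>At height 2 pi m the integer part of m \<psi> contributes full periods, and what remains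
  is the rounded phase, within 2 pi / m of the true one. Replacing \<open>lattice m\<close> by
  \<psi> in the other factor costs |\<zeta>| / m.\<close>

lemma lattice_integrand_close:
  assumes "1 / h < real m" "x \<in> {-1..0}" "0 \<le> Re \<zeta>"
  shows "cmod (exp ((\<zeta> + 2 * of_real pi * \<i> * of_nat m) * of_real (lattice m x)) -
      exp (\<i> * of_real (\<xi> x)) * exp (\<zeta> * of_real (\<psi> x))) \<le> (cmod \<zeta> + 2 * pi) / m"
proof -
  have "0 < 1 / h" using h by simp
  then have m: "0 < real m" using assms(1) by linarith
  let ?a = "exp (\<zeta> * of_real (lattice m x))" and ?b = "exp (\<zeta> * of_real (\<psi> x))"
  let ?u = "2 * of_real pi * \<i> * of_real (of_int \<lfloor>m * phase x\<rfloor> / m)" and ?v = "2 * of_real pi * \<i> * of_real (phase x)"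
  have "real m * lattice m x = of_int \<lfloor>m * \<psi> x\<rfloor> + of_int \<lfloor>m * phase x\<rfloor> / m" using m by (simp add: lattice_def)
  then have "complex_of_real (real m * lattice m x) = of_real (of_int \<lfloor>m * \<psi> x\<rfloor> + of_int \<lfloor>m * phase x\<rfloor> / m)"
    by (rule arg_cong)
  then have "complex_of_nat m * of_real (lattice m x) = of_int \<lfloor>m * \<psi> x\<rfloor> + of_real (of_int \<lfloor>m * phase x\<rfloor> / m)" by simp
  then have "2 * of_real pi * \<i> * of_nat m * of_real (lattice m x) = ?u + 2 * of_real pi * \<i> * of_int \<lfloor>m * \<psi> x\<rfloor>"
    by (simp only: mult.assoc) (simp add: algebra_simps)
  then have "exp ((\<zeta> + 2 * of_real pi * \<i> * of_nat m) * of_real (lattice m x)) = ?a * exp ?u"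
    by (simp only: distrib_right exp_add exp_2pi_int mult_1_right)
  moreover have "?a * exp ?u - exp ?v * ?b = (?a - ?b) * exp ?u + ?b * (exp ?u - exp ?v)"
    by (simp add: algebra_simps)
  moreover have "cmod ((?a - ?b) * exp ?u) \<le> cmod \<zeta> / m"
  proof -
    have "cmod (?a - ?b) \<le> cmod (\<zeta> * of_real (lattice m x) - \<zeta> * of_real (\<psi> x))"
      using assms(3) lattice_range[OF assms(1,2)] \<psi>_bounds[OF assms(2)] h
      by (intro norm_exp_diff_le) (auto intro!: mult_nonneg_nonpos)
    also have "\<dots> = cmod \<zeta> * \<bar>lattice m x - \<psi> x\<bar>"
      unfolding right_diff_distrib[symmetric] norm_mult of_real_diff[symmetric] norm_of_real ..
    also have "\<dots> \<le> cmod \<zeta> * (1 / m)"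
      using lattice_close[of m x] m by (intro mult_left_mono) auto
    finally show ?thesis by (simp add: norm_mult)
  qed
  moreover have "cmod (?b * (exp ?u - exp ?v)) \<le> 2 * pi / m"
  proof -
    have b: "cmod ?b \<le> 1"
      using assms(3) \<psi>_bounds[OF assms(2)] h by (auto intro!: mult_nonneg_nonpos)
    have "cmod (exp ?u - exp ?v) \<le> cmod (?u - ?v)" by (rule norm_exp_diff_le) auto
    also have "\<dots> = 2 * pi * \<bar>of_int \<lfloor>m * phase x\<rfloor> / m - phase x\<bar>"
      unfolding right_diff_distrib[symmetric] norm_mult of_real_diff[symmetric] norm_of_real by simp
    also have "\<dots> \<le> 2 * pi * (1 / m)"
    proof (intro mult_left_mono)
      have "of_int \<lfloor>m * phase x\<rfloor> / m - phase x = (of_int \<lfloor>m * phase x\<rfloor> - m * phase x) / m"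
        using m by (simp add: diff_divide_distrib)
      moreover have "\<bar>of_int \<lfloor>m * phase x\<rfloor> - m * phase x\<bar> \<le> 1" by linarith
      ultimately show "\<bar>of_int \<lfloor>m * phase x\<rfloor> / m - phase x\<bar> \<le> 1 / m"
        using m by (simp add: abs_divide divide_right_mono)
    qed simp
    finally have "cmod ?b * cmod (exp ?u - exp ?v) \<le> 1 * (2 * pi * (1 / m))" using b by (intro mult_mono) auto
    then show ?thesis by (simp add: norm_mult)
  qed
  ultimately show ?thesis
    unfolding exp_phase using norm_triangle_mono[of "(?a - ?b) * exp ?u" _ "?b * (exp ?u - exp ?v)"]
    by (simp add: add_divide_distrib)
qed

end

lemma bounded_measurable_compose:
  assumes "bounded_measurable f" "\<phi> \<in> measurable borel_I borel_I"
  shows "bounded_measurable (\<lambda>x. f (\<phi> x))"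
proof -
  obtain b where b: "\<And>x. x \<in> {-1..0} \<Longrightarrow> norm (f x) \<le> b" and m: "f \<in> borel_measurable borel_I"
    using assms(1) unfolding bounded_measurable_def by blast
  show ?thesis
  proof (rule bounded_measurableI[OF measurable_compose[OF assms(2) m]])
    show "norm (f (\<phi> x)) \<le> b" if "x \<in> {-1..0}" for x
      using measurable_space[OF assms(2)] that by (intro b) simp
  qed
qed

context damped_integral
begin

definition lattice_map :: "nat \<Rightarrow> real \<Rightarrow> real" where
  "lattice_map m x = - (real (lattice_index m x) / real (m * m))"

text \<open>The shift brings the window around 2 pi i m back to a fixed place, where the functions
  can converge; real parts of zeros are unchanged.\<close>

definition approx_char :: "nat \<Rightarrow> complex \<Rightarrow> complex" where
  "approx_char m \<zeta> = char_fun (pushforward_nbv (lattice_map m) M) (\<zeta> + 2 * of_real pi * \<i> * of_nat m)"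

lemma lattice_map_meas: "1 / h < real m \<Longrightarrow> lattice_map m \<in> measurable borel_I borel_I"
  unfolding lattice_map_def[abs_def]
  by (rule lattice_map_measurable[OF lattice_index_simple lattice_index_range(1)])

lemma approx_char_eq:
  assumes "1 / h < real m"
  shows "approx_char m \<zeta> =
    det (mat 1 - integral_scal M (\<lambda>x. exp ((\<zeta> + 2 * of_real pi * \<i> * of_nat m) * of_real (lattice_map m x))))"
  unfolding approx_char_def by (rule char_fun_pushforward_nbv[OF M lattice_map_meas[OF assms]])

lemma approx_char_holomorphic:
  assumes "1 / h < real m" shows "approx_char m holomorphic_on S"
proof -
  have "lattice_system (m * m) (\<lambda>k. measure_of_nbv M (lattice_index m -` {k} \<inter> {-1..0})) (pushforward_nbv (lattice_map m) M)"
    unfolding lattice_map_def[abs_def]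
    by (rule lattice_pushforward_system[OF M lattice_index_simple[OF assms] lattice_index_range(1)[OF assms]])
  then have eq: "approx_char m = (\<lambda>\<zeta>. det (mat 1 - (\<Sum>k=1..m * m.
      cscale (exp (- ((\<zeta> + 2 * of_real pi * \<i> * of_nat m) * of_real (real k / real (m * m)))))
        (complex_mat (measure_of_nbv M (lattice_index m -` {k} \<inter> {-1..0}))))))"
    unfolding approx_char_def[abs_def] lattice_system_def by blast
  show ?thesis
    unfolding eq by (intro holomorphic_on_det, unfold vector_minus_component sum_component cscale_nth)
      (intro holomorphic_intros)
qed

text \<open>The offset \<open>m1\<close> makes every index exceed 1/h. The error (|\<zeta>| + 2 pi)
  / m of the integrands is uniform on bounded sets, and total variation carries it over to the
  matrices.\<close>

lemma uniform_limit_approx_char: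
  assumes m1: "1 / h < real m1" and K: "bounded K" "K \<subseteq> {\<zeta>. 0 \<le> Re \<zeta>}"
  shows "uniform_limit K (\<lambda>n. approx_char (n + m1)) (\<lambda>\<zeta>. det (mat 1 - B \<zeta>)) sequentially"
proof -
  obtain b where b: "\<And>\<zeta>. \<zeta> \<in> K \<Longrightarrow> cmod \<zeta> \<le> b" using K(1) unfolding bounded_iff by blast
  have large: "1 / h < real (n + m1)" for n using m1 by simp
  have "0 < 1 / h" using h by simp
  then have m1pos: "0 < real m1" using m1 by linarith
  let ?X = "\<lambda>n \<zeta>. mat 1 - integral_scal M (\<lambda>x. exp ((\<zeta> + 2 * of_real pi * \<i> * of_nat (n + m1)) * of_real (lattice_map (n + m1) x)))"
  have "uniform_limit K (\<lambda>n \<zeta>. det (?X n \<zeta>)) (\<lambda>\<zeta>. det (mat 1 - B \<zeta>)) sequentially"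
  proof (rule uniform_limit_det)
    show "uniform_limit K ?X (\<lambda>\<zeta>. mat 1 - B \<zeta>) sequentially"
    proof (rule uniform_limit_matrixI)
      fix n \<zeta> i j assume \<zeta>: "\<zeta> \<in> K"
      let ?m = "n + m1"
      let ?f = "\<lambda>x. exp ((\<zeta> + 2 * of_real pi * \<i> * of_nat ?m) * of_real (lattice_map ?m x))"
      have R: "0 \<le> Re \<zeta>" using \<zeta> K(2) by auto
      have "cmod (integral_scal M ?f $ i $ j - B \<zeta> $ i $ j) \<le> total_mass_nbv M * ((b + 2 * pi) / real ?m)"
        unfolding B_def
      proof (rule integral_scal_diff_entry_le[OF M _ integrand_bounded_measurable[OF R]])
        show "bounded_measurable ?f"
          by (rule bounded_measurable_compose[OF bounded_measurable_exp lattice_map_meas[OF large]])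
        fix x :: real assume x: "x \<in> {-1..0}"
        have "cmod (?f x - exp (\<i> * of_real (\<xi> x)) * exp (\<zeta> * of_real (\<psi> x))) \<le> (cmod \<zeta> + 2 * pi) / real ?m"
          using lattice_integrand_close[OF large x R] lattice_index_range(2)[OF large x]
          unfolding lattice_map_def by simp
        also have "\<dots> \<le> (b + 2 * pi) / real ?m" using b[OF \<zeta>] by (intro divide_right_mono) auto
        finally show "cmod (?f x - exp (\<i> * of_real (\<xi> x)) * exp (\<zeta> * of_real (\<psi> x))) \<le> (b + 2 * pi) / real ?m" .
      qed
      then show "norm (?X n \<zeta> $ i $ j - (mat 1 - B \<zeta>) $ i $ j) \<le> total_mass_nbv M * ((b + 2 * pi) / real ?m)"
        by (simp add: norm_minus_commute)
    next
      have "(\<lambda>n. (b + 2 * pi) / real (n + m1)) \<longlonglongrightarrow> 0"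
        by (rule LIMSEQ_ignore_initial_segment[where f="\<lambda>n. (b + 2 * pi) / real n"]) (rule lim_const_over_n)
      then show "(\<lambda>n. total_mass_nbv M * ((b + 2 * pi) / real (n + m1))) \<longlonglongrightarrow> 0"
        by (rule tendsto_mult_right_zero)
    qed
    have "norm (mat 1 - B \<zeta>) \<le> norm (mat 1 :: complex^'n^'n) + real CARD('n) * real CARD('n) * total_mass_nbv M"
      if "\<zeta> \<in> K" for \<zeta>
    proof -
      have R: "0 \<le> Re \<zeta>" using that K(2) by auto
      have "exp (- (Re \<zeta> * h)) \<le> 1" using R h by simp
      then have "total_mass_nbv M * exp (- (Re \<zeta> * h)) \<le> total_mass_nbv M"
        using total_mass_nbv_nonneg by (intro mult_left_le)
      then have "norm (B \<zeta>) \<le> real CARD('n) * real CARD('n) * total_mass_nbv M"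
        by (intro norm_matrix_le order_trans[OF B_entry_le[OF R]])
      then show ?thesis using norm_triangle_ineq4[of "mat 1" "B \<zeta>"] by linarith
    qed
    then show "bounded ((\<lambda>\<zeta>. mat 1 - B \<zeta>) ` K)" unfolding bounded_iff by blast
  qed
  then show ?thesis unfolding approx_char_eq[OF large, symmetric] .
qed

lemma lattice_zero_in_right_half_plane:
  assumes \<sigma>: "0 < \<sigma>" "det (mat 1 - B (of_real \<sigma>)) = 0"
  obtains m \<zeta> where "m0 \<le> m" "1 / h < real m" "0 < Re \<zeta>" "approx_char m \<zeta> = 0"
proof -
  let ?S = "{\<zeta>. 0 < Re \<zeta>}"
  let ?g = "\<lambda>\<zeta>. det (mat 1 - B \<zeta>)"
  obtain m1 :: nat where m1': "max (1 / h) (real m0) < real m1" using reals_Archimedean2 by blast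
  then have m1: "1 / h < real m1" "m0 \<le> m1" by auto
  have large: "1 / h < real (n + m1)" for n using m1(1) by simp
  have oS: "open ?S" by (rule open_halfspace_Re_gt)
  have ul: "uniform_limit K (\<lambda>n. approx_char (n + m1)) ?g sequentially" if "compact K" "K \<subseteq> ?S" for K
    using that compact_imp_bounded by (intro uniform_limit_approx_char[OF m1(1)]) auto
  have "\<exists>n. \<exists>\<zeta>\<in>?S. approx_char (n + m1) \<zeta> = 0"
  proof (rule ccontr)
    assume neg: "\<not> ?thesis"
    have holg: "?g holomorphic_on ?S"
    proof (rule holomorphic_uniform_sequence[OF oS approx_char_holomorphic[OF large]])
      fix x assume "x \<in> ?S"
      then obtain d where "0 < d" "cball x d \<subseteq> ?S" using oS open_contains_cball by blast
      then show "\<exists>d. 0 < d \<and> cball x d \<subseteq> ?S \<and> uniform_limit (cball x d) (\<lambda>n. approx_char (n + m1)) ?g sequentially"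
        using ul[of "cball x d"] by auto
    qed
    \<comment> \<open>A constant would equal the value 0 taken at \<sigma>, but for large real
      \<zeta> the matrix \<open>B\<close> is too small for the determinant to vanish.\<close>
    have nonconst: "\<not> ?g constant_on ?S"
    proof
      assume "?g constant_on ?S"
      then obtain c where c: "\<And>\<zeta>. 0 < Re \<zeta> \<Longrightarrow> ?g \<zeta> = c" unfolding constant_on_def by blast
      obtain s where s: "\<And>t w. s \<le> t \<Longrightarrow> cmod w \<le> 1 \<Longrightarrow> det (mat 1 - cscale w (B (of_real t))) \<noteq> 0"
        using B_large by blast
      have "cscale 1 (B \<zeta>) = B \<zeta>" for \<zeta> by (simp add: vec_eq_iff)
      then have "?g (of_real (max s \<sigma>)) \<noteq> 0" using s[of "max s \<sigma>" 1] by simp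
      moreover have "?g (of_real (max s \<sigma>)) = ?g (of_real \<sigma>)"
        using c[of "of_real (max s \<sigma>)"] c[of "of_real \<sigma>"] \<sigma>(1) by simp
      ultimately show False using \<sigma>(2) by simp
    qed
    have "connected ?S" by (intro convex_connected convex_halfspace_Re_gt)
    then have "?g (of_real \<sigma>) \<noteq> 0"
      by (rule Hurwitz_no_zeros[OF oS _ approx_char_holomorphic[OF large] holg ul nonconst]) (use neg \<sigma>(1) in auto)
    then show False using \<sigma>(2) by simp
  qed
  then obtain n \<zeta> where "0 < Re \<zeta>" "approx_char (n + m1) \<zeta> = 0" by auto
  then show ?thesis using that[of "n + m1" \<zeta>] m1(2) large[of n] by simp
qed

lemma unstable_lattice_pushforward:
  assumes nrm: "is_norm nrm" and m: "1 / h < real m" and \<zeta>: "0 < Re \<zeta>" "approx_char m \<zeta> = 0"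
  shows "pushforward_nbv (lattice_map m) M \<in> G nrm"
    and "\<not> exponentially_stable nrm (pushforward_nbv (lattice_map m) M)"
proof -
  let ?P = "pushforward_nbv (lattice_map m) M"
  have "?P \<in> W"
    unfolding lattice_map_def[abs_def]
    by (rule lattice_pushforward_W[OF M lattice_index_simple[OF m] lattice_index_range(1)[OF m]])
  moreover have "lattice_system (m * m) (\<lambda>k. measure_of_nbv M (lattice_index m -` {k} \<inter> {-1..0})) ?P"
    unfolding lattice_map_def[abs_def]
    by (rule lattice_pushforward_system[OF M lattice_index_simple[OF m] lattice_index_range(1)[OF m]])
  note omega = spectral_abscissa_eq_omega_lattice[OF nrm this \<zeta>(2)[unfolded approx_char_def]]
  ultimately show "?P \<in> G nrm" using omega(1) \<zeta>(1) by (simp add: G_def)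
  show "\<not> exponentially_stable nrm ?P"
    using omega(2) \<zeta>(1) by (simp add: exponentially_stable_def not_less less_imp_le)
qed

end

lemma rho_HS_greater_one_not_locally_strongly_stable:
  fixes M :: "real \<Rightarrow> real^'n^'n"
  assumes nrm: "is_norm nrm" and M: "M \<in> NBV" and rho: "1 < rho_HS M"
  shows "\<not> locally_strongly_stable nrm M"
proof
  assume "locally_strongly_stable nrm M"
  then obtain \<epsilon> where \<epsilon>: "0 < \<epsilon>" and stable: "\<And>\<phi>. \<phi> \<in> measurable borel_I borel_I \<Longrightarrow>
      sup_norm abs (\<lambda>\<theta>. \<phi> \<theta> - \<theta>) < \<epsilon> \<Longrightarrow> pushforward_nbv \<phi> M \<in> G nrm \<Longrightarrow>
      exponentially_stable nrm (pushforward_nbv \<phi> M)"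
    unfolding locally_strongly_stable_def by blast
  obtain \<xi> where \<xi>: "\<xi> \<in> borel_measurable borel_I"
    and sr: "1 < ereal (spectral_radius (integral_scal M (\<lambda>\<theta>. exp (\<i> * of_real (\<xi> \<theta>)))))"
    using rho unfolding rho_HS_def less_SUP_iff by blast
  \<comment> \<open>Clamping moves a delay by at most h \<le> \<epsilon>/3 and rounding by less than
    1/m < \<epsilon>/3; h \<le> 1/4 keeps -1 + h below -h.\<close>
  define h where "h = min (\<epsilon> / 3) (1 / 4)"
  have h: "0 < h" "h \<le> \<epsilon> / 3" "h \<le> 1 / 4" using \<epsilon> by (auto simp: h_def)
  define \<psi> where "\<psi> x = max (-1 + h) (min (- h) x)" for x :: real
  have \<psi>m: "\<psi> \<in> borel_measurable borel_I"
    unfolding \<psi>_def[abs_def] by (intro borel_measurable_continuous_on_restrict continuous_intros)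
  have \<psi>b: "-1 + h \<le> \<psi> x \<and> \<psi> x \<le> - h" for x using h by (auto simp: \<psi>_def)
  interpret D: damped_integral M \<xi> \<psi> h
    by standard (use M \<xi> \<psi>m h \<psi>b in auto)
  have "1 < spectral_radius (D.B 0)" using sr by (simp add: D.B_def one_ereal_def)
  then obtain w0 where "cmod w0 < 1" "det (mat 1 - cscale w0 (D.B 0)) = 0"
    by (rule det_resolvent_zero_exists)
  then obtain \<sigma> w where \<sigma>: "0 < \<sigma>" "cmod w = 1" "det (mat 1 - cscale w (D.B (of_real \<sigma>))) = 0"
    by (rule D.eigenvalue_crosses_circle)
  \<comment> \<open>Adding the constant Arg w to \<xi> multiplies \<open>B\<close> by w, which moves
    the crossing point on the circle to 1.\<close>
  interpret E: damped_integral M "\<lambda>x. \<xi> x + Arg w" \<psi> h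
    by standard (use M \<xi> \<psi>m h \<psi>b in \<open>auto intro: borel_measurable_add\<close>)
  have w: "exp (\<i> * of_real (Arg w)) = w"
  proof -
    have "w \<noteq> 0" using \<sigma>(2) by auto
    from Arg_eq[OF this] show ?thesis unfolding \<sigma>(2) of_real_1 mult_1 by (rule sym)
  qed
  have "E.B \<zeta> = cscale w (D.B \<zeta>)" for \<zeta>
    unfolding E.B_def D.B_def integral_scal_mult[symmetric]
    by (intro integral_scal_cong) (simp add: distrib_left exp_add w mult.commute mult.left_commute)
  then have zero: "det (mat 1 - E.B (of_real \<sigma>)) = 0" using \<sigma>(3) by simp
  obtain m0 :: nat where m0: "3 / \<epsilon> < real m0" using reals_Archimedean2 by blast
  obtain m \<zeta> where m: "m0 \<le> m" "1 / h < real m" and \<zeta>: "0 < Re \<zeta>" "E.approx_char m \<zeta> = 0"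
    using E.lattice_zero_in_right_half_plane[OF \<sigma>(1) zero] by blast
  have "0 < 3 / \<epsilon>" using \<epsilon> by simp
  then have m': "3 / \<epsilon> < real m" "0 < real m" using m0 m(1) by linarith+
  have close: "\<bar>E.lattice_map m \<theta> - \<theta>\<bar> \<le> 2 / 3 * \<epsilon>" if \<theta>: "\<theta> \<in> {-1..0}" for \<theta>
  proof -
    have "1 / real m < \<epsilon> / 3" using m' \<epsilon> by (simp add: field_simps)
    moreover have "\<bar>E.lattice m \<theta> - \<psi> \<theta>\<bar> < 1 / real m" using m' by (intro E.lattice_close) simp
    moreover have "\<bar>\<psi> \<theta> - \<theta>\<bar> \<le> h" using \<theta> h by (auto simp: \<psi>_def)
    moreover have "E.lattice_map m \<theta> = E.lattice m \<theta>"
      using E.lattice_index_range(2)[OF m(2) \<theta>] by (simp add: E.lattice_map_def)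
    ultimately show ?thesis using h(2) by linarith
  qed
  \<comment> \<open>A fixed margin is kept because a supremum of values below \<epsilon> may equal
    \<epsilon>.\<close>
  have "sup_norm abs (\<lambda>\<theta>. E.lattice_map m \<theta> - \<theta>) \<le> 2 / 3 * \<epsilon>" by (rule sup_norm_least) (rule close)
  also have "\<dots> < \<epsilon>" using \<epsilon> by simp
  finally have "exponentially_stable nrm (pushforward_nbv (E.lattice_map m) M)"
    using stable E.lattice_map_meas[OF m(2)] E.unstable_lattice_pushforward(1)[OF nrm m(2) \<zeta>] by blast
  then show False using E.unstable_lattice_pushforward(2)[OF nrm m(2) \<zeta>] by simp
qed

theorem mainTheorem2:
  fixes nrm :: "real^'n \<Rightarrow> real" and M :: "real \<Rightarrow> real^'n^'n"
  assumes "is_norm nrm"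
    and "M \<in> G nrm"
  shows "(rho_HS M < 1 \<longrightarrow> strongly_stable nrm M \<and> locally_strongly_stable nrm M) \<and>
         (locally_strongly_stable nrm M \<longrightarrow> rho_HS M \<le> 1)"
proof -
  have M: "M \<in> NBV" using assms(2) by (simp add: G_def W_def)
  then show ?thesis
    using rho_HS_less_one_strongly_stable[OF M, of nrm]
      rho_HS_greater_one_not_locally_strongly_stable[OF assms(1) M] by (auto simp: not_less[symmetric])
qed

end
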